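(* Let $Q=(-1,0)\times(-1,1)$ and let $D$ be a fixed nonempty open rectangle with $D\subset\subset Q_{1/2}=(-1/4,0)\times(-1/2,1/2)$. Let $0<\kappa<1$ and $p=\frac{2}{1-\kappa}$. There exists a Borel function $a:Q\to[\kappa,\kappa^{-1}]$ such that the following hold. (i) There exists a solution $u\in W^{1,2}_2(Q)$ of $$u_t-au_{xx}=0\quad\text{a.e. in }Q$$ such that $u$ and $u_x$ are bounded and continuous in $Q$, and there are constants $c,N>0$ such that $$c\,\tau^{-p}\le\big|\{(t,x)\in D:u_{xx}(t,x)>\tau\}\big|\le N\tau^{-p}$$ for all sufficiently large $\tau>0$. In particular, $u_t,u_{xx}\in L_{p,\infty}(D)$ and $u_t,u_{xx}\notin L_p(D)$. (ii) There exist a sequence $\{\phi_j\}_{j\ge1}\subset C_0^\infty(Q)$ and constants $c,N>0$ independent of $j$ such that $$\|\phi_j\|_{L_\infty}+\|\phi_{j,x}\|_{L_\infty}+\|\phi_{j,t}-a\phi_{j,xx}\|_{L_p(Q)}\le N,$$ whereas $$\int_D|\phi_{j,xx}|^p\,dx\,dt\ge c\log j.$$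
   Context: Points are written $(t,x)$ with $t$ time and $x$ space. Rectangles have sides parallel to the $t$- and $x$-axes. $W^{1,2}_2(Q)=\{u:u,u_x,u_t,u_{xx}\in L_2(Q)\}$ (weak derivatives). $L_{p,\infty}$ denotes the weak $L_p$ space, and $|\cdot|$ of a set is Lebesgue measure. $\phi_{j,t},\phi_{j,x},\phi_{j,xx}$ are partial derivatives of $\phi_j$. $D\subset\subset Q_{1/2}$ means that $\overline D$ is a compact subset of $Q_{1/2}$. *)

theory Defs
  imports "HOL-Analysis.Analysis" "HOL-Probability.Essential_Supremum"
begin

text \<open>Points of the plane are pairs \<open>(t, x)\<close>, time first. Lebesgue measure on the plane is
  \<^term>\<open>lebesgue :: (real \<times> real) measure\<close>.\<close>

definition Q :: "(real \<times> real) set"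
  where "Q = {-1<..<0} \<times> {-1<..<1}"

definition Q_half :: "(real \<times> real) set"
  where "Q_half = {-1/4<..<0} \<times> {-1/2<..<1/2}"

definition open_rectangle :: "(real \<times> real) set \<Rightarrow> bool"
  where "open_rectangle D \<longleftrightarrow> (\<exists>t\<^sub>1 t\<^sub>2 x\<^sub>1 x\<^sub>2. D = {t\<^sub>1<..<t\<^sub>2} \<times> {x\<^sub>1<..<x\<^sub>2})"

definition compactly_contained :: "'a::topological_space set \<Rightarrow> 'a set \<Rightarrow> bool"
  where "compactly_contained A B \<longleftrightarrow> compact (closure A) \<and> closure A \<subseteq> B"

definition pd_t :: "(real \<times> real \<Rightarrow> real) \<Rightarrow> real \<times> real \<Rightarrow> real"
  where "pd_t f = (\<lambda>(t, x). deriv (\<lambda>s. f (s, x)) t)"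

definition pd_x :: "(real \<times> real \<Rightarrow> real) \<Rightarrow> real \<times> real \<Rightarrow> real"
  where "pd_x f = (\<lambda>(t, x). deriv (\<lambda>y. f (t, y)) x)"

primrec Ck :: "nat \<Rightarrow> (real \<times> real \<Rightarrow> real) \<Rightarrow> bool" where
  "Ck 0 f \<longleftrightarrow> continuous_on UNIV f"
| "Ck (Suc k) f \<longleftrightarrow>
     (\<forall>t x. (\<lambda>s. f (s, x)) differentiable (at t) \<and> (\<lambda>y. f (t, y)) differentiable (at x)) \<and>
     Ck k (pd_t f) \<and> Ck k (pd_x f)"

text \<open>\<open>C\<^sub>0\<^sup>\<infinity>(\<Omega>)\<close>: elements are functions on the whole plane, extended by zero outside \<open>\<Omega>\<close>.\<close>

definition C0_inf :: "(real \<times> real) set \<Rightarrow> (real \<times> real \<Rightarrow> real) set"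
  where "C0_inf \<Omega> = {\<phi>. (\<forall>k. Ck k \<phi>) \<and> compactly_contained {z. \<phi> z \<noteq> 0} \<Omega>}"

definition Lp :: "real \<Rightarrow> (real \<times> real) set \<Rightarrow> (real \<times> real \<Rightarrow> real) set"
  where "Lp p S = {f. f \<in> borel_measurable (lebesgue_on S) \<and>
    integrable (lebesgue_on S) (\<lambda>z. \<bar>f z\<bar> powr p)}"

definition weak_Lp :: "real \<Rightarrow> (real \<times> real) set \<Rightarrow> (real \<times> real \<Rightarrow> real) set"
  where "weak_Lp p S = {f. f \<in> borel_measurable (lebesgue_on S) \<and>
    (\<exists>C. \<forall>\<tau>>0. emeasure lebesgue {z \<in> S. \<bar>f z\<bar> > \<tau>} \<le> ennreal (C * \<tau> powr (- p)))}"

text \<open>Norms take values in the extended reals and are \<open>\<infinity>\<close> outside the respective space.\<close>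

definition Lp_norm :: "real \<Rightarrow> (real \<times> real) set \<Rightarrow> (real \<times> real \<Rightarrow> real) \<Rightarrow> ereal"
  where "Lp_norm p S f =
    (if f \<in> Lp p S then ereal ((\<integral>z. \<bar>f z\<bar> powr p \<partial>lebesgue_on S) powr (1 / p)) else \<infinity>)"

definition Linf_norm :: "(real \<times> real) set \<Rightarrow> (real \<times> real \<Rightarrow> real) \<Rightarrow> ereal"
  where "Linf_norm S f = esssup (lebesgue_on S) (\<lambda>z. ereal \<bar>f z\<bar>)"

definition locally_integrable :: "(real \<times> real) set \<Rightarrow> (real \<times> real \<Rightarrow> real) \<Rightarrow> bool"
  where "locally_integrable \<Omega> f \<longleftrightarrow> (\<forall>K. compact K \<and> K \<subseteq> \<Omega> \<longrightarrow> f absolutely_integrable_on K)"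

text \<open>\<open>weak_deriv i j \<Omega> u v\<close>: \<open>v\<close> is (a representative of) the weak derivative
  \<open>\<partial>\<^sub>t\<^sup>i \<partial>\<^sub>x\<^sup>j u\<close> in \<open>\<Omega>\<close>.\<close>

definition weak_deriv ::
    "nat \<Rightarrow> nat \<Rightarrow> (real \<times> real) set \<Rightarrow> (real \<times> real \<Rightarrow> real) \<Rightarrow> (real \<times> real \<Rightarrow> real) \<Rightarrow> bool"
  where "weak_deriv i j \<Omega> u v \<longleftrightarrow> locally_integrable \<Omega> u \<and> locally_integrable \<Omega> v \<and>
    (\<forall>\<phi> \<in> C0_inf \<Omega>. (\<integral>z. u z * (pd_t ^^ i) ((pd_x ^^ j) \<phi>) z \<partial>lebesgue_on \<Omega>) =
       (-1) ^ (i + j) * (\<integral>z. v z * \<phi> z \<partial>lebesgue_on \<Omega>))"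

definition W12_2 :: "(real \<times> real) set \<Rightarrow> (real \<times> real \<Rightarrow> real) set"
  where "W12_2 \<Omega> = {u \<in> Lp 2 \<Omega>. \<exists>u\<^sub>t \<in> Lp 2 \<Omega>. \<exists>u\<^sub>x \<in> Lp 2 \<Omega>. \<exists>u\<^sub>x\<^sub>x \<in> Lp 2 \<Omega>.
    weak_deriv 1 0 \<Omega> u u\<^sub>t \<and> weak_deriv 0 1 \<Omega> u u\<^sub>x \<and> weak_deriv 0 2 \<Omega> u u\<^sub>x\<^sub>x}"

end

theory Submission
  imports Defs "HOL-Computational_Algebra.Polynomial"
begin

text \<open>The solution is a staircase laminate. Where \<open>(u\<^sub>t, u\<^sub>x\<^sub>x) = (m, m)\<close>, a rapid oscillation in \<open>x\<close> replaces
  \<open>u\<^sub>x\<^sub>x\<close> by \<open>m + 1\<close> on most of the set and by about \<open>\<kappa> m\<close> on the rest; a rapid oscillation in \<open>t\<close> then does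
  the same to \<open>u\<^sub>t\<close>. All the values satisfy \<open>\<kappa> \<le> u\<^sub>t / u\<^sub>x\<^sub>x \<le> 1 / \<kappa>\<close>, so that \<open>a\<close> can be read off afterwards as
  \<open>u\<^sub>t / u\<^sub>x\<^sub>x\<close>. A step keeps about the fraction \<open>1 - 1 / ((1 - \<kappa>) m)\<close> of the length in each of the two
  variables, hence the set where \<open>u\<^sub>x\<^sub>x\<close> is comparable to \<open>m\<close> or larger has measure of order
  \<open>m powr (- 2 / (1 - \<kappa>)) = m powr (- p)\<close>. The set kept after \<open>n\<close> steps is a product \<open>A n \<times> B n\<close> and every
  correction is a sum of two products of smooth functions of one variable.

  For the second part the staircase is stopped after \<open>j\<close> steps and the initial quadratic polynomial is
  cut off away from \<open>D\<close>. Inside \<open>D\<close> the equation fails only on a set of measure of order \<open>j powr (- p)\<close>,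
  where both derivatives are of order \<open>j\<close>, which costs a bounded amount in \<open>L\<^sub>p\<close>, whereas the integral
  of \<open>\<bar>\<phi>\<^sub>x\<^sub>x\<bar> powr p\<close> collects \<open>1 / n\<close> from every step \<open>n \<le> j\<close>.\<close>

section \<open>Smooth functions of one variable\<close>

text \<open>The shares come from a mean value: the second derivative of a compactly supported
  oscillation has mean zero, so a gain of 1 on the share \<rho> is paid for on the rest by values no
  lower than \<open>\<kappa> * m - m\<close>, which forces \<rho> \<le> (1 - \<kappa>) m (1 -
  \<rho>). Each of the two splittings moves one coordinate of (m, m) only, and its low end sits near
  the boundary of the admissible cone. The obstacle is localisation. Cutting off an x-oscillation in
  t disturbs u_t, and cutting off a t-oscillation in x disturbs u_xx. Each disturbance is a
  derivative of a cutoff times a small oscillation, so the cutoff is fixed first and the frequency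
  afterwards, which makes the disturbance at most 1. A reserve of 2 in the amplitude absorbs it, and
  the starting height absorbs the reserve, so that the exponent is not affected. The amplitudes
  \<open>(1 / 2) ^ n\<close> make u and u_x converge uniformly. The sums for u_t and u_xx converge
  only almost everywhere; they are identified as weak derivatives by dominated convergence, with a
  majorant that is integrable because p > 2.\<close>

primrec smooth_upto :: "nat \<Rightarrow> (real \<Rightarrow> real) \<Rightarrow> bool" where
  "smooth_upto 0 f \<longleftrightarrow> True"
| "smooth_upto (Suc k) f \<longleftrightarrow> (\<forall>x. f differentiable at x) \<and> smooth_upto k (deriv f)"

definition smooth :: "(real \<Rightarrow> real) \<Rightarrow> bool"
  where "smooth f \<longleftrightarrow> (\<forall>k. smooth_upto k f)"

lemma smooth_upto_SucI:
  assumes "\<And>x. (f has_real_derivative f' x) (at x)" "smooth_upto k f'"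
  shows "smooth_upto (Suc k) f"
proof -
  have "deriv f = f'"
    using assms(1) by (auto intro!: DERIV_imp_deriv)
  then show ?thesis
    using assms by (auto simp: real_differentiable_def)
qed

lemma smooth_upto_SucD:
  assumes "smooth_upto (Suc k) f"
  shows "(f has_real_derivative deriv f x) (at x)" "smooth_upto k (deriv f)"
  using assms by (auto simp: DERIV_deriv_iff_real_differentiable)

lemma smooth_upto_mono: "smooth_upto (Suc k) f \<Longrightarrow> smooth_upto k f"
proof (induction k arbitrary: f)
  case (Suc k)
  from Suc.prems have "\<forall>x. f differentiable at x" "smooth_upto (Suc k) (deriv f)"
    by simp_all
  with Suc.IH show ?case
    by simp
qed simp

lemma smooth_has_deriv: "smooth f \<Longrightarrow> (f has_real_derivative deriv f x) (at x)"
  using smooth_upto_SucD(1)[of 0 f] by (auto simp: smooth_def)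

lemma smooth_deriv: "smooth f \<Longrightarrow> smooth (deriv f)"
  unfolding smooth_def using smooth_upto_SucD(2) by blast

lemma smoothI:
  assumes "\<And>x. (f has_real_derivative f' x) (at x)" "smooth f'"
  shows "smooth f"
  unfolding smooth_def
proof
  fix k
  have "smooth_upto k f'"
    using assms(2) by (simp add: smooth_def)
  then show "smooth_upto k f"
    using smooth_upto_SucI[OF assms(1)] smooth_upto_mono by blast
qed

lemma smooth_continuous: "smooth f \<Longrightarrow> continuous_on S f"
  by (meson DERIV_isCont smooth_has_deriv continuous_at_imp_continuous_on)

lemma smooth_const [intro, simp]: "smooth (\<lambda>_. c)"
proof -
  have "smooth_upto k (\<lambda>_. c)" for k
  proof (induction k arbitrary: c)
    case (Suc k)
    then show ?case
      using smooth_upto_SucI[of "\<lambda>_. c" "\<lambda>_. 0"] by auto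
  qed simp
  then show ?thesis
    by (simp add: smooth_def)
qed

lemma smooth_id [intro, simp]: "smooth (\<lambda>x. x)"
  by (rule smoothI[of _ "\<lambda>_. 1"]) auto

lemma smooth_upto_add: "smooth_upto k f \<Longrightarrow> smooth_upto k g \<Longrightarrow> smooth_upto k (\<lambda>x. f x + g x)"
proof (induction k arbitrary: f g)
  case (Suc k)
  show ?case
    by (rule smooth_upto_SucI[of _ "\<lambda>x. deriv f x + deriv g x"])
       (use Suc smooth_upto_SucD in \<open>auto intro!: derivative_eq_intros simp del: smooth_upto.simps\<close>)
qed simp

lemma smooth_upto_mult: "smooth_upto k f \<Longrightarrow> smooth_upto k g \<Longrightarrow> smooth_upto k (\<lambda>x. f x * g x)"
proof (induction k arbitrary: f g)
  case (Suc k)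
  have *: "((\<lambda>x. f x * g x) has_real_derivative deriv f x * g x + f x * deriv g x) (at x)" for x
    using Suc.prems smooth_upto_SucD(1) by (auto intro!: derivative_eq_intros simp del: smooth_upto.simps)
  have "smooth_upto k (\<lambda>x. deriv f x * g x)" "smooth_upto k (\<lambda>x. f x * deriv g x)"
    using Suc smooth_upto_mono smooth_upto_SucD(2) by blast+
  then show ?case
    using smooth_upto_SucI[OF *] smooth_upto_add by blast
qed simp

lemma smooth_add [intro]: "smooth f \<Longrightarrow> smooth g \<Longrightarrow> smooth (\<lambda>x. f x + g x)"
  by (simp add: smooth_def smooth_upto_add)

lemma smooth_mult [intro]: "smooth f \<Longrightarrow> smooth g \<Longrightarrow> smooth (\<lambda>x. f x * g x)"
  by (simp add: smooth_def smooth_upto_mult)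

lemma smooth_minus [intro]: "smooth f \<Longrightarrow> smooth (\<lambda>x. - f x)"
  using smooth_mult[of "\<lambda>_. -1" f] by simp

lemma smooth_diff [intro]: "smooth f \<Longrightarrow> smooth g \<Longrightarrow> smooth (\<lambda>x. f x - g x)"
  using smooth_add[of f "\<lambda>x. - g x"] smooth_minus[of g] by simp

lemma smooth_divide [intro]: "smooth f \<Longrightarrow> smooth (\<lambda>x. f x / c)"
  using smooth_mult[of "\<lambda>_. 1 / c" f] by simp

lemma smooth_sum [intro]: "(\<And>i. i \<in> I \<Longrightarrow> smooth (f i)) \<Longrightarrow> smooth (\<lambda>x. \<Sum>i\<in>I. f i x)"
  by (induction I rule: infinite_finite_induct) auto

lemma smooth_compose_affine:
  assumes "smooth f"
  shows "smooth (\<lambda>x. f (a * x + b))"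
proof -
  \<comment> \<open>The prefactor \<open>c\<close> belongs to the induction because every
    differentiation multiplies it by \<open>a\<close>.\<close>
  have "smooth_upto k f \<Longrightarrow> smooth_upto k (\<lambda>x. c * f (a * x + b))" for k c
  proof (induction k arbitrary: f c)
    case (Suc k)
    have "smooth_upto k (\<lambda>x. (c * a) * deriv f (a * x + b))"
      using Suc smooth_upto_SucD(2) by blast
    moreover have "((\<lambda>x. c * f (a * x + b)) has_real_derivative c * a * deriv f (a * x + b)) (at x)" for x
      by (rule derivative_eq_intros DERIV_chain'[where f = "\<lambda>x. a * x + b" and g = f] smooth_upto_SucD(1)[OF Suc.prems] refl)+
        (auto simp: algebra_simps)
    ultimately show ?case
      by (rule smooth_upto_SucI[rotated])
  qed simp
  from this[of _ 1] show ?thesis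
    using assms by (simp add: smooth_def)
qed

section \<open>Functions flat at the origin, smooth steps and plateaus\<close>

lemma tendsto_poly_mult_exp_minus:
  "((\<lambda>y. poly P y * exp (- y)) \<longlongrightarrow> 0) at_top" for P :: "real poly"
proof -
  have pow: "((\<lambda>y::real. y ^ k * exp (- y)) \<longlongrightarrow> 0) at_top" for k :: nat
    using tendsto_power_div_exp_0[of k] by (simp add: exp_minus divide_inverse)
  have "((\<lambda>y. \<Sum>i\<le>degree P. coeff P i * (y ^ i * exp (- y))) \<longlongrightarrow>
     (\<Sum>i\<le>degree P. coeff P i * 0)) at_top"
    by (intro tendsto_sum tendsto_mult_left pow)
  then show ?thesis
    by (simp add: poly_altdef sum_distrib_right mult.assoc)
qed

text \<open>The polynomial parameter closes the family around exp(-1/x) under differentiation: with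
  y = 1/x, the x-derivative of P(y) exp(-y) is y^2 (P - P')(y) exp(-y). Smoothness is then one
  induction for all \<open>P\<close> at once.\<close>

definition flat_exp :: "real poly \<Rightarrow> real \<Rightarrow> real"
  where "flat_exp P x = (if x > 0 then poly P (1 / x) * exp (- (1 / x)) else 0)"

lemma flat_exp_has_deriv:
  "(flat_exp P has_real_derivative flat_exp (monom 1 2 * (P - pderiv P)) x) (at x)"
proof -
  let ?P' = "monom 1 2 * (P - pderiv P)"
  consider "x < 0" | "x = 0" | "x > 0" by linarith
  then show ?thesis
  proof cases
    case 1
    have "((\<lambda>_. 0) has_real_derivative 0) (at x)" by simp
    then have "(flat_exp P has_real_derivative 0) (at x)"
      by (rule has_field_derivative_transform_within_open[where S = "{..<0}"])
         (use 1 in \<open>auto simp: flat_exp_def\<close>)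
    then show ?thesis using 1 by (simp add: flat_exp_def)
  next
    case 3
    have "((\<lambda>x. poly P (1 / x) * exp (- (1 / x))) has_real_derivative
        poly ?P' (1 / x) * exp (- (1 / x))) (at x)"
      using 3 by (auto intro!: derivative_eq_intros DERIV_chain'[OF _ poly_DERIV]
          simp: poly_monom power2_eq_square field_simps)
    then have "(flat_exp P has_real_derivative poly ?P' (1 / x) * exp (- (1 / x))) (at x)"
      by (rule has_field_derivative_transform_within_open[where S = "{0<..}"])
         (use 3 in \<open>auto simp: flat_exp_def\<close>)
    then show ?thesis using 3 by (simp add: flat_exp_def)
  next
    case 2
    \<comment> \<open>For h > 0 and y = 1/h the difference quotient at 0 is y P(y) exp(-y), and
      \<open>pCons 0 P\<close> is the polynomial y P(y).\<close>
    have "((\<lambda>y. poly (pCons 0 P) y * exp (- y)) \<longlongrightarrow> 0) at_top"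
      by (rule tendsto_poly_mult_exp_minus)
    then have "((\<lambda>h. poly (pCons 0 P) (inverse h) * exp (- inverse h)) \<longlongrightarrow> 0) (at_right 0)"
      by (rule filterlim_compose[OF _ filterlim_inverse_at_top_right])
    then have "((\<lambda>h. flat_exp P h / h) \<longlongrightarrow> 0) (at_right 0)"
      by (rule Lim_transform_eventually)
         (auto simp: flat_exp_def eventually_at_right[of 0 1] field_simps intro!: exI[of _ 1])
    moreover have "((\<lambda>h. flat_exp P h / h) \<longlongrightarrow> 0) (at_left 0)"
      by (rule Lim_transform_eventually[OF tendsto_const])
         (auto simp: flat_exp_def eventually_at_left[of "-1" 0] intro!: exI[of _ "-1"])
    ultimately have "((\<lambda>h. flat_exp P h / h) \<longlongrightarrow> 0) (at 0)"
      by (simp add: filterlim_split_at)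
    then show ?thesis
      using 2 by (simp add: DERIV_def flat_exp_def)
  qed
qed

lemma smooth_flat_exp: "smooth (flat_exp P)"
proof -
  have "smooth_upto k (flat_exp P)" for k
    by (induction k arbitrary: P) (auto intro!: smooth_upto_SucI[OF flat_exp_has_deriv] simp del: smooth_upto.simps(2))
  then show ?thesis
    by (simp add: smooth_def)
qed

lemma ex_antiderivative:
  assumes "smooth f"
  obtains F where "\<And>x. (F has_real_derivative f x) (at x)" "smooth F" "F c = 0"
proof -
  have "\<exists>F. \<forall>x::real. -\<infinity> < ereal x \<longrightarrow> ereal x < \<infinity> \<longrightarrow> (F has_vector_derivative f x) (at x)"
    by (rule einterval_antiderivative)
       (use DERIV_isCont[OF smooth_has_deriv[OF assms]] in auto)
  then obtain F where F: "\<And>x. (F has_real_derivative f x) (at x)"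
    by (auto simp: has_real_derivative_iff_has_vector_derivative)
  have *: "((\<lambda>x. F x - F c) has_real_derivative f x) (at x)" for x
    using F[of x] by (auto intro!: derivative_eq_intros)
  show ?thesis
    using that[OF * smoothI[OF *]] assms by simp
qed

lemma const_on_interval:
  fixes F :: "real \<Rightarrow> real"
  assumes "\<And>x. (F has_real_derivative f x) (at x)" "\<And>x. a \<le> x \<Longrightarrow> x \<le> b \<Longrightarrow> f x = 0" "a \<le> b"
  shows "F a = F b"
proof (cases "a = b")
  case False
  then show ?thesis
    using DERIV_isconst_end[of a b F] assms
    by (metis DERIV_isCont continuous_at_imp_continuous_on less_eq_real_def)
qed simp

text \<open>The primitive of a bump supported in [0, 1], divided by the total mass of the
  bump.\<close>

lemma ex_smooth_step:
  obtains s where "smooth s" "\<And>x. 0 \<le> s x" "\<And>x. s x \<le> 1"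
    "\<And>x. x \<le> 0 \<Longrightarrow> s x = 0" "\<And>x. x \<ge> 1 \<Longrightarrow> s x = 1"
proof -
  define b where "b x = flat_exp 1 x * flat_exp 1 ((-1) * x + 1)" for x
  have "smooth b"
    unfolding b_def by (intro smooth_mult smooth_compose_affine smooth_flat_exp)
  then obtain F where F: "\<And>x. (F has_real_derivative b x) (at x)" "smooth F" "F 0 = 0"
    using ex_antiderivative by metis
  have b0: "b x \<ge> 0" for x
    by (simp add: b_def flat_exp_def)
  have bout: "b x = 0" if "x \<le> 0 \<or> x \<ge> 1" for x
    using that by (auto simp: b_def flat_exp_def)
  have mono: "F x \<le> F y" if "x \<le> y" for x y
    using DERIV_nonneg_imp_nondecreasing[of x y F] that F(1) b0 by blast
  have pos: "F 1 > 0"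
    using DERIV_pos_imp_increasing_open[of 0 1 F] F DERIV_isCont
    by (force simp: b_def flat_exp_def intro!: continuous_at_imp_continuous_on)
  have low: "F x = 0" if "x \<le> 0" for x
    using const_on_interval[OF F(1), of x 0] that bout F(3) by auto
  have high: "F x = F 1" if "x \<ge> 1" for x
    using const_on_interval[OF F(1), of 1 x] that bout by auto
  show ?thesis
  proof (rule that[of "\<lambda>x. F x / F 1"])
    show "smooth (\<lambda>x. F x / F 1)"
      using F by blast
    show "0 \<le> F x / F 1" for x
      using mono[of x 0] mono[of 0 x] low[of x] F(3) pos by (cases "x \<le> 0") auto
    show "F x / F 1 \<le> 1" for x
      using mono[of x 1] high[of x] pos by (cases "x \<le> 1") auto
    show "F x / F 1 = 1" if "x \<ge> 1" for x
      using high[OF that] pos by simp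
  qed (simp add: low)
qed

text \<open>A rising step times its mirror image. The symmetry in the last clause is what later
  makes the first moment of the oscillation profile vanish.\<close>

lemma ex_plateau:
  fixes a b \<eta> :: real
  assumes "\<eta> > 0"
  obtains P where "smooth P" "\<And>x. 0 \<le> P x" "\<And>x. P x \<le> 1"
    "\<And>x. a + \<eta> \<le> x \<Longrightarrow> x \<le> b - \<eta> \<Longrightarrow> P x = 1"
    "\<And>x. x \<le> a \<or> b \<le> x \<Longrightarrow> P x = 0" "\<And>x. P (a + b - x) = P x"
proof -
  obtain s where s: "smooth s" "\<And>x. 0 \<le> s x" "\<And>x. s x \<le> 1"
    "\<And>x. x \<le> 0 \<Longrightarrow> s x = 0" "\<And>x. x \<ge> 1 \<Longrightarrow> s x = 1"
    using ex_smooth_step by metis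
  show ?thesis
  proof (rule that[of "\<lambda>x. s ((1 / \<eta>) * x + (- a / \<eta>)) * s ((- 1 / \<eta>) * x + b / \<eta>)"])
    show "smooth (\<lambda>x. s (1 / \<eta> * x + - a / \<eta>) * s (- 1 / \<eta> * x + b / \<eta>))"
      by (intro smooth_mult smooth_compose_affine s)
    show "s (1 / \<eta> * x + - a / \<eta>) * s (- 1 / \<eta> * x + b / \<eta>) \<le> 1" for x
      using s(2,3) by (simp add: mult_le_one)
    show "s (1 / \<eta> * (a + b - x) + - a / \<eta>) * s (- 1 / \<eta> * (a + b - x) + b / \<eta>) =
         s (1 / \<eta> * x + - a / \<eta>) * s (- 1 / \<eta> * x + b / \<eta>)" for x
      by (simp add: diff_divide_distrib add_divide_distrib)
    fix x
    show "0 \<le> s (1 / \<eta> * x + - a / \<eta>) * s (- 1 / \<eta> * x + b / \<eta>)"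
      using s(2) by simp
    show "s (1 / \<eta> * x + - a / \<eta>) * s (- 1 / \<eta> * x + b / \<eta>) = 1" if "a + \<eta> \<le> x" "x \<le> b - \<eta>"
    proof -
      have "1 / \<eta> * x + - a / \<eta> \<ge> 1" "- 1 / \<eta> * x + b / \<eta> \<ge> 1"
        using that assms by (auto simp: field_simps)
      then show ?thesis using s by simp
    qed
    show "s (1 / \<eta> * x + - a / \<eta>) * s (- 1 / \<eta> * x + b / \<eta>) = 0" if "x \<le> a \<or> b \<le> x"
    proof -
      have "1 / \<eta> * x + - a / \<eta> \<le> 0 \<or> - 1 / \<eta> * x + b / \<eta> \<le> 0"
        using that assms by (auto simp: field_simps)
      then show ?thesis using s by auto
    qed
  qed
qed

section \<open>Cutoffs and oscillations\<close>

lemma deriv_eq_0_outside_closed: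
  fixes f :: "real \<Rightarrow> real"
  assumes "closed K" "\<And>x. x \<notin> K \<Longrightarrow> f x = 0" "x \<notin> K"
  shows "deriv f x = 0"
proof (rule DERIV_imp_deriv)
  show "(f has_real_derivative 0) (at x)"
    by (rule has_field_derivative_transform_within_open[where f = "\<lambda>_. 0" and S = "- K"])
       (use assms in auto)
qed

lemma bounded_of_compact_support:
  fixes f :: "'a::topological_space \<Rightarrow> real"
  assumes "continuous_on UNIV f" "compact K" "\<And>x. x \<notin> K \<Longrightarrow> f x = 0"
  obtains M where "M > 0" "\<And>x. \<bar>f x\<bar> \<le> M"
proof -
  have "compact (f ` K)"
    using assms compact_continuous_image continuous_on_subset by blast
  then obtain M where M: "\<And>x. x \<in> K \<Longrightarrow> \<bar>f x\<bar> \<le> M" "M > 0"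
    using compact_imp_bounded bounded_pos by (metis bounded_pos imageI real_norm_def)
  then have "\<bar>f x\<bar> \<le> M" for x
    using assms(3)[of x] by (cases "x \<in> K") auto
  with M that show ?thesis by blast
qed

text \<open>The second derivative is \<open>P - c R (1 - P)\<close> with plateau functions \<open>P \<le> R\<close> and \<open>c \<le> \<alpha>\<close> making its mean
  zero, which is possible because \<open>\<rho> < \<alpha> (1 - \<rho>)\<close>. It is even about \<open>1 / 2\<close>, so its first moment
  vanishes as well and the double primitive has compact support.\<close>

lemma ex_profile:
  fixes \<alpha> \<rho> :: real
  assumes "0 < \<rho>" "\<rho> < \<alpha> / (\<alpha> + 1)" "0 < \<alpha>"
  obtains \<psi> \<eta> where "smooth \<psi>" "0 < \<eta>" "\<eta> < 1 / 2 - \<rho> / 2"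
    "\<And>x. x \<le> \<eta> \<or> 1 - \<eta> \<le> x \<Longrightarrow> \<psi> x = 0"
    "\<And>x. - \<alpha> \<le> deriv (deriv \<psi>) x" "\<And>x. deriv (deriv \<psi>) x \<le> 1"
    "\<And>x. 1 / 2 - \<rho> / 2 \<le> x \<Longrightarrow> x \<le> 1 / 2 + \<rho> / 2 \<Longrightarrow> deriv (deriv \<psi>) x = 1"
proof -
  \<comment> \<open>This \<eta> solves
    \<open>\<rho> + 2 * \<eta> = \<alpha> * (1 - \<rho> - 6 * \<eta>)\<close>. The left side bounds
    the mass of \<open>P\<close> from above; the factor of \<alpha> bounds the mass of
    \<open>h\<close> from below, as 1 - 4 \<eta> minus the mass of \<open>P\<close>. Hence the
    balancing factor \<open>c\<close> is at most \<alpha>.\<close>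
  define \<eta> where "\<eta> = (\<alpha> * (1 - \<rho>) - \<rho>) / (2 + 6 * \<alpha>)"
  have \<alpha>: "\<rho> < \<alpha> * (1 - \<rho>)"
    using assms by (simp add: field_simps)
  then have \<eta>: "\<eta> > 0" "\<eta> * (2 + 6 * \<alpha>) = \<alpha> * (1 - \<rho>) - \<rho>"
    using assms by (auto simp: \<eta>_def)
  then have balance: "\<rho> + 2 * \<eta> = \<alpha> * (1 - \<rho> - 6 * \<eta>)"
    by (simp add: algebra_simps)
  then have small: "1 - \<rho> - 6 * \<eta> > 0"
    using assms \<eta> by (metis add_pos_pos mult_pos_pos zero_less_mult_pos zero_less_numeral)
  obtain P where P: "smooth P" "\<And>x. 0 \<le> P x" "\<And>x. P x \<le> 1"
    "\<And>x. 1/2 - \<rho>/2 - \<eta> + \<eta> \<le> x \<Longrightarrow> x \<le> 1/2 + \<rho>/2 + \<eta> - \<eta> \<Longrightarrow> P x = 1"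
    "\<And>x. x \<le> 1/2 - \<rho>/2 - \<eta> \<or> 1/2 + \<rho>/2 + \<eta> \<le> x \<Longrightarrow> P x = 0"
    "\<And>x. P (1/2 - \<rho>/2 - \<eta> + (1/2 + \<rho>/2 + \<eta>) - x) = P x"
    using ex_plateau[OF \<eta>(1), of "1/2 - \<rho>/2 - \<eta>" "1/2 + \<rho>/2 + \<eta>"] by metis
  obtain R where R: "smooth R" "\<And>x. 0 \<le> R x" "\<And>x. R x \<le> 1"
    "\<And>x. \<eta> + \<eta> \<le> x \<Longrightarrow> x \<le> 1 - \<eta> - \<eta> \<Longrightarrow> R x = 1"
    "\<And>x. x \<le> \<eta> \<or> 1 - \<eta> \<le> x \<Longrightarrow> R x = 0"
    "\<And>x. R (\<eta> + (1 - \<eta>) - x) = R x"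
    using ex_plateau[OF \<eta>(1), of "\<eta>" "1 - \<eta>"] by metis
  define h where "h x = R x * (1 - P x)" for x
  have h: "smooth h" "\<And>x. 0 \<le> h x" "\<And>x. h x \<le> 1 - P x"
  proof -
    show "smooth h"
      unfolding h_def by (intro smooth_mult smooth_diff smooth_const P R)
    show "0 \<le> h x" "h x \<le> 1 - P x" for x
      using P(2,3)[of x] R(2,3)[of x] by (auto simp: h_def intro!: mult_left_le_one_le)
  qed
  obtain F1 where F1: "\<And>x. (F1 has_real_derivative P x) (at x)" "smooth F1" "F1 0 = 0"
    using ex_antiderivative[OF P(1)] by metis
  obtain F2 where F2: "\<And>x. (F2 has_real_derivative h x) (at x)" "smooth F2" "F2 0 = 0"
    using ex_antiderivative[OF h(1)] by metis
  have "F1 (1/2 - \<rho>/2 - \<eta>) = F1 0" "F1 (1/2 + \<rho>/2 + \<eta>) = F1 1"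
    using const_on_interval[OF F1(1), of 0 "1/2 - \<rho>/2 - \<eta>"]
      const_on_interval[OF F1(1), of "1/2 + \<rho>/2 + \<eta>" 1] P(5) small \<eta> by auto
  moreover have "F1 (1/2 + \<rho>/2 + \<eta>) - (1/2 + \<rho>/2 + \<eta>) \<le> F1 (1/2 - \<rho>/2 - \<eta>) - (1/2 - \<rho>/2 - \<eta>)"
    using assms \<eta>(1) P(3)
    by (intro DERIV_nonpos_imp_nonincreasing[of _ _ "\<lambda>x. F1 x - x"])
       (auto intro!: exI[of _ "P _ - 1"] derivative_eq_intros F1(1))
  ultimately have F1_1: "F1 1 \<le> \<rho> + 2 * \<eta>"
    using F1 by simp
  have F12_mono: "F1 x + F2 x \<le> F1 y + F2 y" if "x \<le> y" for x y
    by (rule DERIV_nonneg_imp_nondecreasing[OF that])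
       (auto intro!: exI[of _ "P _ + h _"] derivative_eq_intros F1(1) F2(1) add_nonneg_nonneg P h)
  \<comment> \<open>On this interval \<open>R\<close> is 1, so \<open>P + h\<close> is 1 there and
    its total mass is at least 1 - 4 \<eta>.\<close>
  have "F1 (2 * \<eta>) + F2 (2 * \<eta>) - 2 * \<eta> \<le> F1 (1 - 2 * \<eta>) + F2 (1 - 2 * \<eta>) - (1 - 2 * \<eta>)"
  proof (rule DERIV_nonneg_imp_nondecreasing[of _ _ "\<lambda>x. F1 x + F2 x - x"])
    show "2 * \<eta> \<le> 1 - 2 * \<eta>"
      using small assms by simp
    show "\<exists>y. ((\<lambda>x. F1 x + F2 x - x) has_real_derivative y) (at x) \<and> 0 \<le> y"
      if "2 * \<eta> \<le> x" "x \<le> 1 - 2 * \<eta>" for x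
      by (rule exI[of _ "P x + h x - 1"])
         (use that R(4)[of x] in \<open>auto intro!: derivative_eq_intros F1(1) F2(1) simp: h_def\<close>)
  qed
  then have "F1 1 + F2 1 \<ge> 1 - 4 * \<eta>"
    using F12_mono[of 0 "2 * \<eta>"] F12_mono[of "1 - 2 * \<eta>" 1] F1(3) F2(3) \<eta>(1) by simp
  then have F2_1: "F2 1 \<ge> 1 - \<rho> - 6 * \<eta>"
    using F1_1 by simp
  have "F1 0 \<le> F1 1"
    by (rule DERIV_nonneg_imp_nondecreasing) (use P(2) F1(1) in auto)
  define c where "c = F1 1 / F2 1"
  have c: "c \<ge> 0" "c * F2 1 = F1 1"
    using \<open>F1 0 \<le> F1 1\<close> F1(3) F2_1 small by (auto simp: c_def)
  have "F1 1 \<le> \<alpha> * F2 1"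
    using F1_1 F2_1 balance assms(3) by (smt (verit) mult_left_mono)
  then have c_le: "c \<le> \<alpha>"
    using F2_1 small by (simp add: c_def divide_le_eq)
  define g where "g x = P x - c * h x" for x
  define k where "k x = F1 x - c * F2 x" for x
  have k: "\<And>x. (k has_real_derivative g x) (at x)" "smooth k" "k 0 = 0" "k 1 = 0"
  proof -
    show "(k has_real_derivative g x) (at x)" for x
      unfolding k_def g_def by (auto intro!: derivative_eq_intros F1(1) F2(1))
    show "smooth k"
      unfolding k_def by (intro smooth_mult smooth_diff smooth_const F1 F2)
  qed (use F1(3) F2(3) c in \<open>simp_all add: k_def\<close>)
  obtain l where l: "\<And>x. (l has_real_derivative k x) (at x)" "smooth l" "l 0 = 0"
    using ex_antiderivative[OF k(2)] by metis
  have sym: "g (1 - x) = g x" for x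
    using P(6)[of x] R(6)[of x] by (simp add: g_def h_def)
  have refl: "((\<lambda>x. f (1 - x)) has_real_derivative - f' (1 - x)) (at x)"
    if "\<And>x. (f has_real_derivative f' x) (at x)" for f f' :: "real \<Rightarrow> real" and x
    by (rule DERIV_cong[OF DERIV_chain'[where f = "\<lambda>x. 1 - x" and D = "-1", OF _ that]])
       (auto intro!: derivative_eq_intros)
  \<comment> \<open>Vanishing of the first moment without computing it: \<open>g\<close> is even
    about 1/2, so \<open>k\<close> is odd about 1/2, so \<open>l\<close> is even and takes at 1 the
    value 0 that it has at 0.\<close>
  have "k (1 - x) + k x = k (1 - 0) + k 0" for x
    by (rule DERIV_isconst_all[of "\<lambda>x. k (1 - x) + k x"])
       (auto intro!: derivative_eq_intros k(1) refl[OF k(1)] simp: sym)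
  then have odd: "k (1 - x) = - k x" for x
    using k(3,4) by (simp add: eq_neg_iff_add_eq_0)
  have "l (1 - 0) - l 0 = l (1 - 1/2) - l (1/2)"
    by (rule DERIV_isconst_all[of "\<lambda>x. l (1 - x) - l x"])
       (auto intro!: derivative_eq_intros l(1) refl[OF l(1)] simp: odd)
  then have l1: "l 1 = 0"
    using l(3) by simp
  have g0: "g x = 0" if "x \<le> \<eta> \<or> 1 - \<eta> \<le> x" for x
    using that P(5)[of x] R(5)[of x] small \<eta>(1) assms(1) by (auto simp: g_def h_def)
  have vanish: "f x = 0" if f: "\<And>x. (f has_real_derivative f' x) (at x)" "f 0 = 0" "f 1 = 0"
    and f': "\<And>x. x \<le> \<eta> \<or> 1 - \<eta> \<le> x \<Longrightarrow> f' x = 0" and x: "x \<le> \<eta> \<or> 1 - \<eta> \<le> x"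
    for f f' :: "real \<Rightarrow> real" and x
  proof -
    consider "x \<le> 0" | "0 \<le> x" "x \<le> \<eta>" | "1 - \<eta> \<le> x" "x \<le> 1" | "1 \<le> x"
      using x by linarith
    then show ?thesis
    proof cases
      case 1 with const_on_interval[OF f(1), of x 0] f' f \<eta> show ?thesis by auto
    next
      case 2 with const_on_interval[OF f(1), of 0 x] f' f \<eta> show ?thesis by auto
    next
      case 3 with const_on_interval[OF f(1), of x 1] f' f \<eta> show ?thesis by auto
    next
      case 4 with const_on_interval[OF f(1), of 1 x] f' f \<eta> show ?thesis by auto
    qed
  qed
  have k0: "k x = 0" if "x \<le> \<eta> \<or> 1 - \<eta> \<le> x" for x
    using vanish[OF k(1,3,4) g0 that] by simp
  have l0: "l x = 0" if "x \<le> \<eta> \<or> 1 - \<eta> \<le> x" for x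
    using vanish[OF l(1,3) l1 k0 that] by simp
  have "deriv l = k" "deriv k = g"
    using k(1) l(1) by (auto intro!: DERIV_imp_deriv)
  then have dd: "deriv (deriv l) = g" by simp
  show ?thesis
  proof (rule that[of l \<eta>])
    show "\<eta> < 1 / 2 - \<rho> / 2"
      using small \<eta> by simp
    show "- \<alpha> \<le> deriv (deriv l) x" for x
    proof -
      have "c * h x \<le> \<alpha> * 1"
        using c c_le assms h(2)[of x] h(3)[of x] P(2)[of x] by (intro mult_mono) auto
      then show ?thesis
        using P(2)[of x] by (simp add: dd g_def)
    qed
    show "deriv (deriv l) x \<le> 1" for x
    proof -
      have "0 \<le> c * h x" using c h by simp
      then show ?thesis using P(3)[of x] by (simp add: dd g_def)
    qed
    show "deriv (deriv l) x = 1" if "1 / 2 - \<rho> / 2 \<le> x" "x \<le> 1 / 2 + \<rho> / 2" for x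
      using P(4)[of x] that by (simp add: dd g_def h_def)
  qed (use l l0 \<eta> in auto)
qed

section \<open>Grids of cells inside an open set\<close>

lemma measure_cells:
  fixes I :: "int set" and S g1 g2 :: real
  assumes "finite I" "S > 0" "0 \<le> g1" "g1 \<le> g2" "g2 \<le> 1"
  shows "measure lebesgue (\<Union>i\<in>I. {(i + g1) / S<..<(i + g2) / S}) = card I * (g2 - g1) / S"
proof -
  have "measure lebesgue (\<Union>i\<in>I. {(i + g1) / S<..<(i + g2) / S}) =
      (\<Sum>i\<in>I. measure lebesgue {(i + g1) / S<..<(i + g2) / S})"
  proof (rule measure_UNION')
    show "pairwise (\<lambda>i j. disjnt {(i + g1) / S<..<(i + g2) / S} {(j + g1) / S<..<(j + g2) / S}) I"
    proof (clarsimp simp: pairwise_def disjnt_iff)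
      fix i j :: int and x
      assume "i \<noteq> j" "(i + g1) / S < x" "x < (i + g2) / S" "(j + g1) / S < x" "x < (j + g2) / S"
      then have "i + g1 < x * S" "x * S < i + g2" "j + g1 < x * S" "x * S < j + g2"
        using assms(2) by (simp_all add: field_simps)
      then have "real_of_int i < j + 1" "real_of_int j < i + 1"
        using assms by linarith+
      with \<open>i \<noteq> j\<close> show False by linarith
    qed
  qed (use assms in auto)
  also have "\<dots> = (\<Sum>i\<in>I. (g2 - g1) / S)"
    using assms by (intro sum.cong) (auto simp: divide_right_mono diff_divide_distrib add_divide_distrib)
  finally show ?thesis by simp
qed

text \<open>By inner regularity a compact \<open>K\<close> inside \<open>A\<close> has measure above
  \<open>r\<close>. It has a positive distance from the complement, so once the mesh 1/S is below
  that distance every cell meeting \<open>K\<close> lies in \<open>A\<close>. The free lower bound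
  \<open>S0\<close> on the frequency is what makes oscillations on the grid small.\<close>

lemma ex_cells:
  fixes A :: "real set"
  assumes "open A" "bounded A" "r < measure lebesgue A"
  obtains S :: real and I :: "int set" where "S \<ge> S0" "S > 0" "finite I"
    "\<And>i. i \<in> I \<Longrightarrow> {i / S..(real_of_int i + 1) / S} \<subseteq> A" "r < card I / S"
proof -
  have A: "A \<in> lmeasurable"
    using assms by (simp add: lmeasurable_open)
  define e where "e = measure lebesgue A - r"
  have "e > 0" using assms by (simp add: e_def)
  obtain K where K: "closed K" "K \<subseteq> A" "A - K \<in> lmeasurable" "emeasure lebesgue (A - K) < ennreal e"
    using sets_lebesgue_inner_closed[OF fmeasurableD[OF A] \<open>e > 0\<close>] by metis
  have "compact K"
    using K assms bounded_subset compact_eq_bounded_closed by blast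
  then have KL: "K \<in> lmeasurable" by (rule lmeasurable_compact)
  have "measure lebesgue (A - K) < e"
    using K(3,4) \<open>e > 0\<close> by (simp add: emeasure_eq_measure2 ennreal_less_iff)
  moreover have "measure lebesgue (A - K) = measure lebesgue A - measure lebesgue K"
    using A KL K by (simp add: measurable_measure_Diff fmeasurableD)
  ultimately have rK: "r < measure lebesgue K" by (simp add: e_def)
  have "closed (- A)" "K \<inter> - A = {}" using assms K by auto
  then obtain d where d: "d > 0" "\<And>x y. x \<in> K \<Longrightarrow> y \<in> - A \<Longrightarrow> d \<le> dist x y"
    using separate_compact_closed[OF \<open>compact K\<close>] by metis
  define S where "S = max 1 (max S0 (2 / d))"
  have S: "S \<ge> S0" "S > 0" "1 / S < d"
  proof -
    have "S \<ge> 2 / d" "S \<ge> 1" by (auto simp: S_def)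
    then have "1 < S * d" using d by (smt (verit) divide_le_eq)
    then show "1 / S < d" using \<open>S \<ge> 1\<close> by (simp add: divide_less_eq mult.commute)
  qed (auto simp: S_def)
  define I where "I = (\<lambda>x. \<lfloor>S * x\<rfloor>) ` K"
  obtain B where B: "\<And>x. x \<in> K \<Longrightarrow> \<bar>x\<bar> \<le> B"
    using compact_imp_bounded[OF \<open>compact K\<close>] bounded_iff by (metis real_norm_def)
  have "I \<subseteq> {\<lfloor>- (S * B)\<rfloor>..\<lfloor>S * B\<rfloor>}"
  proof -
    have "- (S * B) \<le> S * x \<and> S * x \<le> S * B" if "x \<in> K" for x
    proof -
      have "S * (- B) \<le> S * x" "S * x \<le> S * B"
        using B[OF that] S by (intro mult_left_mono; simp)+
      then show ?thesis by simp
    qed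
    then show ?thesis
      by (auto simp: I_def intro!: floor_mono)
  qed
  then have "finite I" using finite_subset by blast
  have cell: "i / S \<le> x \<and> x \<le> (real_of_int i + 1) / S" if "i = \<lfloor>S * x\<rfloor>" for i :: int and x :: real
  proof -
    have "of_int i \<le> S * x" "S * x \<le> of_int i + 1"
      unfolding that by linarith+
    then show ?thesis using S by (simp add: field_simps)
  qed
  have sub: "{i / S..(real_of_int i + 1) / S} \<subseteq> A" if i: "i \<in> I" for i
  proof
    fix y assume y: "y \<in> {i / S..(real_of_int i + 1) / S}"
    obtain x where x: "x \<in> K" "i = \<lfloor>S * x\<rfloor>"
      using i by (auto simp: I_def)
    have "(of_int i + 1) / S = of_int i / S + 1 / S" by (simp add: add_divide_distrib)
    then have "dist x y \<le> 1 / S"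
      using y cell[OF x(2)] by (auto simp: dist_real_def)
    then show "y \<in> A"
      using d(2)[OF x(1), of y] S by force
  qed
  have "K \<subseteq> (\<Union>i\<in>I. {i / S..(real_of_int i + 1) / S})"
    using cell by (auto simp: I_def)
  then have "measure lebesgue K \<le> measure lebesgue (\<Union>i\<in>I. {i / S..(real_of_int i + 1) / S})"
    using \<open>finite I\<close> KL by (intro measure_mono_fmeasurable) (auto simp: fmeasurableD)
  also have "\<dots> \<le> (\<Sum>i\<in>I. measure lebesgue {i / S..(real_of_int i + 1) / S})"
    using \<open>finite I\<close> by (intro measure_UNION_le) auto
  also have "\<dots> = (\<Sum>i\<in>I. 1 / S)"
    using S by (intro sum.cong) (auto simp: divide_right_mono add_divide_distrib)
  finally have "measure lebesgue K \<le> card I / S" by simp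
  with rK have "r < card I / S" by simp
  with S \<open>finite I\<close> sub show ?thesis by (intro that)
qed

lemma sum_cells_cases:
  fixes f :: "real \<Rightarrow> real" and I :: "int set" and S x y :: real
  assumes "finite I" "\<And>x. x \<le> 0 \<or> 1 \<le> x \<Longrightarrow> f x = 0"
  shows "(\<Sum>i\<in>I. f (y - i)) = (if \<lfloor>y\<rfloor> \<in> I then f (y - \<lfloor>y\<rfloor>) else 0)"
proof -
  have "f (y - i) = 0" if "i \<noteq> \<lfloor>y\<rfloor>" for i
  proof (rule assms(2))
    show "y - of_int i \<le> 0 \<or> 1 \<le> y - of_int i"
      using that by linarith
  qed
  then have "(\<Sum>i\<in>I. f (y - i)) = (\<Sum>i\<in>I. if i = \<lfloor>y\<rfloor> then f (y - \<lfloor>y\<rfloor>) else 0)"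
    by (intro sum.cong) auto
  then show ?thesis
    using assms(1) by (simp add: sum.delta)
qed

text \<open>Carries every pointwise bound on \<open>f\<close> over to the sum without loss: at most
  one summand is nonzero, and where the cell is missing the value is 0, which is
  \<open>f 0\<close>.\<close>

lemma sum_cells_in_range:
  fixes f :: "real \<Rightarrow> real" and I :: "int set" and S x y :: real
  assumes "finite I" "\<And>x. x \<le> 0 \<or> 1 \<le> x \<Longrightarrow> f x = 0"
  shows "(\<Sum>i\<in>I. f (y - i)) \<in> range f"
proof -
  have "(\<Sum>i\<in>I. f (y - i)) \<in> {f (y - \<lfloor>y\<rfloor>), f 0}"
    using sum_cells_cases[where f = f and y = y, OF assms] assms(2)[of 0] by auto
  then show ?thesis by blast
qed

lemma sum_cells_eq:
  fixes f :: "real \<Rightarrow> real" and I :: "int set" and S x y :: real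
  assumes "finite I" "\<And>x. x \<le> 0 \<or> 1 \<le> x \<Longrightarrow> f x = 0" "i \<in> I" "0 \<le> y - i" "y - i < 1"
  shows "(\<Sum>i\<in>I. f (y - i)) = f (y - i)"
proof -
  have "\<lfloor>y\<rfloor> = i" using assms by linarith
  then show ?thesis using sum_cells_cases[where f = f and y = y, OF assms(1,2)] assms(3) by simp
qed

lemma smooth_cells:
  fixes I :: "int set" and S :: real
  assumes "smooth f"
  shows "smooth (\<lambda>x. \<Sum>i\<in>I. f (S * x - i))"
    and "deriv (\<lambda>x. c * (\<Sum>i\<in>I. f (S * x - i))) = (\<lambda>x. (c * S) * (\<Sum>i\<in>I. deriv f (S * x - i)))"
proof -
  show "smooth (\<lambda>x. \<Sum>i\<in>I. f (S * x - i))"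
    using smooth_compose_affine[OF assms, of S "- of_int _"] by (intro smooth_sum) simp
  show "deriv (\<lambda>x. c * (\<Sum>i\<in>I. f (S * x - i))) = (\<lambda>x. (c * S) * (\<Sum>i\<in>I. deriv f (S * x - i)))"
  proof (rule ext, rule DERIV_imp_deriv)
    fix x
    have "((\<lambda>x. f (S * x - i)) has_real_derivative S * deriv f (S * x - i)) (at x)" for i :: int
      by (rule DERIV_cong[OF DERIV_chain'[where f = "\<lambda>x. S * x - i" and D = S,
            OF _ smooth_has_deriv[OF assms]]]) (auto intro!: derivative_eq_intros)
    then show "((\<lambda>x. c * (\<Sum>i\<in>I. f (S * x - i))) has_real_derivative
        (c * S) * (\<Sum>i\<in>I. deriv f (S * x - i))) (at x)"
      by (auto intro!: derivative_eq_intros simp: sum_distrib_left mult_ac)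
  qed
qed

lemma cells_support:
  fixes f :: "real \<Rightarrow> real" and I :: "int set" and S x y :: real
  assumes "finite I" "S > 0" "\<And>x. x \<le> 0 \<or> 1 \<le> x \<Longrightarrow> f x = 0"
    and "x \<notin> (\<Union>i\<in>I. {i / S..(real_of_int i + 1) / S})"
  shows "(\<Sum>i\<in>I. f (S * x - i)) = 0"
proof (rule sum.neutral, rule ballI, rule assms(3))
  fix i assume "i \<in> I"
  then have "x < i / S \<or> (real_of_int i + 1) / S < x"
    using assms(4) by force
  then show "S * x - i \<le> 0 \<or> 1 \<le> S * x - i"
    using assms(2) by (auto simp: field_simps)
qed

text \<open>A sum of translated plateaus on a grid, so that the length of the set where the cutoff
  is 1 can be counted. That set is open, hence derivatives of the cutoff vanish on it.\<close>

lemma ex_cutoff: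
  fixes A :: "real set"
  assumes "open A" "bounded A" "0 \<le> r" "r < measure lebesgue A"
  obtains \<zeta> A' K where "smooth \<zeta>" "\<And>x. 0 \<le> \<zeta> x" "\<And>x. \<zeta> x \<le> 1" "compact K" "K \<subseteq> A"
    "\<And>x. x \<notin> K \<Longrightarrow> \<zeta> x = 0" "open A'" "A' \<subseteq> K" "\<And>x. x \<in> A' \<Longrightarrow> \<zeta> x = 1"
    "r < measure lebesgue A'"
proof -
  define r' where "r' = (r + measure lebesgue A) / 2"
  have r': "r < r'" "r' < measure lebesgue A" "r' > 0"
    using assms by (auto simp: r'_def)
  \<comment> \<open>Chosen so that losing the fraction 4 \<eta> of every cell turns
    \<open>r'\<close> into the midpoint of \<open>r\<close> and \<open>r'\<close>.\<close>
  define \<eta> where "\<eta> = (r' - r) / (8 * r')"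
  have \<eta>: "\<eta> > 0" "\<eta> \<le> 1 / 8"
    using r' assms by (auto simp: \<eta>_def field_simps)
  obtain S I where SI: "S > 0" "finite I"
    "\<And>i. i \<in> I \<Longrightarrow> {real_of_int i / S..(real_of_int i + 1) / S} \<subseteq> A" "r' < card I / S"
    using ex_cells[OF assms(1,2) r'(2), of 1] by metis
  obtain P where P: "smooth P" "\<And>x. 0 \<le> P x" "\<And>x. P x \<le> 1"
    "\<And>x. \<eta> + \<eta> \<le> x \<Longrightarrow> x \<le> 1 - \<eta> - \<eta> \<Longrightarrow> P x = 1" "\<And>x. x \<le> \<eta> \<or> 1 - \<eta> \<le> x \<Longrightarrow> P x = 0"
    using ex_plateau[OF \<eta>(1), of "\<eta>" "1 - \<eta>"] by metis
  have P0: "P x = 0" if "x \<le> 0 \<or> 1 \<le> x" for x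
    using P(5)[of x] that \<eta> by auto
  define K where "K = (\<Union>i\<in>I. {real_of_int i / S..(real_of_int i + 1) / S})"
  define A' where "A' = (\<Union>i\<in>I. {(real_of_int i + 2 * \<eta>) / S<..<(i + (1 - 2 * \<eta>)) / S})"
  define \<zeta> where "\<zeta> x = (\<Sum>i\<in>I. P (S * x - i))" for x
  show ?thesis
  proof (rule that[of \<zeta> K A'])
    show "smooth \<zeta>"
      unfolding \<zeta>_def by (rule smooth_cells(1)[OF P(1)])
    have "\<zeta> x \<in> range P" for x
      unfolding \<zeta>_def using sum_cells_in_range[OF SI(2), of P] P0 by blast
    then show "0 \<le> \<zeta> x" "\<zeta> x \<le> 1" for x
      using P by (metis imageE)+
    show "compact K" "K \<subseteq> A"
      using SI by (auto simp: K_def)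
    show "\<zeta> x = 0" if "x \<notin> K" for x
      using cells_support[OF SI(2,1) P0] that by (simp add: \<zeta>_def K_def)
    show "open A'" by (auto simp: A'_def)
    show "A' \<subseteq> K"
      unfolding A'_def K_def
    proof (rule UN_mono[OF order_refl])
      fix i
      have "real_of_int i / S \<le> (i + 2 * \<eta>) / S" "(i + (1 - 2 * \<eta>)) / S \<le> (real_of_int i + 1) / S"
        using SI \<eta> by (auto simp: divide_right_mono)
      then show "{(real_of_int i + 2 * \<eta>) / S<..<(i + (1 - 2 * \<eta>)) / S} \<subseteq> {i / S..(real_of_int i + 1) / S}"
        by auto
    qed
    show "\<zeta> x = 1" if x: "x \<in> A'" for x
    proof -
      obtain i where i: "i \<in> I" "(real_of_int i + 2 * \<eta>) / S < x" "x < (i + (1 - 2 * \<eta>)) / S"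
        using x by (auto simp: A'_def)
      then have *: "2 * \<eta> < S * x - i" "S * x - i < 1 - 2 * \<eta>"
        using SI by (auto simp: field_simps)
      then have "\<zeta> x = P (S * x - i)"
        unfolding \<zeta>_def using \<eta> i by (intro sum_cells_eq[OF SI(2) P0]) auto
      also have "\<dots> = 1" using * by (intro P) auto
      finally show ?thesis .
    qed
    have "measure lebesgue A' = card I * ((1 - 2 * \<eta>) - 2 * \<eta>) / S"
      unfolding A'_def using SI \<eta> by (intro measure_cells) auto
    also have "\<dots> = (card I / S) * (1 - 4 * \<eta>)" by simp
    also have "\<dots> \<ge> r' * (1 - 4 * \<eta>)"
      using SI \<eta> by (intro mult_right_mono) auto
    also have "r' * (1 - 4 * \<eta>) = (r + r') / 2"
      using r' by (simp add: \<eta>_def field_simps)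
    finally show "r < measure lebesgue A'"
      using r' by simp
  qed
qed

text \<open>The profile is repeated on the cells of a fine grid as f(S x - i) / S^2. The second
  derivative keeps its values, whereas the function and its first derivative shrink like 1/S^2 and
  1/S. The kept set is the share \<rho> of each cell, and the cells fill almost all of
  \<open>A\<close>.\<close>

lemma ex_oscillation:
  fixes A :: "real set"
  assumes "open A" "bounded A" "0 < \<alpha>" "0 < \<rho>" "\<rho> < \<alpha> / (\<alpha> + 1)"
    and "r < \<rho> * measure lebesgue A" "0 < \<epsilon>"
  obtains \<psi> A' K where "smooth \<psi>" "compact K" "K \<subseteq> A" "\<And>x. x \<notin> K \<Longrightarrow> \<psi> x = 0"
    "\<And>x. \<bar>\<psi> x\<bar> \<le> \<epsilon>" "\<And>x. \<bar>deriv \<psi> x\<bar> \<le> \<epsilon>"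
    "\<And>x. - \<alpha> \<le> deriv (deriv \<psi>) x" "\<And>x. deriv (deriv \<psi>) x \<le> 1"
    "open A'" "A' \<subseteq> K" "\<And>x. x \<in> A' \<Longrightarrow> deriv (deriv \<psi>) x = 1"
    "r \<le> measure lebesgue A'" "measure lebesgue A' \<le> \<rho> * measure lebesgue A"
proof -
  obtain f \<eta> where f: "smooth f" "0 < \<eta>" "\<eta> < 1 / 2 - \<rho> / 2"
    "\<And>x. x \<le> \<eta> \<or> 1 - \<eta> \<le> x \<Longrightarrow> f x = 0"
    "\<And>x. - \<alpha> \<le> deriv (deriv f) x" "\<And>x. deriv (deriv f) x \<le> 1"
    "\<And>x. 1 / 2 - \<rho> / 2 \<le> x \<Longrightarrow> x \<le> 1 / 2 + \<rho> / 2 \<Longrightarrow> deriv (deriv f) x = 1"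
    using ex_profile[OF assms(4,5,3)] by metis
  have out: "h x = 0" if "\<And>x. x \<notin> {\<eta>..1 - \<eta>} \<Longrightarrow> h x = 0" "x \<le> 0 \<or> 1 \<le> x" for h :: "real \<Rightarrow> real" and x
    using that f(2) by auto
  have f0: "f x = 0" if "x \<notin> {\<eta>..1 - \<eta>}" for x
    using f(4)[of x] that by auto
  have f1: "deriv f x = 0" if "x \<notin> {\<eta>..1 - \<eta>}" for x
    by (rule deriv_eq_0_outside_closed[OF _ f0 that]) auto
  have f2: "deriv (deriv f) x = 0" if "x \<notin> {\<eta>..1 - \<eta>}" for x
    by (rule deriv_eq_0_outside_closed[OF _ f1 that]) auto
  obtain M0 where M0: "\<And>x. \<bar>f x\<bar> \<le> M0" "M0 > 0"
    using bounded_of_compact_support[OF smooth_continuous[OF f(1)] compact_Icc f0] by metis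
  obtain M1 where M1: "\<And>x. \<bar>deriv f x\<bar> \<le> M1" "M1 > 0"
    using bounded_of_compact_support[OF smooth_continuous[OF smooth_deriv[OF f(1)]] compact_Icc f1] by metis
  have "r / \<rho> < measure lebesgue A"
    using assms by (simp add: divide_less_eq mult.commute)
  then obtain S I where SI: "S \<ge> max 1 ((M0 + M1) / \<epsilon>)" "S > 0" "finite I"
    "\<And>i. i \<in> I \<Longrightarrow> {real_of_int i / S..(real_of_int i + 1) / S} \<subseteq> A" "r / \<rho> < card I / S"
    using ex_cells[OF assms(1,2), of "r / \<rho>" "max 1 ((M0 + M1) / \<epsilon>)"] by metis
  have "S \<ge> 1" "(M0 + M1) / \<epsilon> \<le> S" using SI(1) by auto
  then have "M0 + M1 \<le> \<epsilon> * S"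
    using assms by (simp add: divide_le_eq mult.commute)
  then have M: "M0 \<le> \<epsilon> * S" "M1 \<le> \<epsilon> * S" using M0 M1 by auto
  define K where "K = (\<Union>i\<in>I. {real_of_int i / S..(real_of_int i + 1) / S})"
  define A' where "A' = (\<Union>i\<in>I. {(real_of_int i + (1/2 - \<rho>/2)) / S<..<(i + (1/2 + \<rho>/2)) / S})"
  define \<psi> where "\<psi> = (\<lambda>x. (1 / S\<^sup>2) * (\<Sum>i\<in>I. f (S * x - i)))"
  have d1: "deriv \<psi> = (\<lambda>x. (1 / S) * (\<Sum>i\<in>I. deriv f (S * x - i)))"
    unfolding \<psi>_def smooth_cells(2)[OF f(1)] using SI(2) by (simp add: power2_eq_square)
  have d2: "deriv (deriv \<psi>) = (\<lambda>x. (\<Sum>i\<in>I. deriv (deriv f) (S * x - i)))"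
    unfolding d1 smooth_cells(2)[OF smooth_deriv[OF f(1)]] using SI(2) by simp
  have half: "\<rho> < 1" using assms by (smt (verit) divide_less_eq_1)
  have KA: "K \<subseteq> A" using SI by (auto simp: K_def)
  have sub: "A' \<subseteq> K"
    unfolding A'_def K_def
  proof (rule UN_mono[OF order_refl])
    fix i
    have "real_of_int i / S \<le> (i + (1/2 - \<rho>/2)) / S" "(i + (1/2 + \<rho>/2)) / S \<le> (real_of_int i + 1) / S"
      using SI half by (auto simp: divide_right_mono)
    then show "{(real_of_int i + (1/2 - \<rho>/2)) / S<..<(i + (1/2 + \<rho>/2)) / S} \<subseteq> {i / S..(real_of_int i + 1) / S}"
      by auto
  qed
  have meas: "measure lebesgue A' = \<rho> * (card I / S)"
    using measure_cells[OF SI(3,2), of "1/2 - \<rho>/2" "1/2 + \<rho>/2"] half assms(4)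
    by (simp add: A'_def)
  show ?thesis
  proof (rule that[of \<psi> K A'])
    show "smooth \<psi>"
      unfolding \<psi>_def by (intro smooth_mult smooth_const smooth_cells(1) f(1))
    show "compact K" "K \<subseteq> A"
      using SI KA by (auto simp: K_def)
    show "\<psi> x = 0" if "x \<notin> K" for x
      using cells_support[where f = f, OF SI(3,2) out[where h = f, OF f0]] that by (simp add: \<psi>_def K_def)
    show "open A'" by (auto simp: A'_def)
    show "A' \<subseteq> K" by (rule sub)
    show "\<bar>\<psi> x\<bar> \<le> \<epsilon>" for x
    proof -
      have "(\<Sum>i\<in>I. f (S * x - i)) \<in> range f"
        by (rule sum_cells_in_range[OF SI(3) out[where h = f, OF f0]])
      then have "\<bar>\<Sum>i\<in>I. f (S * x - i)\<bar> \<le> M0" using M0(1) by auto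
      also have "M0 \<le> \<epsilon> * S" by (rule M)
      also have "\<dots> \<le> \<epsilon> * S\<^sup>2"
        using \<open>S \<ge> 1\<close> assms by (intro mult_left_mono) (auto simp: power2_eq_square)
      finally show ?thesis
        using SI(2) by (simp add: \<psi>_def abs_mult divide_le_eq)
    qed
    show "\<bar>deriv \<psi> x\<bar> \<le> \<epsilon>" for x
    proof -
      have "(\<Sum>i\<in>I. deriv f (S * x - i)) \<in> range (deriv f)"
        by (rule sum_cells_in_range[OF SI(3) out[where h = "deriv f", OF f1]])
      then have "\<bar>\<Sum>i\<in>I. deriv f (S * x - i)\<bar> \<le> M1" using M1(1) by auto
      also have "M1 \<le> \<epsilon> * S" by (rule M)
      finally show ?thesis
        using SI(2) by (simp add: d1 abs_mult divide_le_eq)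
    qed
    have "deriv (deriv \<psi>) x \<in> range (deriv (deriv f))" for x
      unfolding d2 by (rule sum_cells_in_range[OF SI(3) out[where h = "deriv (deriv f)", OF f2]])
    then show "- \<alpha> \<le> deriv (deriv \<psi>) x" "deriv (deriv \<psi>) x \<le> 1" for x
      using f(5,6) by (metis imageE)+
    show "deriv (deriv \<psi>) x = 1" if x: "x \<in> A'" for x
    proof -
      obtain i where i: "i \<in> I" "(real_of_int i + (1/2 - \<rho>/2)) / S < x" "x < (i + (1/2 + \<rho>/2)) / S"
        using x by (auto simp: A'_def)
      then have *: "1/2 - \<rho>/2 < S * x - i" "S * x - i < 1/2 + \<rho>/2"
        using SI(2) by (auto simp: field_simps)
      then have "deriv (deriv \<psi>) x = deriv (deriv f) (S * x - i)"
        unfolding d2 using half i by (intro sum_cells_eq[OF SI(3) out[where h = "deriv (deriv f)", OF f2]]) auto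
      also have "\<dots> = 1" using * by (intro f) auto
      finally show ?thesis .
    qed
    show "r \<le> measure lebesgue A'"
      using SI(5) assms(4) by (simp add: meas divide_less_eq mult.commute)
    have "card I / S = measure lebesgue (\<Union>i\<in>I. {(real_of_int i + 0) / S<..<(real_of_int i + 1) / S})"
      using measure_cells[OF SI(3,2), of 0 1] by simp
    also have "\<dots> \<le> measure lebesgue A"
    proof (rule measure_mono_fmeasurable)
      show "A \<in> lmeasurable" using assms by (simp add: lmeasurable_open)
      have "(\<Union>i\<in>I. {(real_of_int i + 0) / S<..<(real_of_int i + 1) / S}) \<subseteq> K"
        unfolding K_def by (rule UN_mono) auto
      then show "(\<Union>i\<in>I. {(real_of_int i + 0) / S<..<(real_of_int i + 1) / S}) \<subseteq> A"
        using KA by blast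
    qed auto
    finally show "measure lebesgue A' \<le> \<rho> * measure lebesgue A"
      using assms(4) by (simp add: meas del: times_divide_eq_right)
  qed
qed

section \<open>Sums of products and one step of the staircase\<close>

text \<open>Reduces smoothness in the plane to one variable: the class is closed under
  \<open>pd_t\<close> and \<open>pd_x\<close> and consists of continuous functions, so its members
  satisfy \<open>Ck k\<close> for every \<open>k\<close>.\<close>

inductive tensor_sum :: "(real \<times> real \<Rightarrow> real) \<Rightarrow> bool" where
  tensor_prod: "smooth f \<Longrightarrow> smooth g \<Longrightarrow> tensor_sum (\<lambda>z. f (fst z) * g (snd z))"
| tensor_add: "tensor_sum u \<Longrightarrow> tensor_sum v \<Longrightarrow> tensor_sum (\<lambda>z. u z + v z)"

lemma pd_prod:
  assumes "smooth f" "smooth g"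
  shows "((\<lambda>s. f (fst (s, x)) * g (snd (s, x))) has_real_derivative deriv f t * g x) (at t)"
    and "((\<lambda>y. f (fst (t, y)) * g (snd (t, y))) has_real_derivative f t * deriv g x) (at x)"
    and "pd_t (\<lambda>z. f (fst z) * g (snd z)) = (\<lambda>z. deriv f (fst z) * g (snd z))"
    and "pd_x (\<lambda>z. f (fst z) * g (snd z)) = (\<lambda>z. f (fst z) * deriv g (snd z))"
proof -
  show *: "((\<lambda>s. f (fst (s, x)) * g (snd (s, x))) has_real_derivative deriv f t * g x) (at t)"
    "((\<lambda>y. f (fst (t, y)) * g (snd (t, y))) has_real_derivative f t * deriv g x) (at x)" for t x
    by (auto intro!: derivative_eq_intros smooth_has_deriv assms)
  show "pd_t (\<lambda>z. f (fst z) * g (snd z)) = (\<lambda>z. deriv f (fst z) * g (snd z))"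
    "pd_x (\<lambda>z. f (fst z) * g (snd z)) = (\<lambda>z. f (fst z) * deriv g (snd z))"
    using DERIV_imp_deriv[OF *(1)] DERIV_imp_deriv[OF *(2)] by (auto simp: pd_t_def pd_x_def)
qed

lemma tensor_sum_pd:
  assumes "tensor_sum u"
  shows tensor_sum_has_pd_t: "((\<lambda>s. u (s, x)) has_real_derivative pd_t u (t, x)) (at t)"
    and tensor_sum_has_pd_x: "((\<lambda>y. u (t, y)) has_real_derivative pd_x u (t, x)) (at x)"
    and tensor_sum_pd_t: "tensor_sum (pd_t u)"
    and tensor_sum_pd_x: "tensor_sum (pd_x u)"
    and tensor_sum_continuous: "continuous_on UNIV u"
proof -
  have "(\<forall>t x. ((\<lambda>s. u (s, x)) has_real_derivative pd_t u (t, x)) (at t) \<and>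
      ((\<lambda>y. u (t, y)) has_real_derivative pd_x u (t, x)) (at x)) \<and>
      tensor_sum (pd_t u) \<and> tensor_sum (pd_x u) \<and> continuous_on UNIV u"
    using assms
  proof induction
    case (tensor_prod f g)
    have "continuous_on UNIV (\<lambda>z :: real \<times> real. f (fst z) * g (snd z))"
      by (intro continuous_intros continuous_on_compose2[OF smooth_continuous[OF tensor_prod(1), of UNIV]]
          continuous_on_compose2[OF smooth_continuous[OF tensor_prod(2), of UNIV]] subset_UNIV)
    then show ?case
      using pd_prod[OF tensor_prod] tensor_prod smooth_deriv
      by (auto intro!: tensor_sum.tensor_prod)
  next
    case (tensor_add u v)
    have *: "((\<lambda>s. u (s, x) + v (s, x)) has_real_derivative pd_t u (t, x) + pd_t v (t, x)) (at t)"
      "((\<lambda>y. u (t, y) + v (t, y)) has_real_derivative pd_x u (t, x) + pd_x v (t, x)) (at x)" for t x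
      using tensor_add.IH by (auto intro!: derivative_intros)
    have "pd_t (\<lambda>z. u z + v z) = (\<lambda>z. pd_t u z + pd_t v z)"
      "pd_x (\<lambda>z. u z + v z) = (\<lambda>z. pd_x u z + pd_x v z)"
      using DERIV_imp_deriv[OF *(1)] DERIV_imp_deriv[OF *(2)] by (auto simp: pd_t_def pd_x_def)
    then show ?case
      using * tensor_add.IH by (auto intro!: tensor_sum.tensor_add continuous_intros)
  qed
  then show "((\<lambda>s. u (s, x)) has_real_derivative pd_t u (t, x)) (at t)"
    "((\<lambda>y. u (t, y)) has_real_derivative pd_x u (t, x)) (at x)"
    "tensor_sum (pd_t u)" "tensor_sum (pd_x u)" "continuous_on UNIV u"
    by auto
qed

lemma pd_add:
  assumes "tensor_sum u" "tensor_sum v"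
  shows "pd_t (\<lambda>z. u z + v z) = (\<lambda>z. pd_t u z + pd_t v z)"
    and "pd_x (\<lambda>z. u z + v z) = (\<lambda>z. pd_x u z + pd_x v z)"
proof -
  have *: "((\<lambda>s. u (s, x) + v (s, x)) has_real_derivative pd_t u (t, x) + pd_t v (t, x)) (at t)"
    "((\<lambda>y. u (t, y) + v (t, y)) has_real_derivative pd_x u (t, x) + pd_x v (t, x)) (at x)" for t x
    using tensor_sum_pd assms by (auto intro!: derivative_intros)
  then show "pd_t (\<lambda>z. u z + v z) = (\<lambda>z. pd_t u z + pd_t v z)"
    "pd_x (\<lambda>z. u z + v z) = (\<lambda>z. pd_x u z + pd_x v z)"
    using DERIV_imp_deriv[OF *(1)] DERIV_imp_deriv[OF *(2)] by (auto simp: pd_t_def pd_x_def)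
qed

lemma tensor_sum_Ck: "tensor_sum u \<Longrightarrow> Ck k u"
proof (induction k arbitrary: u)
  case 0
  then show ?case by (simp add: tensor_sum_continuous)
next
  case (Suc k)
  then show ?case
    using tensor_sum_has_pd_t[OF Suc.prems] tensor_sum_has_pd_x[OF Suc.prems]
    by (simp add: tensor_sum_pd_t tensor_sum_pd_x) (meson real_differentiable_def)
qed

lemma tensor_sum_sum:
  fixes w :: "nat \<Rightarrow> real \<times> real \<Rightarrow> real"
  assumes "tensor_sum u" "\<And>k. tensor_sum (w k)"
  shows "tensor_sum (\<lambda>z. u z + (\<Sum>k<n. w k z))"
    and "pd_t (\<lambda>z. u z + (\<Sum>k<n. w k z)) = (\<lambda>z. pd_t u z + (\<Sum>k<n. pd_t (w k) z))"
    and "pd_x (\<lambda>z. u z + (\<Sum>k<n. w k z)) = (\<lambda>z. pd_x u z + (\<Sum>k<n. pd_x (w k) z))"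
proof -
  have "tensor_sum (\<lambda>z. u z + (\<Sum>k<n. w k z)) \<and>
    pd_t (\<lambda>z. u z + (\<Sum>k<n. w k z)) = (\<lambda>z. pd_t u z + (\<Sum>k<n. pd_t (w k) z)) \<and>
    pd_x (\<lambda>z. u z + (\<Sum>k<n. w k z)) = (\<lambda>z. pd_x u z + (\<Sum>k<n. pd_x (w k) z))"
  proof (induction n)
    case (Suc n)
    define v where "v = (\<lambda>z. u z + (\<Sum>k<n. w k z))"
    have eq: "(\<lambda>z. u z + (\<Sum>k<Suc n. w k z)) = (\<lambda>z. v z + w n z)"
      by (simp add: v_def add.assoc)
    have v: "tensor_sum v" "pd_t v = (\<lambda>z. pd_t u z + (\<Sum>k<n. pd_t (w k) z))"
      "pd_x v = (\<lambda>z. pd_x u z + (\<Sum>k<n. pd_x (w k) z))"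
      using Suc by (auto simp: v_def)
    show ?case
      unfolding eq pd_add[OF v(1) assms(2)[of n]] v(2,3)
      using tensor_add[OF v(1) assms(2)[of n]] by (simp add: add.assoc)
  qed (use assms in simp)
  then show "tensor_sum (\<lambda>z. u z + (\<Sum>k<n. w k z))"
    "pd_t (\<lambda>z. u z + (\<Sum>k<n. w k z)) = (\<lambda>z. pd_t u z + (\<Sum>k<n. pd_t (w k) z))"
    "pd_x (\<lambda>z. u z + (\<Sum>k<n. w k z)) = (\<lambda>z. pd_x u z + (\<Sum>k<n. pd_x (w k) z))"
    by auto
qed

text \<open>Here \<open>p\<close> and \<open>s\<close> are the values of u_t and u_xx after a step.
  The last two inequalities are the ellipticity bounds on their ratio; the first four keep both
  comparable to \<open>m\<close>, which controls the distribution of the derivatives.\<close>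

definition admissible :: "real \<Rightarrow> real \<Rightarrow> real \<Rightarrow> real \<Rightarrow> bool"
  where "admissible \<kappa> m p s \<longleftrightarrow>
    \<kappa> * m \<le> p \<and> p \<le> m + 2 \<and> \<kappa> * m \<le> s \<and> s \<le> m + 2 \<and> \<kappa> * s \<le> p \<and> \<kappa> * p \<le> s"

text \<open>The two situations in a step: u_xx oscillates while u_t is m up to an error, or u_t
  oscillates while u_xx is m + 1 up to an error. The low value satisfies m + y \<ge> \<kappa> m + 2,
  and the reserve 2 is enough because the other value is at most m + 2 and \<kappa> (m + 2) \<le>
  \<kappa> m + 2.\<close>

lemma admissible_arith:
  assumes "0 < \<kappa>" "\<kappa> < 1" "2 < (1 - \<kappa>) * m" "\<bar>e\<bar> \<le> 1" "- ((1 - \<kappa>) * m - 2) \<le> y" "y \<le> 1"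
  shows "admissible \<kappa> m (m + e) (m + y)" "admissible \<kappa> m (m + y) (m + 1 + e)"
proof -
  have "\<kappa> * m + 2 < m" using assms(3) by (simp add: algebra_simps)
  have "0 < (1 - \<kappa>) * m" using assms(3) by linarith
  then have "m > 0"
    using assms(2) by (simp add: zero_less_mult_iff)
  have "\<kappa> * m + 2 \<le> m + y" using assms(5) by (simp add: algebra_simps)
  have sub: "\<kappa> * m' \<le> s" if "m' \<le> m + 2" "\<kappa> * m + 2 \<le> s" for m' s
  proof -
    have "\<kappa> * m' \<le> \<kappa> * (m + 2)" using that assms by (intro mult_left_mono) auto
    also have "\<dots> \<le> \<kappa> * m + 2" using assms by (simp add: algebra_simps)
    finally show ?thesis using that by linarith
  qed
  have sub1: "\<kappa> * m' \<le> s" if "m' \<le> m + 1" "\<kappa> * m + 1 \<le> s" for m' s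
  proof -
    have "\<kappa> * m' \<le> \<kappa> * (m + 1)" using that assms by (intro mult_left_mono) auto
    also have "\<dots> \<le> \<kappa> * m + 1" using assms by (simp add: algebra_simps)
    finally show ?thesis using that by linarith
  qed
  have "- 1 \<le> e" "e \<le> 1" using assms(4) by auto
  note bounds = this \<open>\<kappa> * m + 2 < m\<close> \<open>\<kappa> * m + 2 \<le> m + y\<close> assms(6)
  show "admissible \<kappa> m (m + e) (m + y)"
    unfolding admissible_def using bounds by (intro conjI sub1; linarith)
  show "admissible \<kappa> m (m + y) (m + 1 + e)"
    unfolding admissible_def using bounds by (intro conjI sub; linarith)
qed

text \<open>One step of the staircase: on \<open>A \<times> B\<close> the pair \<open>(u\<^sub>t, u\<^sub>x\<^sub>x)\<close> equals \<open>(m, m)\<close>; adding \<open>w\<close> turns it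
  into \<open>(m + 1, m + 1)\<close> on \<open>A' \<times> B'\<close>.\<close>

definition stage ::
    "real \<Rightarrow> real \<Rightarrow> real \<Rightarrow> real \<Rightarrow> real \<Rightarrow> real set \<times> real set \<Rightarrow>
     (real \<times> real \<Rightarrow> real) \<Rightarrow> real set \<times> real set \<Rightarrow> bool"
  where "stage \<kappa> m \<rho> r \<epsilon> = (\<lambda>(A, B) w (A', B').
    tensor_sum w \<and> (\<exists>K. compact K \<and> K \<subseteq> A \<times> B \<and> (\<forall>z. z \<notin> K \<longrightarrow> w z = 0)) \<and>
    (\<forall>z. \<bar>w z\<bar> \<le> \<epsilon> \<and> \<bar>pd_x w z\<bar> \<le> \<epsilon> \<and> admissible \<kappa> m (m + pd_t w z) (m + pd_x (pd_x w) z)) \<and>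
    (\<forall>z\<in>A' \<times> B'. pd_t w z = 1 \<and> pd_x (pd_x w) z = 1) \<and>
    open A' \<and> A' \<subseteq> A \<and> r * measure lebesgue A \<le> measure lebesgue A' \<and>
      measure lebesgue A' \<le> \<rho> * measure lebesgue A \<and>
    open B' \<and> B' \<subseteq> B \<and> r * measure lebesgue B \<le> measure lebesgue B' \<and>
      measure lebesgue B' \<le> \<rho> * measure lebesgue B)"

text \<open>Nested sets \<open>A2 \<subseteq> K4 \<subseteq> A1 \<subseteq> K1 \<subseteq> A\<close>
  and \<open>B2 \<subseteq> K3 \<subseteq> B1 \<subseteq> K2 \<subseteq> B\<close> carry the step:
  the time cutoff \<zeta> is 1 on \<open>A1\<close>, the space oscillation \<psi> gains 1 on
  \<open>B1\<close>, the space cutoff \<xi> lives in \<open>B1\<close> and is 1 on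
  \<open>B2\<close>, and the time oscillation \<theta> lives in \<open>A1\<close> and gains 1 on
  \<open>A2\<close>. Both gains are complete on \<open>A2 \<times> B2\<close>.\<close>

lemma ex_stage:
  fixes A B :: "real set"
  assumes \<kappa>: "0 < \<kappa>" "\<kappa> < 1" and m: "2 < (1 - \<kappa>) * m"
    and r: "0 < r" "r < \<rho>" "\<rho> < ((1 - \<kappa>) * m - 2) / ((1 - \<kappa>) * m - 1)" and "\<epsilon> > 0"
    and A: "open A" "bounded A" "measure lebesgue A > 0"
    and B: "open B" "bounded B" "measure lebesgue B > 0"
  shows "\<exists>w AB'. stage \<kappa> m \<rho> r \<epsilon> (A, B) w AB'"
proof -
  define \<alpha> where "\<alpha> = (1 - \<kappa>) * m - 2"
  have \<alpha>: "\<alpha> > 0" "\<rho> < \<alpha> / (\<alpha> + 1)" "\<rho> > 0"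
    using m r by (auto simp: \<alpha>_def)
  have "\<rho> < 1" using \<alpha> by (smt (verit) divide_less_eq_1)
  \<comment> \<open>In time the cutoff comes first: it may reduce the length by the factor r /
    \<rho>, and the later oscillation keeps nearly the share \<rho>, which leaves at least
    r.\<close>
  have "r / \<rho> * measure lebesgue A < 1 * measure lebesgue A"
    using r A by (intro mult_strict_right_mono) (auto simp: divide_less_eq)
  moreover have "0 \<le> r / \<rho> * measure lebesgue A" using r A by simp
  ultimately obtain \<zeta> A1 K1 where \<zeta>: "smooth \<zeta>" "\<And>x. 0 \<le> \<zeta> x" "\<And>x. \<zeta> x \<le> 1" "compact K1" "K1 \<subseteq> A"
    "\<And>x. x \<notin> K1 \<Longrightarrow> \<zeta> x = 0" "open A1" "A1 \<subseteq> K1" "\<And>x. x \<in> A1 \<Longrightarrow> \<zeta> x = 1"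
    "r / \<rho> * measure lebesgue A < measure lebesgue A1"
    using ex_cutoff[OF A(1,2), of "r / \<rho> * measure lebesgue A"] by (metis mult_1)
  have \<zeta>': "deriv \<zeta> x = 0" if "x \<notin> K1" for x
    using deriv_eq_0_outside_closed[OF compact_imp_closed[OF \<zeta>(4)] \<zeta>(6) that] by simp
  have \<zeta>'1: "deriv \<zeta> x = 0" if "x \<in> A1" for x
  proof (rule DERIV_imp_deriv)
    show "(\<zeta> has_real_derivative 0) (at x)"
      by (rule has_field_derivative_transform_within_open[where f = "\<lambda>_. 1" and S = A1])
         (use \<zeta> that in auto)
  qed
  obtain M1 where M1: "M1 > 0" "\<And>x. \<bar>deriv \<zeta> x\<bar> \<le> M1"
    using bounded_of_compact_support[OF smooth_continuous[OF smooth_deriv[OF \<zeta>(1)]] \<zeta>(4) \<zeta>'] by metis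
  \<comment> \<open>The term \<open>1 / M1\<close> makes the cutoff error \<zeta>' \<psi> at most 1;
    the half of \<epsilon> leaves room for the second product.\<close>
  define \<epsilon>1 where "\<epsilon>1 = min (\<epsilon> / 2) (1 / M1)"
  have \<epsilon>1: "\<epsilon>1 > 0" "\<epsilon>1 \<le> \<epsilon> / 2" "M1 * \<epsilon>1 \<le> 1"
    using M1 \<open>\<epsilon> > 0\<close> by (auto simp: \<epsilon>1_def min_def field_simps)
  \<comment> \<open>In space the oscillation comes first. It keeps at least the share
    \<open>r'\<close>, and the gap between \<open>r\<close> and \<open>r'\<close> is what the cutoff
    \<xi> may lose.\<close>
  define r' where "r' = (r + \<rho>) / 2"
  have r': "r < r'" "r' < \<rho>" using r by (auto simp: r'_def)
  have "r' * measure lebesgue B < \<rho> * measure lebesgue B"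
    using r' B by simp
  then obtain \<psi> B1 K2 where \<psi>: "smooth \<psi>" "compact K2" "K2 \<subseteq> B" "\<And>x. x \<notin> K2 \<Longrightarrow> \<psi> x = 0"
    "\<And>x. \<bar>\<psi> x\<bar> \<le> \<epsilon>1" "\<And>x. \<bar>deriv \<psi> x\<bar> \<le> \<epsilon>1"
    "\<And>x. - \<alpha> \<le> deriv (deriv \<psi>) x" "\<And>x. deriv (deriv \<psi>) x \<le> 1"
    "open B1" "B1 \<subseteq> K2" "\<And>x. x \<in> B1 \<Longrightarrow> deriv (deriv \<psi>) x = 1"
    "r' * measure lebesgue B \<le> measure lebesgue B1" "measure lebesgue B1 \<le> \<rho> * measure lebesgue B"
    using ex_oscillation[OF B(1,2) \<alpha>(1,3,2) _ \<epsilon>1(1)] by metis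
  have "r * measure lebesgue B < measure lebesgue B1"
    using r' B \<psi>(12) by (smt (verit) mult_strict_right_mono)
  moreover have "bounded B1"
    using \<psi> compact_imp_bounded bounded_subset by blast
  moreover have "0 \<le> r * measure lebesgue B" using r by simp
  ultimately obtain \<xi> B2 K3 where \<xi>: "smooth \<xi>" "\<And>x. 0 \<le> \<xi> x" "\<And>x. \<xi> x \<le> 1" "compact K3" "K3 \<subseteq> B1"
    "\<And>x. x \<notin> K3 \<Longrightarrow> \<xi> x = 0" "open B2" "B2 \<subseteq> K3" "\<And>x. x \<in> B2 \<Longrightarrow> \<xi> x = 1"
    "r * measure lebesgue B < measure lebesgue B2"
    using ex_cutoff[OF \<psi>(9)] by metis
  have \<xi>': "deriv \<xi> x = 0" if "x \<notin> K3" for x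
    using deriv_eq_0_outside_closed[OF compact_imp_closed[OF \<xi>(4)] \<xi>(6) that] by simp
  have \<xi>'': "deriv (deriv \<xi>) x = 0" if "x \<notin> K3" for x
    using deriv_eq_0_outside_closed[OF compact_imp_closed[OF \<xi>(4)] \<xi>' that] by simp
  have \<xi>''1: "deriv (deriv \<xi>) x = 0" if "x \<in> B2" for x
  proof -
    have *: "deriv \<xi> x = 0" if "x \<in> B2" for x
    proof (rule DERIV_imp_deriv)
      show "(\<xi> has_real_derivative 0) (at x)"
        by (rule has_field_derivative_transform_within_open[where f = "\<lambda>_. 1" and S = B2])
           (use \<xi> that in auto)
    qed
    show ?thesis
    proof (rule DERIV_imp_deriv)
      show "(deriv \<xi> has_real_derivative 0) (at x)"
        by (rule has_field_derivative_transform_within_open[where f = "\<lambda>_. 0" and S = B2])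
           (use \<xi> * that in auto)
    qed
  qed
  obtain M2 where M2: "M2 > 0" "\<And>x. \<bar>deriv \<xi> x\<bar> \<le> M2"
    using bounded_of_compact_support[OF smooth_continuous[OF smooth_deriv[OF \<xi>(1)]] \<xi>(4) \<xi>'] by metis
  obtain M3 where M3: "M3 > 0" "\<And>x. \<bar>deriv (deriv \<xi>) x\<bar> \<le> M3"
    using bounded_of_compact_support[OF smooth_continuous[OF smooth_deriv[OF smooth_deriv[OF \<xi>(1)]]] \<xi>(4) \<xi>'']
    by metis
  \<comment> \<open>Three demands on \<theta>': the products \<theta>' \<xi> and \<theta>' \<xi>'
    are at most \<epsilon> / 2, and the error \<theta>' \<xi>'' is at most 1.\<close>
  define \<epsilon>2 where "\<epsilon>2 = Min {\<epsilon> / 2, \<epsilon> / 2 / M2, 1 / M3}"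
  have "\<epsilon>2 > 0" using M2 M3 \<open>\<epsilon> > 0\<close> by (simp add: \<epsilon>2_def)
  have "\<epsilon>2 \<le> \<epsilon> / 2" "\<epsilon>2 \<le> \<epsilon> / 2 / M2" "\<epsilon>2 \<le> 1 / M3" by (simp_all add: \<epsilon>2_def)
  then have \<epsilon>2: "\<epsilon>2 > 0" "\<epsilon>2 \<le> \<epsilon> / 2" "M2 * \<epsilon>2 \<le> \<epsilon> / 2" "M3 * \<epsilon>2 \<le> 1"
    using M2 M3 \<open>\<epsilon>2 > 0\<close> by (auto simp: pos_le_divide_eq mult_ac)
  have A1A: "A1 \<subseteq> A" using \<zeta> by blast
  have A1b: "bounded A1" using A1A A bounded_subset by blast
  have rA1: "r * measure lebesgue A < \<rho> * measure lebesgue A1"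
    using \<zeta>(10) \<alpha>(3) by (simp add: field_simps)
  obtain \<theta> A2 K4 where \<theta>: "smooth \<theta>" "compact K4" "K4 \<subseteq> A1" "\<And>x. x \<notin> K4 \<Longrightarrow> \<theta> x = 0"
    "\<And>x. \<bar>\<theta> x\<bar> \<le> \<epsilon>2" "\<And>x. \<bar>deriv \<theta> x\<bar> \<le> \<epsilon>2"
    "\<And>x. - \<alpha> \<le> deriv (deriv \<theta>) x" "\<And>x. deriv (deriv \<theta>) x \<le> 1"
    "open A2" "A2 \<subseteq> K4" "\<And>x. x \<in> A2 \<Longrightarrow> deriv (deriv \<theta>) x = 1"
    "r * measure lebesgue A \<le> measure lebesgue A2" "measure lebesgue A2 \<le> \<rho> * measure lebesgue A1"
    using ex_oscillation[OF \<zeta>(7) A1b \<alpha>(1,3,2) rA1 \<epsilon>2(1)] by metis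
  have \<theta>': "deriv \<theta> x = 0" if "x \<notin> K4" for x
    using deriv_eq_0_outside_closed[OF compact_imp_closed[OF \<theta>(2)] \<theta>(4) that] by simp
  have \<theta>'': "deriv (deriv \<theta>) x = 0" if "x \<notin> K4" for x
    using deriv_eq_0_outside_closed[OF compact_imp_closed[OF \<theta>(2)] \<theta>' that] by simp
  \<comment> \<open>The second product uses \<theta>' because u_t involves one time derivative only:
    the controlled second derivative \<theta>'' has to appear as the first t-derivative of the
    correction.\<close>
  define w where "w = (\<lambda>z. \<zeta> (fst z) * \<psi> (snd z) + deriv \<theta> (fst z) * \<xi> (snd z))"
  have sm: "smooth \<zeta>" "smooth \<psi>" "smooth (deriv \<psi>)" "smooth (deriv \<theta>)" "smooth \<xi>" "smooth (deriv \<xi>)"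
    "smooth (deriv \<zeta>)" "smooth (deriv (deriv \<theta>))"
    using \<zeta>(1) \<psi>(1) \<theta>(1) \<xi>(1) smooth_deriv by blast+
  have tw: "tensor_sum w"
    unfolding w_def by (intro tensor_add tensor_prod sm)
  have wt: "pd_t w = (\<lambda>z. deriv \<zeta> (fst z) * \<psi> (snd z) + deriv (deriv \<theta>) (fst z) * \<xi> (snd z))"
    unfolding w_def by (simp add: pd_add pd_prod tensor_prod sm)
  have wx: "pd_x w = (\<lambda>z. \<zeta> (fst z) * deriv \<psi> (snd z) + deriv \<theta> (fst z) * deriv \<xi> (snd z))"
    unfolding w_def by (simp add: pd_add pd_prod tensor_prod sm)
  have wxx: "pd_x (pd_x w) =
      (\<lambda>z. \<zeta> (fst z) * deriv (deriv \<psi>) (snd z) + deriv \<theta> (fst z) * deriv (deriv \<xi>) (snd z))"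
    unfolding wx by (simp add: pd_add pd_prod tensor_prod sm)
  have supp: "w z = 0" if "z \<notin> K1 \<times> K2" for z
    using that \<zeta>(6,8) \<psi>(4,10) \<theta>' \<theta>(3) \<xi>(5,6) by (auto simp: w_def mem_Times_iff) blast+
  have bound: "\<bar>w z\<bar> \<le> \<epsilon>" for z
  proof -
    have "\<bar>\<zeta> (fst z) * \<psi> (snd z)\<bar> \<le> 1 * \<epsilon>1" "\<bar>deriv \<theta> (fst z) * \<xi> (snd z)\<bar> \<le> \<epsilon>2 * 1"
      unfolding abs_mult using \<zeta>(2,3) \<psi>(5) \<theta>(6) \<xi>(2,3) \<epsilon>2 by (intro mult_mono; simp)+
    then show ?thesis using \<epsilon>1 \<epsilon>2 by (simp add: w_def)
  qed
  have bound_x: "\<bar>pd_x w z\<bar> \<le> \<epsilon>" for z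
  proof -
    have "\<bar>\<zeta> (fst z) * deriv \<psi> (snd z)\<bar> \<le> 1 * \<epsilon>1" "\<bar>deriv \<theta> (fst z) * deriv \<xi> (snd z)\<bar> \<le> \<epsilon>2 * M2"
      unfolding abs_mult using \<zeta>(2,3) \<psi>(6) \<theta>(6) M2 \<epsilon>2 by (intro mult_mono; simp)+
    then show ?thesis using \<epsilon>1 \<epsilon>2 by (simp add: wx mult.commute)
  qed
  \<comment> \<open>On \<open>A1 \<times> B1\<close> the space oscillation is at its high value and
    \<zeta>' vanishes, so u_t oscillates with u_xx near m + 1. Elsewhere the second product
    contributes nothing to u_t or u_xx, and u_xx oscillates with u_t near m.\<close>
  have adm: "admissible \<kappa> m (m + pd_t w z) (m + pd_x (pd_x w) z)" for z
  proof (cases "z \<in> A1 \<times> B1")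
    case True
    have "pd_t w z = deriv (deriv \<theta>) (fst z) * \<xi> (snd z)"
      using True \<zeta>'1 by (auto simp: wt mem_Times_iff)
    moreover have "pd_x (pd_x w) z = 1 + deriv \<theta> (fst z) * deriv (deriv \<xi>) (snd z)"
      using True \<zeta>(9) \<psi>(11) by (auto simp: wxx mem_Times_iff)
    moreover have "\<bar>deriv \<theta> (fst z) * deriv (deriv \<xi>) (snd z)\<bar> \<le> \<epsilon>2 * M3"
      unfolding abs_mult using \<theta>(6) M3 \<epsilon>2 by (intro mult_mono; simp)
    moreover have "- \<alpha> * 1 \<le> deriv (deriv \<theta>) (fst z) * \<xi> (snd z)"
      using \<theta>(7)[of "fst z"] \<xi>(2,3)[of "snd z"] \<alpha>(1)
      by (smt (verit) mult_left_le mult_nonneg_nonneg mult_right_mono mult_minus_left)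
    moreover have "deriv (deriv \<theta>) (fst z) * \<xi> (snd z) \<le> 1 * 1"
      using \<theta>(8)[of "fst z"] \<xi>(2,3)[of "snd z"]
      by (smt (verit) mult_left_le mult_nonneg_nonneg mult_right_mono mult_minus_left)
    ultimately show ?thesis
      using admissible_arith(2)[OF \<kappa> m] \<epsilon>2 by (simp add: \<alpha>_def mult.commute add.assoc[symmetric])
  next
    case False
    have "deriv (deriv \<theta>) (fst z) * \<xi> (snd z) = 0" "deriv \<theta> (fst z) * deriv (deriv \<xi>) (snd z) = 0"
    proof -
      have "fst z \<notin> K4 \<or> snd z \<notin> K3"
        using False \<theta>(3) \<xi>(5) by (auto simp: mem_Times_iff)
      then show "deriv (deriv \<theta>) (fst z) * \<xi> (snd z) = 0" "deriv \<theta> (fst z) * deriv (deriv \<xi>) (snd z) = 0"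
        using \<theta>' \<theta>'' \<xi>(6) \<xi>'' by auto
    qed
    then have "pd_t w z = deriv \<zeta> (fst z) * \<psi> (snd z)"
      "pd_x (pd_x w) z = \<zeta> (fst z) * deriv (deriv \<psi>) (snd z)"
      by (simp_all add: wt wxx)
    moreover have "\<bar>deriv \<zeta> (fst z) * \<psi> (snd z)\<bar> \<le> M1 * \<epsilon>1"
      unfolding abs_mult using \<psi>(5) M1 \<epsilon>1 by (intro mult_mono; simp)
    moreover have "- \<alpha> * 1 \<le> \<zeta> (fst z) * deriv (deriv \<psi>) (snd z)"
      using \<psi>(7)[of "snd z"] \<zeta>(2,3)[of "fst z"] \<alpha>(1)
      by (smt (verit) mult.commute mult_left_le mult_nonneg_nonneg mult_right_mono mult_minus_left)
    moreover have "\<zeta> (fst z) * deriv (deriv \<psi>) (snd z) \<le> 1 * 1"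
      using \<psi>(8)[of "snd z"] \<zeta>(2,3)[of "fst z"]
      by (smt (verit) mult.commute mult_left_le mult_nonneg_nonneg mult_right_mono mult_minus_left)
    ultimately show ?thesis
      using admissible_arith(1)[OF \<kappa> m] \<epsilon>1 by (simp add: \<alpha>_def)
  qed
  have good: "pd_t w z = 1 \<and> pd_x (pd_x w) z = 1" if "z \<in> A2 \<times> B2" for z
    using that \<theta>(3,10,11) \<xi>(5,8,9) \<zeta>(9) \<zeta>'1 \<xi>''1 \<psi>(11)
    by (auto simp: wt wxx mem_Times_iff subset_iff)
  have "measure lebesgue A2 \<le> \<rho> * measure lebesgue A"
  proof -
    have "measure lebesgue A1 \<le> measure lebesgue A"
      using A A1A \<zeta>(7) by (intro measure_mono_fmeasurable) (auto simp: lmeasurable_open)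
    then show ?thesis using \<theta>(13) \<alpha>(3) by (smt (verit) mult_left_mono)
  qed
  moreover have "measure lebesgue B2 \<le> \<rho> * measure lebesgue B"
  proof -
    have "measure lebesgue B2 \<le> measure lebesgue B1"
      using \<xi> \<psi>(9) \<open>bounded B1\<close> by (intro measure_mono_fmeasurable) (auto simp: lmeasurable_open)
    then show ?thesis using \<psi>(13) by linarith
  qed
  ultimately have "stage \<kappa> m \<rho> r \<epsilon> (A, B) w (A2, B2)"
    unfolding stage_def prod.case
    using tw supp bound bound_x adm good \<theta> \<xi> \<zeta> \<psi>
    by (intro conjI exI[of _ "K1 \<times> K2"] compact_Times Sigma_mono) auto
  then show ?thesis by blast
qed

section \<open>Test functions and weak derivatives on Q\<close>

lemma pd_eq_0_outside_closed:
  assumes K: "closed K" "\<And>z. z \<notin> K \<Longrightarrow> f z = 0" and z: "z \<notin> K"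
  shows "pd_t f z = 0" "pd_x f z = 0"
proof -
  obtain t x where tx: "z = (t, x)" by force
  have "continuous_on UNIV (\<lambda>s. (s, x))" "continuous_on UNIV (\<lambda>y. (t, y))"
    by (intro continuous_on_Pair continuous_on_id continuous_on_const)+
  from this[THEN closed_vimage[OF K(1)]]
  have cl: "closed {s. (s, x) \<in> K}" "closed {y. (t, y) \<in> K}"
    by (simp_all add: vimage_def)
  show "pd_t f z = 0"
    using deriv_eq_0_outside_closed[OF cl(1), of "\<lambda>s. f (s, x)" t] K z tx by (simp add: pd_t_def)
  show "pd_x f z = 0"
    using deriv_eq_0_outside_closed[OF cl(2), of "\<lambda>y. f (t, y)" x] K z tx by (simp add: pd_x_def)
qed

lemma C0_infI:
  assumes "\<And>k. Ck k f" "compact K" "K \<subseteq> \<Omega>" "\<And>z. z \<notin> K \<Longrightarrow> f z = 0"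
  shows "f \<in> C0_inf \<Omega>"
proof -
  have "closure {z. f z \<noteq> 0} \<subseteq> K"
    using assms by (intro closure_minimal) (auto simp: compact_imp_closed)
  then have "compactly_contained {z. f z \<noteq> 0} \<Omega>"
    using assms compact_imp_bounded[OF assms(2)] bounded_subset[of K] closure_subset[of "{z. f z \<noteq> 0}"]
    by (auto simp: compactly_contained_def)
  then show ?thesis using assms by (simp add: C0_inf_def)
qed

lemma C0_infD:
  assumes "f \<in> C0_inf \<Omega>"
  shows "continuous_on UNIV f" "pd_t f \<in> C0_inf \<Omega>" "pd_x f \<in> C0_inf \<Omega>"
    "((\<lambda>s. f (s, x)) has_real_derivative pd_t f (t, x)) (at t)"
    "((\<lambda>y. f (t, y)) has_real_derivative pd_x f (t, x)) (at x)"
    "\<exists>K. compact K \<and> K \<subseteq> \<Omega> \<and> (\<forall>z. z \<notin> K \<longrightarrow> f z = 0)"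
proof -
  have Ck: "Ck k f" for k using assms by (simp add: C0_inf_def)
  show "continuous_on UNIV f" using Ck[of 0] by simp
  define K where "K = closure {z. f z \<noteq> 0}"
  have K: "compact K" "K \<subseteq> \<Omega>" "\<And>z. z \<notin> K \<Longrightarrow> f z = 0"
    using assms closure_subset[of "{z. f z \<noteq> 0}"]
    by (auto simp: C0_inf_def compactly_contained_def K_def)
  then show "\<exists>K. compact K \<and> K \<subseteq> \<Omega> \<and> (\<forall>z. z \<notin> K \<longrightarrow> f z = 0)" by blast
  have "Ck k (pd_t f)" "Ck k (pd_x f)" for k using Ck[of "Suc k"] by simp_all
  then show "pd_t f \<in> C0_inf \<Omega>" "pd_x f \<in> C0_inf \<Omega>"
    using pd_eq_0_outside_closed[OF compact_imp_closed[OF K(1)] K(3)] K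
    by (auto intro!: C0_infI[where K = K])
  show "((\<lambda>s. f (s, x)) has_real_derivative pd_t f (t, x)) (at t)"
    "((\<lambda>y. f (t, y)) has_real_derivative pd_x f (t, x)) (at x)"
    using Ck[of 1] by (auto simp: pd_t_def pd_x_def DERIV_deriv_iff_real_differentiable)
qed

lemma C0_inf_bounded:
  assumes "f \<in> C0_inf \<Omega>"
  obtains M where "M > 0" "\<And>z. \<bar>f z\<bar> \<le> M"
proof -
  obtain K where "compact K" "\<And>z. z \<notin> K \<Longrightarrow> f z = 0"
    using C0_infD(6)[OF assms] by blast
  from bounded_of_compact_support[OF C0_infD(1)[OF assms] this] that show thesis
    by blast
qed

section \<open>Integration over Q and integration by parts\<close>

lemma Q_lmeasurable [simp]: "Q \<in> lmeasurable" "Q \<in> sets lebesgue" "Q \<in> sets borel"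
proof -
  have "open Q" "bounded Q" by (auto simp: Q_def open_Times bounded_Times)
  then show "Q \<in> lmeasurable" "Q \<in> sets lebesgue" "Q \<in> sets borel"
    by (auto simp: lmeasurable_open)
qed

lemma integral_lebesgue_on_eq_lborel:
  fixes g :: "real \<times> real \<Rightarrow> real"
  assumes "g \<in> borel_measurable borel" "\<And>z. z \<notin> Q \<Longrightarrow> g z = 0"
  shows "(\<integral>z. g z \<partial>lebesgue_on Q) = (\<integral>z. g z \<partial>lborel)"
proof -
  have "(\<integral>z. g z \<partial>lebesgue_on Q) = (\<integral>z. indicator Q z *\<^sub>R g z \<partial>lebesgue)"
    by (rule integral_restrict_space) simp
  also have "(\<lambda>z. indicator Q z *\<^sub>R g z) = g"
  proof
    fix z show "indicator Q z *\<^sub>R g z = g z"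
      using assms(2)[of z] by (cases "z \<in> Q") auto
  qed
  also have "(\<integral>z. g z \<partial>lebesgue) = (\<integral>z. g z \<partial>lborel)"
    using assms(1) by (intro integral_completion) simp
  finally show ?thesis .
qed

text \<open>The interval (-1, 1) serves both variables, since the time interval (-1, 0) of
  \<open>Q\<close> lies inside it.\<close>

lemma integral_derivative_compact_support:
  fixes G :: "real \<Rightarrow> real"
  assumes "\<And>s. (G has_real_derivative g s) (at s)" "continuous_on UNIV g"
    "\<And>s. s \<notin> {-1<..<1} \<Longrightarrow> G s = 0" "\<And>s. s \<notin> {-1<..<1} \<Longrightarrow> g s = 0"
  shows "(\<integral>s. g s \<partial>lborel) = 0"
proof -
  have "(\<integral>s. indicator {-1..1} s *\<^sub>R g s \<partial>lborel) = G 1 - G (-1)"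
  proof (rule integral_FTC_atLeastAtMost)
    show "(G has_vector_derivative g x) (at x within {-1..1})" for x
      using has_field_derivative_at_within[OF assms(1)]
      by (simp add: has_real_derivative_iff_has_vector_derivative)
  qed (use assms(2) continuous_on_subset in auto)
  also have "(\<lambda>s. indicator {-1..1} s *\<^sub>R g s) = g"
  proof
    fix s show "indicator {-1..1} s *\<^sub>R g s = g s"
      using assms(4)[of s] by (cases "s \<in> {-1<..<1}") (auto simp: indicator_def)
  qed
  finally show ?thesis using assms(3) by simp
qed

text \<open>Fubini with the variable of differentiation integrated first; \<open>G\<close> vanishes
  at both ends of each line.\<close>

lemma integral_pd_zero:
  fixes g G :: "real \<times> real \<Rightarrow> real"
  assumes g: "continuous_on UNIV g" "\<And>z. z \<notin> Q \<Longrightarrow> g z = 0" "\<And>z. z \<notin> Q \<Longrightarrow> G z = 0"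
    and der: "(\<forall>t x. ((\<lambda>s. G (s, x)) has_real_derivative g (t, x)) (at t)) \<or>
      (\<forall>t x. ((\<lambda>y. G (t, y)) has_real_derivative g (t, x)) (at x))"
  shows "(\<integral>z. g z \<partial>lebesgue_on Q) = 0"
proof -
  have meas: "g \<in> borel_measurable borel" using g by (simp add: borel_measurable_continuous_onI)
  have "integrable lborel (\<lambda>z. indicator (cbox (-1, -1) (0, 1)) z *\<^sub>R g z)"
    by (rule borel_integrable_compact) (use g in \<open>auto intro: continuous_on_subset\<close>)
  moreover have "(\<lambda>z. indicator (cbox (-1, -1) (0, 1)) z *\<^sub>R g z) = g"
  proof
    fix z
    have "Q \<subseteq> cbox (-1, -1) (0, 1)" by (auto simp: Q_def cbox_Pair_eq)
    then show "indicator (cbox (-1, -1) (0, 1)) z *\<^sub>R g z = g z"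
      using g(2)[of z] by (cases "z \<in> Q") (auto simp: indicator_def)
  qed
  ultimately have int: "integrable (lborel \<Otimes>\<^sub>M lborel) (\<lambda>(t, x). g (t, x))"
    by (simp add: lborel_prod)
  have c: "continuous_on UNIV (\<lambda>s. g (s, x))" "continuous_on UNIV (\<lambda>y. g (t, y))" for t x
    by (rule continuous_on_compose2[OF g(1)], auto intro!: continuous_on_Pair continuous_on_id continuous_on_const)+
  have "(\<integral>z. g z \<partial>lborel) = 0"
    using der
  proof
    assume d: "\<forall>t x. ((\<lambda>s. G (s, x)) has_real_derivative g (t, x)) (at t)"
    have "(\<integral>t. g (t, x) \<partial>lborel) = 0" for x
      by (rule integral_derivative_compact_support[of "\<lambda>s. G (s, x)"])
         (use d g c in \<open>auto simp: Q_def\<close>)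
    moreover have "(\<integral>x. \<integral>t. g (t, x) \<partial>lborel \<partial>lborel) = (\<integral>z. g z \<partial>lborel)"
      using lborel_pair.integral_snd[of "\<lambda>t x. g (t, x)", OF int] by (simp add: lborel_prod case_prod_beta')
    ultimately show ?thesis by simp
  next
    assume d: "\<forall>t x. ((\<lambda>y. G (t, y)) has_real_derivative g (t, x)) (at x)"
    have "(\<integral>x. g (t, x) \<partial>lborel) = 0" for t
      by (rule integral_derivative_compact_support[of "\<lambda>y. G (t, y)"])
         (use d g c in \<open>auto simp: Q_def\<close>)
    moreover have "(\<integral>t. \<integral>x. g (t, x) \<partial>lborel \<partial>lborel) = (\<integral>z. g z \<partial>lborel)"
      using lborel_pair.integral_fst[of "\<lambda>t x. g (t, x)", OF int] by (simp add: lborel_prod case_prod_beta')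
    ultimately show ?thesis by simp
  qed
  then show ?thesis using integral_lebesgue_on_eq_lborel[OF meas g(2)] by simp
qed

lemma integrable_lebesgue_on_Q_bounded:
  fixes f :: "real \<times> real \<Rightarrow> real"
  assumes "f \<in> borel_measurable borel" "\<And>z. z \<in> Q \<Longrightarrow> \<bar>f z\<bar> \<le> M"
  shows "integrable (lebesgue_on Q) f"
proof -
  have M: "integrable (lebesgue_on Q) (\<lambda>_. M)"
    by (rule finite_measure.integrable_const[OF finite_measure_lebesgue_on]) simp
  have "AE z in lebesgue_on Q. norm (f z) \<le> norm M"
    by (rule AE_I2) (use assms(2) in force)
  moreover have "f \<in> borel_measurable (lebesgue_on Q)"
    using assms(1) by (intro measurable_restrict_space1 measurable_completion) simp
  ultimately show ?thesis by (rule Bochner_Integration.integrable_bound[OF M, rotated])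
qed

text \<open>The product of \<open>v\<close> and \<phi> vanishes outside \<open>Q\<close>, so the
  integral of its partial derivative is 0. Nothing is asked of the boundary values of
  \<open>v\<close>.\<close>

lemma integration_by_parts:
  fixes v :: "real \<times> real \<Rightarrow> real"
  assumes v: "continuous_on UNIV v" and \<phi>: "\<phi> \<in> C0_inf Q"
  shows integration_by_parts_t: "continuous_on UNIV v' \<Longrightarrow>
      (\<And>t x. ((\<lambda>s. v (s, x)) has_real_derivative v' (t, x)) (at t)) \<Longrightarrow>
      (\<integral>z. v z * pd_t \<phi> z \<partial>lebesgue_on Q) = - (\<integral>z. v' z * \<phi> z \<partial>lebesgue_on Q)"
    and integration_by_parts_x: "continuous_on UNIV v' \<Longrightarrow>
      (\<And>t x. ((\<lambda>y. v (t, y)) has_real_derivative v' (t, x)) (at x)) \<Longrightarrow>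
      (\<integral>z. v z * pd_x \<phi> z \<partial>lebesgue_on Q) = - (\<integral>z. v' z * \<phi> z \<partial>lebesgue_on Q)"
proof -
  have main: "(\<integral>z. v z * \<psi> z \<partial>lebesgue_on Q) = - (\<integral>z. v' z * \<phi> z \<partial>lebesgue_on Q)"
    if \<psi>: "\<psi> \<in> C0_inf Q" and v': "continuous_on UNIV v'"
      and der: "(\<forall>t x. ((\<lambda>s. v (s, x) * \<phi> (s, x)) has_real_derivative v (t, x) * \<psi> (t, x) + v' (t, x) * \<phi> (t, x)) (at t)) \<or>
        (\<forall>t x. ((\<lambda>y. v (t, y) * \<phi> (t, y)) has_real_derivative v (t, x) * \<psi> (t, x) + v' (t, x) * \<phi> (t, x)) (at x))"
    for \<psi> v'
  proof -
    have out: "\<phi> z = 0" "\<psi> z = 0" if "z \<notin> Q" for z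
      using C0_infD(6)[OF \<phi>] C0_infD(6)[OF \<psi>] that by blast+
    have cont: "continuous_on UNIV (\<lambda>z. v z * \<psi> z)" "continuous_on UNIV (\<lambda>z. v' z * \<phi> z)"
      using v v' C0_infD(1)[OF \<phi>] C0_infD(1)[OF \<psi>] by (auto intro!: continuous_intros)
    have int: "integrable (lebesgue_on Q) f" if f: "continuous_on UNIV f" for f :: "real \<times> real \<Rightarrow> real"
    proof -
      have "compact (f ` cbox (-1, -1) (0, 1))"
        using f by (intro compact_continuous_image compact_cbox) (auto intro: continuous_on_subset)
      then obtain M where M: "\<And>z. z \<in> cbox (-1, -1) (0, 1) \<Longrightarrow> norm (f z) \<le> M"
        using compact_imp_bounded bounded_iff by (metis imageI)
      have "Q \<subseteq> cbox (-1, -1) (0, 1)" by (auto simp: Q_def cbox_Pair_eq)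
      then show ?thesis
        using f M by (intro integrable_lebesgue_on_Q_bounded[of _ M])
          (auto simp: borel_measurable_continuous_onI)
    qed
    have "(\<integral>z. v z * \<psi> z + v' z * \<phi> z \<partial>lebesgue_on Q) = 0"
      by (rule integral_pd_zero[where G = "\<lambda>z. v z * \<phi> z"])
         (use cont out der in \<open>auto intro!: continuous_intros\<close>)
    also have "(\<integral>z. v z * \<psi> z + v' z * \<phi> z \<partial>lebesgue_on Q) =
        (\<integral>z. v z * \<psi> z \<partial>lebesgue_on Q) + (\<integral>z. v' z * \<phi> z \<partial>lebesgue_on Q)"
      using cont by (intro Bochner_Integration.integral_add int)
    finally show ?thesis by simp
  qed
  show "(\<integral>z. v z * pd_t \<phi> z \<partial>lebesgue_on Q) = - (\<integral>z. v' z * \<phi> z \<partial>lebesgue_on Q)"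
    if v': "continuous_on UNIV v'" and der: "\<And>t x. ((\<lambda>s. v (s, x)) has_real_derivative v' (t, x)) (at t)"
    by (rule main[OF C0_infD(2)[OF \<phi>] v'])
       (auto intro!: disjI1 derivative_eq_intros der C0_infD(4)[OF \<phi>])
  show "(\<integral>z. v z * pd_x \<phi> z \<partial>lebesgue_on Q) = - (\<integral>z. v' z * \<phi> z \<partial>lebesgue_on Q)"
    if v': "continuous_on UNIV v'" and der: "\<And>t x. ((\<lambda>y. v (t, y)) has_real_derivative v' (t, x)) (at x)"
    by (rule main[OF C0_infD(3)[OF \<phi>] v'])
       (auto intro!: disjI2 derivative_eq_intros der C0_infD(5)[OF \<phi>])
qed

lemma locally_integrable_Q:
  assumes "integrable (lebesgue_on Q) f"
  shows "locally_integrable Q f"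
  unfolding locally_integrable_def
proof (intro allI impI)
  fix K assume K: "compact K \<and> K \<subseteq> Q"
  have "set_integrable lebesgue Q f"
    using assms integrable_restrict_space[of Q lebesgue f] by (simp add: set_integrable_def)
  then show "f absolutely_integrable_on K"
    by (rule set_integrable_subset) (use K in \<open>auto intro: fmeasurableD lmeasurable_compact\<close>)
qed

lemma tendsto_integral_test:
  assumes "\<And>j. f j \<in> borel_measurable (lebesgue_on Q)" "F \<in> borel_measurable (lebesgue_on Q)"
    and "AE z in lebesgue_on Q. (\<lambda>j. f j z) \<longlonglongrightarrow> F z"
    and "\<And>j. AE z in lebesgue_on Q. \<bar>f j z\<bar> \<le> H z" "integrable (lebesgue_on Q) H"
    and \<phi>: "\<phi> \<in> C0_inf Q"
  shows "(\<lambda>j. \<integral>z. f j z * \<phi> z \<partial>lebesgue_on Q) \<longlonglongrightarrow> (\<integral>z. F z * \<phi> z \<partial>lebesgue_on Q)"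
proof -
  obtain M where M: "M > 0" "\<And>z. \<bar>\<phi> z\<bar> \<le> M" using C0_inf_bounded[OF \<phi>] by metis
  have [measurable]: "\<phi> \<in> borel_measurable (lebesgue_on Q)"
    using C0_infD(1)[OF \<phi>] by (intro measurable_restrict_space1 measurable_completion) (simp add: borel_measurable_continuous_onI)
  note [measurable] = assms(1,2)
  show ?thesis
  proof (rule integral_dominated_convergence[where w = "\<lambda>z. H z * M"])
    show "AE z in lebesgue_on Q. (\<lambda>j. f j z * \<phi> z) \<longlonglongrightarrow> F z * \<phi> z"
      using assms(3) by eventually_elim (intro tendsto_mult_right)
    show "AE z in lebesgue_on Q. norm (f j z * \<phi> z) \<le> H z * M" for j
      using assms(4)[of j]
    proof eventually_elim
      case (elim z)
      have "\<bar>f j z\<bar> * \<bar>\<phi> z\<bar> \<le> H z * M" using elim M(2)[of z] by (intro mult_mono) auto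
      then show ?case by (simp add: abs_mult)
    qed
  qed (use assms(5) in auto)
qed

text \<open>Both sides of the integration by parts pass to the limit under one integrable majorant.
  Almost everywhere convergence suffices, which is all that is available for u_t and u_xx.\<close>

lemma weak_deriv_limit:
  assumes f: "\<And>j. f j \<in> borel_measurable (lebesgue_on Q)" "F \<in> borel_measurable (lebesgue_on Q)"
      "AE z in lebesgue_on Q. (\<lambda>j. f j z) \<longlonglongrightarrow> F z"
      "\<And>j. AE z in lebesgue_on Q. \<bar>f j z\<bar> \<le> H z" "AE z in lebesgue_on Q. \<bar>F z\<bar> \<le> H z"
    and g: "\<And>j. g j \<in> borel_measurable (lebesgue_on Q)" "G \<in> borel_measurable (lebesgue_on Q)"
      "AE z in lebesgue_on Q. (\<lambda>j. g j z) \<longlonglongrightarrow> G z"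
      "\<And>j. AE z in lebesgue_on Q. \<bar>g j z\<bar> \<le> H z" "AE z in lebesgue_on Q. \<bar>G z\<bar> \<le> H z"
    and H: "integrable (lebesgue_on Q) H"
    and ibp: "\<And>j \<phi>. \<phi> \<in> C0_inf Q \<Longrightarrow> (\<integral>z. f j z * (pd_t ^^ i) ((pd_x ^^ k) \<phi>) z \<partial>lebesgue_on Q) =
       (-1) ^ (i + k) * (\<integral>z. g j z * \<phi> z \<partial>lebesgue_on Q)"
  shows "weak_deriv i k Q F G"
  unfolding weak_deriv_def
proof (intro conjI ballI)
  have dom: "integrable (lebesgue_on Q) h"
    if "h \<in> borel_measurable (lebesgue_on Q)" "AE z in lebesgue_on Q. \<bar>h z\<bar> \<le> H z" for h
    by (rule Bochner_Integration.integrable_bound[OF H that(1)])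
       (use that(2) in \<open>auto elim!: eventually_mono\<close>)
  show "locally_integrable Q F" "locally_integrable Q G"
    by (rule locally_integrable_Q[OF dom[OF f(2,5)]], rule locally_integrable_Q[OF dom[OF g(2,5)]])
  fix \<phi> assume \<phi>: "\<phi> \<in> C0_inf Q"
  have "(pd_x ^^ k) \<phi> \<in> C0_inf Q" by (induction k) (auto intro: \<phi> C0_infD(3))
  then have D: "(pd_t ^^ i) ((pd_x ^^ k) \<phi>) \<in> C0_inf Q" by (induction i) (auto intro: C0_infD(2))
  have "(\<lambda>j. \<integral>z. f j z * (pd_t ^^ i) ((pd_x ^^ k) \<phi>) z \<partial>lebesgue_on Q) \<longlonglongrightarrow>
      (\<integral>z. F z * (pd_t ^^ i) ((pd_x ^^ k) \<phi>) z \<partial>lebesgue_on Q)"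
    by (rule tendsto_integral_test[OF f(1-4) H D])
  moreover have "(\<lambda>j. (-1) ^ (i + k) * (\<integral>z. g j z * \<phi> z \<partial>lebesgue_on Q)) \<longlonglongrightarrow>
      (-1) ^ (i + k) * (\<integral>z. G z * \<phi> z \<partial>lebesgue_on Q)"
    by (intro tendsto_mult_left tendsto_integral_test[OF g(1-4) H \<phi>])
  ultimately show "(\<integral>z. F z * (pd_t ^^ i) ((pd_x ^^ k) \<phi>) z \<partial>lebesgue_on Q) =
      (-1) ^ (i + k) * (\<integral>z. G z * \<phi> z \<partial>lebesgue_on Q)"
    unfolding ibp[OF \<phi>] by (rule LIMSEQ_unique)
qed

section \<open>The staircase\<close>

text \<open>The offset gives (1 - \<kappa>) height = (1 - \<kappa>) (n + 3) + 2. The summand 2 pays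
  for the reserve in \<open>admissible_arith\<close>, and the amplitude left for step
  \<open>n\<close> is (1 - \<kappa>) (n + 3).\<close>

definition height :: "real \<Rightarrow> nat \<Rightarrow> real"
  where "height \<kappa> n = real n + 3 + 2 / (1 - \<kappa>)"

text \<open>The share of length kept in step \<open>n\<close>, in time and in space, lies between \<open>ratio n\<close> and
  \<open>ratio (n + 1)\<close>. Both products telescope to multiples of \<open>n powr (- 1 / (1 - \<kappa>))\<close>.\<close>

definition ratio :: "real \<Rightarrow> nat \<Rightarrow> real"
  where "ratio \<kappa> n = ((real n + 1) / (real n + 2)) powr (1 / (1 - \<kappa>))"

lemma lmeasurable_open_Times:
  fixes A B :: "real set"
  assumes "open A" "bounded A" "open B" "bounded B"
  shows "A \<times> B \<in> lmeasurable" "measure lebesgue (A \<times> B) = measure lebesgue A * measure lebesgue B"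
proof -
  show *: "A \<times> B \<in> lmeasurable"
    using assms by (simp add: lmeasurable_open bounded_Times open_Times)
  have "emeasure lebesgue (A \<times> B) = emeasure (lborel \<Otimes>\<^sub>M lborel) (A \<times> B)"
    using assms by (simp add: lborel_prod borel_open open_Times)
  also have "\<dots> = emeasure lebesgue A * emeasure lebesgue B"
    using assms by (subst lborel.emeasure_pair_measure_Times) (auto simp: borel_open)
  finally show "measure lebesgue (A \<times> B) = measure lebesgue A * measure lebesgue B"
    by (simp add: measure_def enn2real_mult)
qed

text \<open>Fixes one choice of sets and corrections from which the solution, the coefficient and
  the test functions are all derived; the two parts of the theorem must share the coefficient. The
  amplitudes \<open>(1 / 2) ^ n\<close> give uniform convergence of the sums of \<open>w n\<close>
  and of \<open>pd_x (w n)\<close>.\<close>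

locale staircase =
  fixes \<kappa> :: real and A B :: "nat \<Rightarrow> real set" and w :: "nat \<Rightarrow> real \<times> real \<Rightarrow> real"
  assumes \<kappa>: "0 < \<kappa>" "\<kappa> < 1"
    and open_0: "open (A 0)" "open (B 0)"
    and in_Q: "A 0 \<times> B 0 \<subseteq> Q"
    and bounded_0: "bounded (A 0)" "bounded (B 0)"
    and pos_0: "0 < measure lebesgue (A 0)" "0 < measure lebesgue (B 0)"
    and stage: "stage \<kappa> (height \<kappa> n) (ratio \<kappa> (Suc n)) (ratio \<kappa> n) ((1 / 2) ^ n)
      (A n, B n) (w n) (A (Suc n), B (Suc n))"

text \<open>The third bound says that the wanted share is attainable, and it fixes the exponent.
  With \<alpha> = (1 - \<kappa>) (n + 3) and q = 1 / (1 - \<kappa>) it reads (1 - 1/(n + 3))^q <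
  \<alpha> / (\<alpha> + 1). In logarithms, q ln(1 - 1/(n + 3)) \<le> - q / (n + 3) = - 1/\<alpha> <
  - ln(1 + 1/\<alpha>).\<close>

lemma ratio_bounds:
  assumes "0 < \<kappa>" "\<kappa> < 1"
  shows "0 < ratio \<kappa> n" "ratio \<kappa> n < ratio \<kappa> (Suc n)"
    "ratio \<kappa> (Suc n) < ((1 - \<kappa>) * height \<kappa> n - 2) / ((1 - \<kappa>) * height \<kappa> n - 1)"
    "2 < (1 - \<kappa>) * height \<kappa> n"
proof -
  define q where "q = 1 / (1 - \<kappa>)"
  have q: "q > 0" "(1 - \<kappa>) * q = 1" using assms by (auto simp: q_def)
  show "0 < ratio \<kappa> n" by (simp add: ratio_def)
  show "ratio \<kappa> n < ratio \<kappa> (Suc n)"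
    unfolding ratio_def using assms by (intro powr_less_mono2) (auto simp: field_simps)
  define \<alpha> where "\<alpha> = (1 - \<kappa>) * (real n + 3)"
  have \<alpha>: "\<alpha> > 0" using assms by (simp add: \<alpha>_def)
  have h: "(1 - \<kappa>) * height \<kappa> n = \<alpha> + 2"
    using assms by (simp add: height_def \<alpha>_def algebra_simps diff_divide_distrib[symmetric] divide_simps)
  then show "2 < (1 - \<kappa>) * height \<kappa> n" using \<alpha> by simp
  have "ln (ratio \<kappa> (Suc n)) = q * ln (1 - 1 / (real n + 3))"
  proof -
    have "(real (Suc n) + 1) / (real (Suc n) + 2) = 1 - 1 / (real n + 3)"
      by (simp add: field_simps)
    then show ?thesis by (simp add: ratio_def q_def ln_powr)
  qed
  also have "\<dots> \<le> q * (- (1 / (real n + 3)))"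
    using q ln_le_minus_one[of "1 - 1 / (real n + 3)"] by (intro mult_left_mono) auto
  also have "\<dots> = - (1 / \<alpha>)"
    using assms by (simp add: \<alpha>_def q_def)
  also have "\<dots> < - ln (1 + 1 / \<alpha>)"
  proof -
    have "ln (1 + 1 / \<alpha>) \<noteq> 1 / \<alpha>"
      using ln_eq_minus_one[of "1 + 1 / \<alpha>"] \<alpha> by (auto simp: add_pos_pos)
    then show ?thesis
      using ln_le_minus_one[of "1 + 1 / \<alpha>"] \<alpha> by (simp add: add_pos_pos)
  qed
  also have "\<dots> = ln (\<alpha> / (\<alpha> + 1))"
  proof -
    have "1 + 1 / \<alpha> = (\<alpha> + 1) / \<alpha>" using \<alpha> by (simp add: field_simps)
    then show ?thesis using \<alpha> by (simp add: ln_div)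
  qed
  finally have "ratio \<kappa> (Suc n) < \<alpha> / (\<alpha> + 1)"
    using \<alpha> \<open>0 < ratio \<kappa> n\<close> \<open>ratio \<kappa> n < ratio \<kappa> (Suc n)\<close> by (subst (asm) ln_less_cancel_iff) auto
  then show "ratio \<kappa> (Suc n) < ((1 - \<kappa>) * height \<kappa> n - 2) / ((1 - \<kappa>) * height \<kappa> n - 1)"
    unfolding h by (simp add: add.commute)
qed

lemma ex_staircase:
  assumes "0 < \<kappa>" "\<kappa> < 1" "open A0" "open B0" "A0 \<times> B0 \<subseteq> Q" "bounded A0" "bounded B0"
    "0 < measure lebesgue A0" "0 < measure lebesgue B0"
  obtains A B w where "staircase \<kappa> A B w" "A 0 = A0" "B 0 = B0"
proof -
  let ?P = "\<lambda>(n::nat) (A, B). open A \<and> open B \<and> bounded A \<and> bounded B \<and>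
    0 < measure lebesgue A \<and> 0 < measure lebesgue B \<and> (n = 0 \<longrightarrow> A = A0 \<and> B = B0)"
  let ?S = "\<lambda>n x y. \<exists>w. stage \<kappa> (height \<kappa> n) (ratio \<kappa> (Suc n)) (ratio \<kappa> n) ((1 / 2) ^ n) x w y"
  have "\<exists>f. \<forall>n. ?P n (f n) \<and> ?S n (f n) (f (Suc n))"
  proof (rule dependent_nat_choice)
    show "\<exists>x. ?P 0 x" using assms by auto
    fix x n assume P: "?P n x"
    obtain A B where x: "x = (A, B)" by force
    obtain v A' B' where v: "stage \<kappa> (height \<kappa> n) (ratio \<kappa> (Suc n)) (ratio \<kappa> n) ((1 / 2) ^ n) (A, B) v (A', B')"
      using ex_stage[OF assms(1,2) ratio_bounds(4,1,2,3)[OF assms(1,2)], of "(1/2)^n" A B n] P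
      by (auto simp: x)
    then have AB': "ratio \<kappa> n * measure lebesgue A \<le> measure lebesgue A'"
      "ratio \<kappa> n * measure lebesgue B \<le> measure lebesgue B'" "open A'" "open B'" "A' \<subseteq> A" "B' \<subseteq> B"
      by (auto simp: stage_def)
    have AB: "bounded A" "bounded B" "0 < measure lebesgue A" "0 < measure lebesgue B"
      using P by (auto simp: x)
    have "0 < ratio \<kappa> n * measure lebesgue A" "0 < ratio \<kappa> n * measure lebesgue B"
      using AB ratio_bounds(1)[OF assms(1,2)] by (intro mult_pos_pos; simp)+
    with AB' have "0 < measure lebesgue A'" "0 < measure lebesgue B'"
      by linarith+
    moreover have "bounded A'" "bounded B'"
      using AB AB' bounded_subset by blast+
    ultimately have "?P (Suc n) (A', B')"
      using AB' by (simp only: prod.case simp_thms nat.distinct)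
    moreover have "?S n x (A', B')"
      using v unfolding x by blast
    ultimately show "\<exists>y. ?P (Suc n) y \<and> ?S n x y"
      by (intro exI[of _ "(A', B')"] conjI)
  qed
  then obtain f where f: "\<forall>n. ?P n (f n) \<and> ?S n (f n) (f (Suc n))" ..
  have f0: "?P 0 (f 0)" using spec[OF f, of 0] by (rule conjunct1)
  have "\<forall>n. ?S n (f n) (f (Suc n))"
    using spec[OF f, THEN conjunct2] by (rule allI)
  \<comment> \<open>The dependent choice runs over the pairs of sets only; the corrections joining
    consecutive pairs are selected afterwards.\<close>
  from choice[OF this] obtain w
    where w: "\<forall>n. stage \<kappa> (height \<kappa> n) (ratio \<kappa> (Suc n)) (ratio \<kappa> n) ((1 / 2) ^ n) (f n) (w n) (f (Suc n))" ..
  have init: "f 0 = (A0, B0)"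
    using f0 by (cases "f 0") simp
  have "staircase \<kappa> (\<lambda>n. fst (f n)) (\<lambda>n. snd (f n)) w"
    by unfold_locales (use w assms init in simp_all)
  then show ?thesis
    using that init by simp
qed

lemma powr_divide_eq:
  fixes x y e :: real
  assumes "0 \<le> x" "0 < y"
  shows "(x / y) powr e = x powr e * y powr (- e)"
  using assms by (simp add: powr_divide powr_minus_divide)

context staircase
begin

section \<open>Exponents and the measure of the nested sets\<close>

abbreviation q :: real where "q \<equiv> 1 / (1 - \<kappa>)"
abbreviation p :: real where "p \<equiv> 2 / (1 - \<kappa>)"

definition \<Omega> :: "nat \<Rightarrow> (real \<times> real) set" where "\<Omega> n = A n \<times> B n"
definition core :: "(real \<times> real) set" where "core = (\<Inter>n. \<Omega> n)"

text \<open>Strict because \<kappa> > 0. This is what makes u_t and u_xx square integrable, through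
  \<open>majorant_integrable\<close>.\<close>

lemma p_gt_2: "p > 2"
  using \<kappa> by (simp add: less_divide_eq)

lemma tensor_w: "tensor_sum (w n)"
  and w_compact_support: "\<exists>K. compact K \<and> K \<subseteq> \<Omega> n \<and> (\<forall>z. z \<notin> K \<longrightarrow> w n z = 0)"
  and w_bound: "\<bar>w n z\<bar> \<le> (1 / 2) ^ n" and w_x_bound: "\<bar>pd_x (w n) z\<bar> \<le> (1 / 2) ^ n"
  and w_admissible: "admissible \<kappa> (height \<kappa> n) (height \<kappa> n + pd_t (w n) z) (height \<kappa> n + pd_x (pd_x (w n)) z)"
  and w_next: "z \<in> \<Omega> (Suc n) \<Longrightarrow> pd_t (w n) z = 1" "z \<in> \<Omega> (Suc n) \<Longrightarrow> pd_x (pd_x (w n)) z = 1"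
  using stage[of n] unfolding stage_def prod.case \<Omega>_def by blast+

lemma A_props: "open (A n)" "bounded (A n)" "A (Suc n) \<subseteq> A n"
  and B_props: "open (B n)" "bounded (B n)" "B (Suc n) \<subseteq> B n"
proof -
  show sub: "A (Suc n) \<subseteq> A n" "B (Suc n) \<subseteq> B n" for n
    using stage[of n] by (auto simp: stage_def)
  show "open (A n)" "open (B n)"
    using stage open_0 by (cases n; force simp: stage_def)+
  have "bounded (A n) \<and> bounded (B n)"
  proof (induction n)
    case (Suc n)
    then show ?case using bounded_subset[OF _ sub(1)[of n]] bounded_subset[OF _ sub(2)[of n]] by simp
  qed (simp add: bounded_0)
  then show "bounded (A n)" "bounded (B n)" by auto
qed

lemma \<Omega>_mono: "m \<le> n \<Longrightarrow> \<Omega> n \<subseteq> \<Omega> m"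
  using A_props(3) B_props(3) lift_Suc_antimono_le[of A] lift_Suc_antimono_le[of B]
  unfolding \<Omega>_def by (meson Sigma_mono)

lemma \<Omega>_open: "open (\<Omega> n)"
  by (simp add: \<Omega>_def A_props B_props open_Times)

lemma \<Omega>_lmeasurable [simp]: "\<Omega> n \<in> lmeasurable"
  by (simp add: \<Omega>_def A_props B_props lmeasurable_open_Times)

lemma \<Omega>_sets [simp]: "\<Omega> n \<in> sets lebesgue" "\<Omega> n \<in> sets borel"
  using \<Omega>_open by (auto simp: fmeasurableD)

lemma \<Omega>_subset_Q: "\<Omega> n \<subseteq> Q"
  using \<Omega>_mono[of 0 n] in_Q by (auto simp: \<Omega>_def)

definition d0 :: real where "d0 = measure lebesgue (\<Omega> 0)"

lemma d0_pos: "d0 > 0"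
  using pos_0 lmeasurable_open_Times(2)[of "A 0" "B 0"] A_props B_props
  by (simp add: d0_def \<Omega>_def)

lemma measure_\<Omega>:
  shows measure_\<Omega>_lower: "d0 * (1 / (real n + 1)) powr p \<le> measure lebesgue (\<Omega> n)"
    and measure_\<Omega>_upper: "measure lebesgue (\<Omega> n) \<le> d0 * (2 / (real n + 2)) powr p"
proof -
  have bounds: "measure lebesgue (C 0) * (1 / (real n + 1)) powr q \<le> measure lebesgue (C n) \<and>
      measure lebesgue (C n) \<le> measure lebesgue (C 0) * (2 / (real n + 2)) powr q"
    if C: "\<And>n. ratio \<kappa> n * measure lebesgue (C n) \<le> measure lebesgue (C (Suc n)) \<and>
      measure lebesgue (C (Suc n)) \<le> ratio \<kappa> (Suc n) * measure lebesgue (C n)"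
    for C :: "nat \<Rightarrow> real set"
  proof (induction n)
    case (Suc n)
    have "(1 / (real (Suc n) + 1)) powr q = ratio \<kappa> n * (1 / (real n + 1)) powr q"
      unfolding ratio_def by (subst powr_mult[symmetric]) (auto simp: field_simps)
    then have "measure lebesgue (C 0) * (1 / (real (Suc n) + 1)) powr q \<le> ratio \<kappa> n * measure lebesgue (C n)"
      using mult_left_mono[OF conjunct1[OF Suc.IH], of "ratio \<kappa> n"] ratio_bounds(1)[OF \<kappa>, of n]
      by (simp add: mult_ac)
    moreover have "(2 / (real (Suc n) + 2)) powr q = ratio \<kappa> (Suc n) * (2 / (real n + 2)) powr q"
    proof -
      have "2 / (real (Suc n) + 2) = (real (Suc n) + 1) / (real (Suc n) + 2) * (2 / (real n + 2))"
        by (simp add: divide_simps)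
      then show ?thesis
        unfolding ratio_def by (simp only: powr_mult)
    qed
    then have "ratio \<kappa> (Suc n) * measure lebesgue (C n) \<le> measure lebesgue (C 0) * (2 / (real (Suc n) + 2)) powr q"
      using mult_left_mono[OF conjunct2[OF Suc.IH], of "ratio \<kappa> (Suc n)"] ratio_bounds(1)[OF \<kappa>, of "Suc n"]
      by (simp add: mult_ac)
    ultimately show ?case
      using C[of n] by linarith
  qed simp
  have a: "measure lebesgue (A 0) * (1 / (real n + 1)) powr q \<le> measure lebesgue (A n) \<and>
      measure lebesgue (A n) \<le> measure lebesgue (A 0) * (2 / (real n + 2)) powr q"
  proof (rule bounds)
    fix n show "ratio \<kappa> n * measure lebesgue (A n) \<le> measure lebesgue (A (Suc n)) \<and>
        measure lebesgue (A (Suc n)) \<le> ratio \<kappa> (Suc n) * measure lebesgue (A n)"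
      using stage[of n] unfolding stage_def prod.case by blast
  qed
  have b: "measure lebesgue (B 0) * (1 / (real n + 1)) powr q \<le> measure lebesgue (B n) \<and>
      measure lebesgue (B n) \<le> measure lebesgue (B 0) * (2 / (real n + 2)) powr q"
  proof (rule bounds)
    fix n show "ratio \<kappa> n * measure lebesgue (B n) \<le> measure lebesgue (B (Suc n)) \<and>
        measure lebesgue (B (Suc n)) \<le> ratio \<kappa> (Suc n) * measure lebesgue (B n)"
      using stage[of n] unfolding stage_def prod.case by blast
  qed
  have m: "measure lebesgue (\<Omega> n) = measure lebesgue (A n) * measure lebesgue (B n)" for n
    by (simp add: \<Omega>_def lmeasurable_open_Times A_props B_props)
  \<comment> \<open>Time and space contribute the exponent \<open>q\<close> each, and
    \<open>p\<close> is twice \<open>q\<close>.\<close>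
  have pq: "x powr p = x powr q * x powr q" for x :: real
    by (simp add: powr_add[symmetric] add_divide_distrib[symmetric])
  show "d0 * (1 / (real n + 1)) powr p \<le> measure lebesgue (\<Omega> n)"
    using mult_mono[OF conjunct1[OF a] conjunct1[OF b]] by (simp add: d0_def m pq mult_ac)
  show "measure lebesgue (\<Omega> n) \<le> d0 * (2 / (real n + 2)) powr p"
    using mult_mono[OF conjunct2[OF a] conjunct2[OF b]] by (simp add: d0_def m pq mult_ac)
qed

lemma core_null: "core \<in> null_sets lebesgue"
proof -
  have *: "core \<in> lmeasurable"
  proof (rule fmeasurableI2[OF \<Omega>_lmeasurable[of 0]])
    show "core \<in> sets lebesgue"
      unfolding core_def by (intro sets.countable_INT) auto
  qed (auto simp: core_def)
  have "(\<lambda>n. d0 * (2 / (real n + 2)) powr p) \<longlonglongrightarrow> d0 * 0"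
  proof (intro tendsto_mult_left)
    have "(\<lambda>n. 2 / (real n + 2)) \<longlonglongrightarrow> 0"
      using LIMSEQ_ignore_initial_segment[OF lim_const_over_n[of "2 :: real"], of 2] by (simp add: add.commute)
    then show "(\<lambda>n. (2 / (real n + 2)) powr p) \<longlonglongrightarrow> 0"
      using tendsto_powr'[of "\<lambda>n. 2 / (real n + 2)" 0 sequentially "\<lambda>_. p" p] \<kappa> by simp
  qed
  moreover have "measure lebesgue core \<le> d0 * (2 / (real n + 2)) powr p" for n
    using measure_mono_fmeasurable[of core "\<Omega> n" lebesgue] measure_\<Omega>_upper[of n] *
    by (force simp: core_def fmeasurableD)
  ultimately have "measure lebesgue core \<le> 0"
    by (intro LIMSEQ_le_const[of _ 0]) auto
  then have "measure lebesgue core = 0"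
    by (simp add: order_antisym)
  then show ?thesis
    using * negligible_iff_measure0 negligible_iff_null_sets by blast
qed

lemma AE_core:
  assumes "S \<in> sets lebesgue"
  shows "AE z in lebesgue_on S. z \<in> S \<and> z \<notin> core"
proof -
  have "AE z in lebesgue. z \<notin> core"
    using core_null by (rule AE_not_in)
  then show ?thesis
    using assms by (simp add: AE_restrict_space_iff) (auto elim!: eventually_mono)
qed

lemmas AE_Q_core = AE_core[OF Q_lmeasurable(2)]
lemmas AE_D_core = AE_core[OF \<Omega>_sets(1)[of 0]]

text \<open>Since \<open>core\<close> is null, almost everywhere statements reduce to the outside of
  \<open>\<Omega> 0\<close> and to the layers \<open>\<Omega> n - \<Omega> (Suc n)\<close>, on each
  of which only finitely many corrections act.\<close>

lemma level_cases:
  assumes "z \<notin> core"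
  obtains "z \<notin> \<Omega> 0" | n where "z \<in> \<Omega> n" "z \<notin> \<Omega> (Suc n)"
proof -
  obtain n where n: "z \<notin> \<Omega> n" using assms by (auto simp: core_def)
  have "z \<notin> \<Omega> 0 \<or> (\<exists>n. z \<in> \<Omega> n \<and> z \<notin> \<Omega> (Suc n))"
  proof (rule ccontr)
    assume no: "\<not> ?thesis"
    have "z \<in> \<Omega> n" by (induction n) (use no in blast)+
    with n show False by simp
  qed
  then show ?thesis using that by blast
qed

text \<open>Treats \<open>u\<^sub>t\<close> and \<open>u\<^sub>x\<^sub>x\<close> simultaneously: \<open>g k\<close> stands for \<open>\<partial>\<^sub>t (w k)\<close> or \<open>\<partial>\<^sub>x\<^sub>x (w k)\<close>. The sum in \<open>total\<close> is finite
  outside \<open>core\<close>; on \<open>core\<close> it diverges and \<open>total\<close> is a junk value on a null set.\<close>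

definition level_increment :: "(nat \<Rightarrow> real \<times> real \<Rightarrow> real) \<Rightarrow> bool"
  where "level_increment g \<longleftrightarrow> (\<forall>k z. (z \<notin> \<Omega> k \<longrightarrow> g k z = 0) \<and> (z \<in> \<Omega> (Suc k) \<longrightarrow> g k z = 1) \<and>
    \<kappa> * height \<kappa> k \<le> height \<kappa> k + g k z \<and> g k z \<le> 2) \<and> (\<forall>k. continuous_on UNIV (g k))"

text \<open>The summand \<open>height \<kappa> 0\<close> is the common constant value of u_t and
  u_xx for the initial polynomial; the sum adds what the first \<open>j\<close> corrections
  contribute.\<close>

definition partial :: "(nat \<Rightarrow> real \<times> real \<Rightarrow> real) \<Rightarrow> nat \<Rightarrow> real \<times> real \<Rightarrow> real"
  where "partial g j z = height \<kappa> 0 + (\<Sum>k<j. g k z)"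

definition total :: "(nat \<Rightarrow> real \<times> real \<Rightarrow> real) \<Rightarrow> real \<times> real \<Rightarrow> real"
  where "total g z = height \<kappa> 0 + (\<Sum>k. g k z)"

section \<open>Values of the derivatives on the layers\<close>

lemma pd_outside:
  assumes "z \<notin> \<Omega> n"
  shows "pd_t (w n) z = 0" "pd_x (w n) z = 0" "pd_x (pd_x (w n)) z = 0"
proof -
  obtain K where K: "compact K" "K \<subseteq> \<Omega> n" "\<And>z. z \<notin> K \<Longrightarrow> w n z = 0"
    using w_compact_support[of n] by blast
  note pd = pd_eq_0_outside_closed[OF compact_imp_closed[OF K(1)]]
  have "z \<notin> K" using K assms by blast
  then show "pd_t (w n) z = 0" "pd_x (w n) z = 0" "pd_x (pd_x (w n)) z = 0"
    by (auto intro!: pd K(3))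
qed

lemma level_increment_w:
  "level_increment (\<lambda>k. pd_t (w k))" "level_increment (\<lambda>k. pd_x (pd_x (w k)))"
  using pd_outside w_next w_admissible tensor_sum_continuous tensor_sum_pd_t tensor_sum_pd_x tensor_w
  by (auto simp: level_increment_def admissible_def)

lemma level_incrementD:
  assumes "level_increment g"
  shows "z \<notin> \<Omega> k \<Longrightarrow> g k z = 0" "z \<in> \<Omega> (Suc k) \<Longrightarrow> g k z = 1"
    "\<kappa> * height \<kappa> k \<le> height \<kappa> k + g k z" "g k z \<le> 2" "continuous_on UNIV (g k)"
  using assms unfolding level_increment_def by blast+

lemma height_add: "height \<kappa> n = height \<kappa> 0 + real n" and height_ge: "height \<kappa> n \<ge> real n + 3"
  using \<kappa> by (auto simp: height_def)

lemma level_increment_sum: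
  assumes "level_increment g" "z \<in> \<Omega> n"
  shows "(\<Sum>k<n. g k z) = real n"
proof -
  have "g k z = 1" if "k < n" for k
    using assms(2) \<Omega>_mono[of "Suc k" n] that by (intro level_incrementD(2)[OF assms(1)]) auto
  then show ?thesis by simp
qed

lemma partial_in:
  assumes "level_increment g" "z \<in> \<Omega> j"
  shows "partial g j z = height \<kappa> j"
  using level_increment_sum[OF assms] by (simp add: partial_def height_def)

text \<open>On layer \<open>n\<close> the earlier increments are all 1, the later ones are 0, and
  only the increment of step \<open>n\<close> varies. Truncation after that step therefore changes
  nothing.\<close>

lemma level_increment_level:
  assumes g: "level_increment g" and z: "z \<in> \<Omega> n" "z \<notin> \<Omega> (Suc n)"
  shows partial_level: "n < j \<Longrightarrow> partial g j z = height \<kappa> n + g n z"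
    and total_level: "total g z = height \<kappa> n + g n z"
proof -
  have 0: "g k z = 0" if "k > n" for k
    using z \<Omega>_mono[of "Suc n" k] that by (intro level_incrementD(1)[OF g]) auto
  have n: "(\<Sum>k<Suc n. g k z) = n + g n z"
    using level_increment_sum[OF g z(1)] by simp
  have "(\<Sum>k<j. g k z) = (\<Sum>k<Suc n. g k z)" if "n < j" for j
    by (rule sum.mono_neutral_right) (use that 0 in auto)
  with n show "n < j \<Longrightarrow> partial g j z = height \<kappa> n + g n z"
    by (simp add: partial_def height_def)
  have "(\<Sum>k. g k z) = (\<Sum>k<Suc n. g k z)"
    by (rule suminf_finite) (use 0 in auto)
  with n show "total g z = height \<kappa> n + g n z"
    by (simp add: total_def height_def)
qed

lemma level_increment_outside:
  assumes g: "level_increment g" and z: "z \<notin> \<Omega> 0"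
  shows "partial g j z = height \<kappa> 0" "total g z = height \<kappa> 0"
proof -
  have 0: "g k z = 0" for k
    using z \<Omega>_mono[of 0 k] by (intro level_incrementD(1)[OF g]) auto
  then show "partial g j z = height \<kappa> 0" "total g z = height \<kappa> 0"
    by (auto simp: partial_def total_def)
qed

lemma total_bounds:
  assumes g: "level_increment g" and z: "z \<in> \<Omega> n" "z \<notin> \<Omega> (Suc n)"
  shows "\<kappa> * height \<kappa> n \<le> total g z" "total g z \<le> height \<kappa> n + 2"
  using level_incrementD(3,4)[OF g, of n z] total_level[OF assms] by simp_all

lemma partial_bounds:
  assumes g: "level_increment g" and z: "z \<in> \<Omega> n" "z \<notin> \<Omega> (Suc n)"
  shows "0 \<le> partial g j z" "partial g j z \<le> height \<kappa> n + 2"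
proof -
  have "0 \<le> partial g j z \<and> partial g j z \<le> height \<kappa> n + 2"
  proof (cases "n < j")
    case True
    have "\<kappa> * height \<kappa> n \<ge> 0" using \<kappa> height_ge[of n] by simp
    then show ?thesis
      using total_bounds[OF assms] partial_level[OF assms True] total_level[OF assms] by simp
  next
    case False
    then have "z \<in> \<Omega> j" using \<Omega>_mono[of j n] z by auto
    then show ?thesis using partial_in[OF g, of z j] False height_ge[of j] by (simp add: height_def)
  qed
  then show "0 \<le> partial g j z" "partial g j z \<le> height \<kappa> n + 2" by auto
qed

lemma partial_tendsto:
  assumes g: "level_increment g" and z: "z \<notin> core"
  shows "(\<lambda>j. partial g j z) \<longlonglongrightarrow> total g z"
  using z
proof (cases rule: level_cases)
  case 1
  then show ?thesis by (simp add: level_increment_outside[OF g])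
next
  case (2 n)
  have "\<forall>\<^sub>F j in sequentially. partial g j z = total g z"
    using eventually_gt_at_top[of n]
    by eventually_elim (simp add: partial_level[OF g 2] total_level[OF g 2])
  then show ?thesis by (rule tendsto_eventually)
qed

lemma partial_measurable [measurable]: "level_increment g \<Longrightarrow> partial g j \<in> borel_measurable borel"
  unfolding partial_def
  by (intro borel_measurable_continuous_onI continuous_intros level_incrementD(5))

lemma total_measurable [measurable]:
  assumes "level_increment g"
  shows "total g \<in> borel_measurable borel"
proof -
  have [measurable]: "g k \<in> borel_measurable borel" for k
    using level_incrementD(5)[OF assms] by (rule borel_measurable_continuous_onI)
  show ?thesis unfolding total_def by measurable
qed

text \<open>At level \<open>k\<close> the values are at most k + C, so values above \<tau> occur
  only at levels beyond about \<tau> - C, that is in a set \<open>\<Omega> n\<close> of known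
  measure. For \<tau> < 2 C the constant already makes the right side at least
  \<open>d0\<close>.\<close>

lemma upper_tail:
  assumes f: "\<And>n z. z \<in> \<Omega> n \<Longrightarrow> z \<notin> \<Omega> (Suc n) \<Longrightarrow> \<bar>f z\<bar> \<le> height \<kappa> n + 2" and "\<tau> > 0"
    and meas: "{z \<in> \<Omega> 0. \<bar>f z\<bar> > \<tau>} \<in> sets lebesgue"
  shows "measure lebesgue {z \<in> \<Omega> 0. \<bar>f z\<bar> > \<tau>} \<le> d0 * (2 * (height \<kappa> 0 + 2)) powr p * \<tau> powr (- p)"
proof -
  define C where "C = height \<kappa> 0 + 2"
  have C: "C \<ge> 5" using height_ge[of 0] by (simp add: C_def)
  have "measure lebesgue {z \<in> \<Omega> 0. \<bar>f z\<bar> > \<tau>} \<le> d0 * (2 * C / \<tau>) powr p"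
  proof (cases "\<tau> < 2 * C")
    case True
    have "measure lebesgue {z \<in> \<Omega> 0. \<bar>f z\<bar> > \<tau>} \<le> d0"
      unfolding d0_def by (rule measure_mono_fmeasurable) (use meas in auto)
    moreover have "1 \<le> (2 * C / \<tau>) powr p"
      using True assms(2) C \<kappa> by (intro ge_one_powr_ge_zero) auto
    ultimately show ?thesis using d0_pos by (smt (verit) mult_le_cancel_left1)
  next
    case False
    \<comment> \<open>With this \<open>n\<close>, a level \<open>k < n\<close> has k + C \<le> n - 1
      + C \<le> \<tau>, which excludes it.\<close>
    define n where "n = Suc (nat \<lfloor>\<tau> - C\<rfloor>)"
    have n: "real n - 1 + C \<le> \<tau>" "\<tau> - C \<le> real n"
      using False C by (auto simp: n_def) linarith+
    have sub: "{z \<in> \<Omega> 0. \<bar>f z\<bar> > \<tau>} \<subseteq> \<Omega> n"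
    proof clarify
      fix t x assume z: "(t, x) \<in> \<Omega> 0" "\<tau> < \<bar>f (t, x)\<bar>"
      show "(t, x) \<in> \<Omega> n"
      proof (rule ccontr)
        assume no: "(t, x) \<notin> \<Omega> n"
        then have "(t, x) \<notin> core" by (auto simp: core_def)
        then show False
        proof (cases rule: level_cases)
          case (2 k)
          then have "k < n" using no \<Omega>_mono[of n k] by (meson not_less subsetD)
          then show False using f[OF 2] z(2) n(1) by (simp add: C_def height_def)
        qed (use z in simp)
      qed
    qed
    have "measure lebesgue {z \<in> \<Omega> 0. \<bar>f z\<bar> > \<tau>} \<le> measure lebesgue (\<Omega> n)"
      by (rule measure_mono_fmeasurable[OF sub]) (use meas in auto)
    also have "\<dots> \<le> d0 * (2 / (real n + 2)) powr p" by (rule measure_\<Omega>_upper)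
    also have "\<dots> \<le> d0 * (2 * C / \<tau>) powr p"
    proof (intro mult_left_mono powr_mono2)
      have "\<tau> / 2 \<le> real n + 2" using n False by simp
      then have "2 / (real n + 2) \<le> 2 / (\<tau> / 2)"
        using assms by (intro divide_left_mono) auto
      also have "\<dots> \<le> 2 * C / \<tau>" using C assms by (simp add: divide_right_mono)
      finally show "2 / (real n + 2) \<le> 2 * C / \<tau>" .
    qed (use d0_pos \<kappa> in auto)
    finally show ?thesis .
  qed
  also have "\<dots> = d0 * (2 * C) powr p * \<tau> powr (- p)"
    using assms(2) C powr_divide_eq[of "2 * C" \<tau> p] by simp
  finally show ?thesis by (simp add: C_def)
qed

text \<open>All of \<open>\<Omega> n\<close> outside \<open>core\<close> has level at least
  \<open>n\<close>, hence values above \<kappa> n; the smallest \<open>n\<close> with \<kappa> n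
  \<ge> \<tau> places a whole \<open>\<Omega> n\<close>, up to a null set, in the superlevel
  set.\<close>

lemma lower_tail:
  assumes f: "\<And>n z. z \<in> \<Omega> n \<Longrightarrow> z \<notin> \<Omega> (Suc n) \<Longrightarrow> \<kappa> * height \<kappa> n \<le> f z" and "\<tau> \<ge> 1"
    and meas: "{z \<in> \<Omega> 0. f z > \<tau>} \<in> sets lebesgue"
  shows "d0 * (\<kappa> / 3) powr p * \<tau> powr (- p) \<le> measure lebesgue {z \<in> \<Omega> 0. f z > \<tau>}"
proof -
  define n where "n = nat \<lceil>\<tau> / \<kappa>\<rceil>"
  have "\<tau> / \<kappa> \<ge> 1" using \<kappa> assms by (simp add: field_simps)
  then have n: "real n \<ge> \<tau> / \<kappa>" "real n \<le> \<tau> / \<kappa> + 1"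
    unfolding n_def by linarith+
  have sub: "\<Omega> n - core \<subseteq> {z \<in> \<Omega> 0. f z > \<tau>}"
  proof
    fix z assume z: "z \<in> \<Omega> n - core"
    then have "z \<notin> core" by simp
    then show "z \<in> {z \<in> \<Omega> 0. f z > \<tau>}"
    proof (cases rule: level_cases)
      case 1
      then show ?thesis using z \<Omega>_mono[of 0 n] by auto
    next
      case (2 k)
      then have "n \<le> k" using z \<Omega>_mono[of "Suc k" n] by (meson DiffD1 not_less_eq_eq subsetD)
      have "\<tau> \<le> \<kappa> * real n" using n \<kappa> by (simp add: divide_le_eq mult.commute)
      also have "\<dots> < \<kappa> * height \<kappa> k"
        using \<kappa> \<open>n \<le> k\<close> height_ge[of k] by (intro mult_strict_left_mono) auto
      also have "\<dots> \<le> f z" by (rule f[OF 2])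
      finally show ?thesis using 2 \<Omega>_mono[of 0 k] by auto
    qed
  qed
  have "d0 * (\<kappa> / 3) powr p * \<tau> powr (- p) = d0 * (\<kappa> / (3 * \<tau>)) powr p"
    using assms(2) \<kappa> powr_divide_eq[of "\<kappa> / 3" \<tau> p] by simp
  also have "\<dots> \<le> d0 * (1 / (real n + 1)) powr p"
  proof (intro mult_left_mono powr_mono2)
    \<comment> \<open>Rounding up costs 1, the shift in \<open>measure_\<Omega>_lower\<close>
      another 1, and each is at most \<tau> / \<kappa>: this is the 3 in the constant.\<close>
    have "real n + 1 \<le> 3 * (\<tau> / \<kappa>)" using n \<open>\<tau> / \<kappa> \<ge> 1\<close> by linarith
    then have "1 / (3 * (\<tau> / \<kappa>)) \<le> 1 / (real n + 1)"
      by (intro divide_left_mono) (use assms \<kappa> in auto)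
    then show "\<kappa> / (3 * \<tau>) \<le> 1 / (real n + 1)" by simp
  qed (use d0_pos p_gt_2 assms \<kappa> in auto)
  also have "\<dots> \<le> measure lebesgue (\<Omega> n)" by (rule measure_\<Omega>_lower)
  also have "\<dots> = measure lebesgue (\<Omega> n - core)"
    using core_null by (intro measure_Diff_null_set[symmetric]) auto
  also have "\<dots> \<le> measure lebesgue {z \<in> \<Omega> 0. f z > \<tau>}"
  proof (rule measure_mono_fmeasurable[OF sub])
    show "\<Omega> n - core \<in> sets lebesgue" using core_null by auto
    show "{z \<in> \<Omega> 0. f z > \<tau>} \<in> lmeasurable"
      by (rule fmeasurableI2[OF \<Omega>_lmeasurable[of 0] _ meas]) auto
  qed
  finally show ?thesis .
qed

text \<open>A discrete layer-cake argument. At a point whose deepest level up to \<open>j\<close> is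
  \<open>k\<close>, the comparison function \<open>h\<close> has \<open>k\<close> terms, each at
  most \<kappa>^p k^(p-1), so it stays below (\<kappa> k)^p. Its integral collects n^(p-1) times a
  measure of order n^(-p), hence the harmonic sum. Stopping at \<open>j\<close> lets the lemma serve
  the truncated functions as well as the limit.\<close>

lemma Lp_lower:
  assumes f: "AE z in lebesgue_on (\<Omega> 0). \<forall>n\<le>j. z \<in> \<Omega> n \<longrightarrow> \<kappa> * real n \<le> \<bar>f z\<bar>"
    and int: "integrable (lebesgue_on (\<Omega> 0)) (\<lambda>z. \<bar>f z\<bar> powr p)" and "j \<ge> 1"
  shows "d0 * (\<kappa> / 2) powr p * ln (real j) \<le> (\<integral>z. \<bar>f z\<bar> powr p \<partial>lebesgue_on (\<Omega> 0))"
proof -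
  let ?M = "lebesgue_on (\<Omega> 0)"
  define h where "h z = (\<Sum>n=1..j. \<kappa> powr p * real n powr (p - 1) * indicator (\<Omega> n) z)" for z
  have meas: "emeasure ?M (\<Omega> n) = emeasure lebesgue (\<Omega> n)" "measure ?M (\<Omega> n) = measure lebesgue (\<Omega> n)" for n
    using \<Omega>_mono[of 0 n] by (auto simp: emeasure_restrict_space measure_restrict_space)
  have sets: "\<Omega> n \<in> sets ?M" for n
    using \<Omega>_mono[of 0 n] by (auto simp: sets_restrict_space_iff)
  have "integrable ?M (indicator (\<Omega> n) :: _ \<Rightarrow> real)" for n
    using sets meas(1)[of n] fmeasurableD2[OF \<Omega>_lmeasurable[of n]]
    by (intro integrable_real_indicator) (simp_all only: top.not_eq_extremum infinity_ennreal_def)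
  then have hint: "integrable ?M h"
    unfolding h_def by (intro Bochner_Integration.integrable_sum) (auto intro!: integrable_mult_right)
  have le: "h z \<le> \<bar>f z\<bar> powr p" if *: "\<forall>n\<le>j. z \<in> \<Omega> n \<longrightarrow> \<kappa> * real n \<le> \<bar>f z\<bar>" for z
  proof (cases "z \<in> \<Omega> 1")
    case False
    then have "z \<notin> \<Omega> n" if "n \<ge> 1" for n using \<Omega>_mono[OF that] by auto
    then have "h z = 0" unfolding h_def by (intro sum.neutral) auto
    then show ?thesis by simp
  next
    case True
    define k where "k = Max {n. n \<le> j \<and> z \<in> \<Omega> n}"
    have fin: "finite {n. n \<le> j \<and> z \<in> \<Omega> n}" by simp
    have "k \<in> {n. n \<le> j \<and> z \<in> \<Omega> n}"
      unfolding k_def by (rule Max_in[OF fin]) (use True assms in auto)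
    then have k: "k \<le> j" "z \<in> \<Omega> k" by auto
    have kmax: "n \<le> k" if "n \<le> j" "z \<in> \<Omega> n" for n
      unfolding k_def using Max_ge[OF fin] that by simp
    then have "k \<ge> 1" using True assms by blast
    have "h z \<le> (\<Sum>n=1..j. if n \<le> k then \<kappa> powr p * real k powr (p - 1) else 0)"
      unfolding h_def
    proof (rule sum_mono)
      fix n assume "n \<in> {1..j}"
      then show "\<kappa> powr p * real n powr (p - 1) * indicator (\<Omega> n) z
          \<le> (if n \<le> k then \<kappa> powr p * real k powr (p - 1) else 0)"
        using kmax[of n] p_gt_2 by (auto simp: indicator_def intro!: mult_left_mono powr_mono2)
    qed
    also have "\<dots> = (\<Sum>n=1..k. \<kappa> powr p * real k powr (p - 1))"
      using k(1) by (intro sum.mono_neutral_cong_right) auto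
    also have "\<dots> = \<kappa> powr p * (real k powr 1 * real k powr (p - 1))" by simp
    also have "\<dots> = (\<kappa> * real k) powr p"
      using \<kappa> by (simp only: powr_add[symmetric]) (simp add: powr_mult)
    also have "\<dots> \<le> \<bar>f z\<bar> powr p"
      using * k \<kappa> p_gt_2 by (intro powr_mono2) auto
    finally show ?thesis .
  qed
  have "d0 * (\<kappa> / 2) powr p * ln (real j) \<le> d0 * (\<kappa> / 2) powr p * (\<Sum>n=1..j. 1 / real n)"
  proof (rule mult_left_mono)
    have "ln (real j) \<le> ln (real j + 1)" using assms by simp
    also have "\<dots> \<le> (\<Sum>n=1..j. 1 / real n)"
      using ln_le_harm[of j] by (simp add: harm_def inverse_eq_divide)
    finally show "ln (real j) \<le> (\<Sum>n=1..j. 1 / real n)" .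
  qed (use d0_pos in auto)
  also have "\<dots> = (\<Sum>n=1..j. d0 * (\<kappa> / 2) powr p * (1 / real n))"
    by (simp add: sum_distrib_left)
  also have "\<dots> \<le> (\<Sum>n=1..j. \<kappa> powr p * real n powr (p - 1) * measure lebesgue (\<Omega> n))"
  proof (rule sum_mono)
    fix n assume n: "n \<in> {1..j}"
    \<comment> \<open>The factor 1/2 in the constant comes from n + 1 \<le> 2 n.\<close>
    have "d0 * (\<kappa> / 2) powr p * (1 / real n) = \<kappa> powr p * real n powr (p - 1) * (d0 * (1 / (2 * real n)) powr p)"
    proof -
      have "d0 * (\<kappa> / 2) powr e * (1 / x) = \<kappa> powr e * x powr (e - 1) * (d0 * (1 / (2 * x)) powr e)"
        if "x > 0" for x e :: real
        using that \<kappa> by (simp add: powr_divide powr_mult powr_diff mult_ac)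
      then show ?thesis using n by simp
    qed
    also have "\<dots> \<le> \<kappa> powr p * real n powr (p - 1) * (d0 * (1 / (real n + 1)) powr p)"
      using n d0_pos \<kappa> by (intro mult_left_mono powr_mono2 divide_left_mono) auto
    also have "\<dots> \<le> \<kappa> powr p * real n powr (p - 1) * measure lebesgue (\<Omega> n)"
      by (intro mult_left_mono measure_\<Omega>_lower) auto
    finally show "d0 * (\<kappa> / 2) powr p * (1 / real n) \<le> \<kappa> powr p * real n powr (p - 1) * measure lebesgue (\<Omega> n)" .
  qed
  also have "\<dots> = integral\<^sup>L ?M h"
    unfolding h_def using meas sets
    by (subst Bochner_Integration.integral_sum)
       (auto intro!: integrable_mult_right \<open>\<And>n. integrable ?M (indicator (\<Omega> n) :: _ \<Rightarrow> real)\<close> simp: Int_absorb2[OF \<Omega>_mono[OF le0]])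
  also have "\<dots> \<le> (\<integral>z. \<bar>f z\<bar> powr p \<partial>?M)"
    using f by (intro integral_mono_AE hint int) (auto elim!: eventually_mono intro: le)
  finally show ?thesis .
qed

text \<open>On layer \<open>k\<close> the sum equals (k + 1) (k + 2) / 2, so it grows like the
  square of the height and dominates the derivatives together with their squares.\<close>

definition majorant :: "real \<times> real \<Rightarrow> real"
  where "majorant z = 2 * (height \<kappa> 0 + 2)\<^sup>2 * (1 + (\<Sum>n. (real n + 1) * indicator (\<Omega> n) z))"

text \<open>Integrating termwise gives a series with terms of order n^(1-p), which converges since p
  > 2. The pointwise series is finite off \<open>core\<close>.\<close>

lemma majorant_integrable: "integrable (lebesgue_on Q) majorant"
proof -
  let ?M = "lebesgue_on Q"
  have meas: "emeasure ?M (\<Omega> n) = emeasure lebesgue (\<Omega> n)" "measure ?M (\<Omega> n) = measure lebesgue (\<Omega> n)" for n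
    using \<Omega>_subset_Q by (auto simp: emeasure_restrict_space measure_restrict_space)
  have sets: "\<Omega> n \<in> sets ?M" for n
    using \<Omega>_subset_Q by (auto simp: sets_restrict_space_iff)
  have int: "integrable ?M (indicator (\<Omega> n) :: _ \<Rightarrow> real)" for n
    using sets meas(1)[of n] fmeasurableD2[OF \<Omega>_lmeasurable[of n]]
    by (intro integrable_real_indicator) (simp_all only: top.not_eq_extremum infinity_ennreal_def)
  have "integrable ?M (\<lambda>z. \<Sum>n. (real n + 1) * indicator (\<Omega> n) z)"
  proof (rule integrable_suminf)
    show "integrable ?M (\<lambda>z. (real n + 1) * indicator (\<Omega> n) z)" for n
      using int by (intro integrable_mult_right) auto
    show "AE z in ?M. summable (\<lambda>n. norm ((real n + 1) * indicator (\<Omega> n) z))"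
      using AE_Q_core
    proof eventually_elim
      case (elim z)
      then obtain N where N: "z \<notin> \<Omega> N" by (auto simp: core_def)
      show ?case
        by (rule summable_finite[of "{..<N}"]) (use N \<Omega>_mono in \<open>auto simp: indicator_def not_less\<close>)
    qed
    show "summable (\<lambda>n. \<integral>z. norm ((real n + 1) * indicator (\<Omega> n) z) \<partial>?M)"
    proof (rule summable_comparison_test')
      have "summable (\<lambda>n. real n powr (1 - p))"
        using p_gt_2 by (subst summable_real_powr_iff) auto
      then have "summable (\<lambda>n. real (n + 2) powr (1 - p))"
        by (rule summable_ignore_initial_segment)
      then show "summable (\<lambda>n. d0 * 2 powr p * real (n + 2) powr (1 - p))"
        by (rule summable_mult)
      fix n :: nat
      have "(\<integral>z. norm ((real n + 1) * indicator (\<Omega> n) z) \<partial>?M) = (real n + 1) * measure lebesgue (\<Omega> n)"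
        using meas(2)[of n] sets[of n] \<Omega>_subset_Q[of n] by (simp add: abs_mult Int_absorb2)
      also have "\<dots> \<le> (real n + 2) * (d0 * (2 / (real n + 2)) powr p)"
        using measure_\<Omega>_upper[of n] by (intro mult_mono) auto
      also have "\<dots> = d0 * 2 powr p * real (n + 2) powr (1 - p)"
      proof -
        have "x * (d0 * (2 / x) powr e) = d0 * 2 powr e * x powr (1 - e)" if "x > 0" for x e :: real
          using that by (simp add: powr_divide powr_diff)
        then show ?thesis by (simp add: add.commute)
      qed
      finally show "norm (\<integral>z. norm ((real n + 1) * indicator (\<Omega> n) z) \<partial>?M) \<le> d0 * 2 powr p * real (n + 2) powr (1 - p)"
        by simp
    qed
  qed
  moreover have "integrable ?M (\<lambda>_. 1 :: real)"
    by (rule finite_measure.integrable_const[OF finite_measure_lebesgue_on]) simp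
  ultimately show ?thesis
    unfolding majorant_def by (intro integrable_mult_right Bochner_Integration.integrable_add) auto
qed

lemma majorant:
  assumes z: "z \<notin> core" and f: "\<And>n. z \<in> \<Omega> n \<Longrightarrow> z \<notin> \<Omega> (Suc n) \<Longrightarrow> \<bar>f z\<bar> \<le> height \<kappa> n + 2"
    "z \<notin> \<Omega> 0 \<Longrightarrow> \<bar>f z\<bar> \<le> height \<kappa> 0 + 2"
  shows "(f z)\<^sup>2 \<le> majorant z" "\<bar>f z\<bar> \<le> majorant z"
proof -
  define C where "C = height \<kappa> 0 + 2"
  have C: "C \<ge> 5" using height_ge[of 0] by (simp add: C_def)
  \<comment> \<open>A bound \<open>b \<ge> 1\<close> satisfies \<open>b \<le> b\<^sup>2\<close>, so
    one estimate of the square yields both conclusions.\<close>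
  have main: "\<exists>b. \<bar>f z\<bar> \<le> b \<and> 1 \<le> b \<and> b\<^sup>2 \<le> majorant z"
    using z
  proof (cases rule: level_cases)
    case 1
    then have "z \<notin> \<Omega> n" for n using \<Omega>_mono[of 0 n] by auto
    then have "majorant z = 2 * C\<^sup>2" by (simp add: majorant_def C_def)
    then show ?thesis using f(2)[OF 1] C by (intro exI[of _ C]) (auto simp: C_def)
  next
    case (2 n)
    have "z \<in> \<Omega> k" if "k \<le> n" for k using 2 \<Omega>_mono[OF that] by auto
    moreover have "z \<notin> \<Omega> k" if "k > n" for k using 2 \<Omega>_mono[of "Suc n" k] that by auto
    ultimately have ind: "indicator (\<Omega> k) z = (if k \<le> n then 1 else 0 :: real)" for k
      by (auto simp: indicator_def)
    have "(\<Sum>k. (real k + 1) * indicator (\<Omega> k) z) = (\<Sum>k\<le>n. (real k + 1) * indicator (\<Omega> k) z)"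
      by (rule suminf_finite) (auto simp: ind)
    also have "\<dots> = (\<Sum>k\<le>n. real k + 1)" by (rule sum.cong) (auto simp: ind)
    also have "\<dots> = (real n + 1) * (real n + 2) / 2"
      by (induction n) (auto simp: field_simps)
    finally have m: "majorant z = 2 * C\<^sup>2 * (1 + (real n + 1) * (real n + 2) / 2)"
      by (simp add: majorant_def C_def)
    have "n + C \<le> C * (real n + 1)" using C mult_right_mono[of 1 C "real n"] by (simp add: algebra_simps)
    then have "(n + C)\<^sup>2 \<le> (C * (real n + 1))\<^sup>2" using C by (intro power_mono) auto
    also have "\<dots> = C\<^sup>2 * ((real n + 1) * (real n + 1))" by (simp add: power2_eq_square)
    also have "\<dots> \<le> C\<^sup>2 * (2 * (1 + (real n + 1) * (real n + 2) / 2))"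
    proof (rule mult_left_mono)
      have "(real n + 1) * (real n + 1) \<le> (real n + 1) * (real n + 2)"
        by (intro mult_left_mono) auto
      also have "\<dots> \<le> 2 * (1 + (real n + 1) * (real n + 2) / 2)"
        by (simp add: distrib_left[of 2])
      finally show "(real n + 1) * (real n + 1) \<le> 2 * (1 + (real n + 1) * (real n + 2) / 2)" .
    qed simp
    also have "\<dots> = majorant z" by (simp add: m)
    finally show ?thesis using f(1)[OF 2] C by (intro exI[of _ "n + C"]) (auto simp: C_def height_def)
  qed
  then obtain b where b: "\<bar>f z\<bar> \<le> b" "1 \<le> b" "b\<^sup>2 \<le> majorant z" by blast
  have "(f z)\<^sup>2 \<le> b\<^sup>2" using b by (metis abs_ge_zero power2_abs power_mono)
  then show "(f z)\<^sup>2 \<le> majorant z" using b by simp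
  have "b \<le> b\<^sup>2" using b by (simp add: power2_eq_square)
  then show "\<bar>f z\<bar> \<le> majorant z" using b by simp
qed

end

section \<open>The solution\<close>

lemma geometric_series_bounds:
  fixes f :: "nat \<Rightarrow> real \<times> real \<Rightarrow> real"
  assumes bound: "\<And>k z. \<bar>f k z\<bar> \<le> (1 / 2) ^ k" and cont: "\<And>k. continuous_on UNIV (f k)"
  shows "\<bar>\<Sum>k<j. f k z\<bar> \<le> 2" "\<bar>\<Sum>k. f k z\<bar> \<le> 2" "(\<lambda>j. \<Sum>k<j. f k z) \<longlonglongrightarrow> (\<Sum>k. f k z)"
    "continuous_on UNIV (\<lambda>z. \<Sum>k. f k z)"
proof -
  have geo: "summable (\<lambda>k. (1 / 2 :: real) ^ k)" "(\<Sum>k. (1 / 2 :: real) ^ k) = 2"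
    using suminf_geometric[of "1 / 2 :: real"] by (simp_all add: summable_geometric)
  have part: "\<bar>\<Sum>k<j. f k z\<bar> \<le> 2" for j
  proof -
    have "\<bar>\<Sum>k<j. f k z\<bar> \<le> (\<Sum>k<j. \<bar>f k z\<bar>)" by (rule sum_abs)
    also have "\<dots> \<le> (\<Sum>k<j. (1 / 2) ^ k)" by (rule sum_mono) (rule bound)
    also have "\<dots> \<le> 2" using sum_le_suminf[OF geo(1), of "{..<j}"] by (simp add: geo)
    finally show ?thesis .
  qed
  then show "\<bar>\<Sum>k<j. f k z\<bar> \<le> 2" .
  have lim: "uniform_limit UNIV (\<lambda>n x. \<Sum>i<n. f i x) (\<lambda>x. \<Sum>i. f i x) sequentially"
    by (rule Weierstrass_m_test[OF _ geo(1)]) (use bound in simp)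
  then show tendsto: "(\<lambda>j. \<Sum>k<j. f k z) \<longlonglongrightarrow> (\<Sum>k. f k z)"
    by (rule tendsto_uniform_limitI) simp
  show "\<bar>\<Sum>k. f k z\<bar> \<le> 2"
    by (rule LIMSEQ_le_const2[OF tendsto_rabs[OF tendsto]]) (use part in blast)
  show "continuous_on UNIV (\<lambda>z. \<Sum>k. f k z)"
    by (rule uniform_limit_theorem[OF _ lim]) (auto intro!: always_eventually continuous_on_sum cont)
qed

lemma pd_cong_open:
  assumes "open S" "\<And>z. z \<in> S \<Longrightarrow> f z = g z" "z \<in> S"
  shows "pd_t f z = pd_t g z" "pd_x f z = pd_x g z"
proof -
  obtain t x where z: "z = (t, x)" by force
  have "continuous_on UNIV (\<lambda>s. (s, x))" "continuous_on UNIV (\<lambda>y. (t, y))"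
    by (intro continuous_on_Pair continuous_on_id continuous_on_const)+
  then have "open ((\<lambda>s. (s, x)) -` S)" "open ((\<lambda>y. (t, y)) -` S)"
    using assms(1) open_vimage by blast+
  then have "\<forall>\<^sub>F s in nhds t. f (s, x) = g (s, x)" "\<forall>\<^sub>F y in nhds x. f (t, y) = g (t, y)"
    using assms(2,3) z by (auto simp: eventually_nhds vimage_def)
  then show "pd_t f z = pd_t g z" "pd_x f z = pd_x g z"
    by (auto simp: z pd_t_def pd_x_def intro!: deriv_cong_ev)
qed

lemma ex_cutoff_interval:
  fixes a b t1 t2 :: real
  assumes "a < t1" "t2 < b"
  obtains \<zeta> s1 s2 where "smooth \<zeta>" "\<And>t. t1 \<le> t \<Longrightarrow> t \<le> t2 \<Longrightarrow> \<zeta> t = 1"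
    "\<And>t. t \<notin> {s1..s2} \<Longrightarrow> \<zeta> t = 0" "a < s1" "s1 < t1" "t2 < s2" "s2 < b"
proof -
  define \<eta> where "\<eta> = min (t1 - a) (b - t2) / 2"
  have \<eta>: "\<eta> > 0" "a < t1 - \<eta>" "t2 + \<eta> < b"
    using assms by (auto simp: \<eta>_def min_def field_simps)
  obtain P where P: "smooth P"
    "\<And>x. t1 - \<eta> + \<eta> \<le> x \<Longrightarrow> x \<le> t2 + \<eta> - \<eta> \<Longrightarrow> P x = 1"
    "\<And>x. x \<le> t1 - \<eta> \<or> t2 + \<eta> \<le> x \<Longrightarrow> P x = 0"
    using ex_plateau[OF \<eta>(1), of "t1 - \<eta>" "t2 + \<eta>"] by metis
  show ?thesis
    by (rule that[of P "t1 - \<eta>" "t2 + \<eta>"]) (use P \<eta> in auto)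
qed

lemma borel_imp_lebesgue_on:
  "f \<in> borel_measurable borel \<Longrightarrow> f \<in> borel_measurable (lebesgue_on S)"
  by (intro measurable_restrict_space1 measurable_completion) simp

context staircase
begin

section \<open>The limit function and its coefficient\<close>

abbreviation gt :: "nat \<Rightarrow> real \<times> real \<Rightarrow> real" where "gt \<equiv> \<lambda>k. pd_t (w k)"
abbreviation gxx :: "nat \<Rightarrow> real \<times> real \<Rightarrow> real" where "gxx \<equiv> \<lambda>k. pd_x (pd_x (w k))"
abbreviation h0 :: real where "h0 \<equiv> height \<kappa> 0"

text \<open>A multiple of the caloric polynomial t + x^2/2: both u_t and u_xx equal
  \<open>h0\<close>, the bottom of the staircase.\<close>

definition base :: "real \<times> real \<Rightarrow> real" where "base z = h0 * (fst z + (snd z)\<^sup>2 / 2)"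

definition sol :: "real \<times> real \<Rightarrow> real" where "sol z = base z + (\<Sum>k. w k z)"
definition sol_x :: "real \<times> real \<Rightarrow> real" where "sol_x z = h0 * snd z + (\<Sum>k. pd_x (w k) z)"

text \<open>The clamping secures the bounds at every point, including \<open>core\<close>, where
  \<open>total\<close> has no meaning. Off \<open>core\<close> it does not change the
  quotient.\<close>

definition coeff :: "real \<times> real \<Rightarrow> real"
  where "coeff z = max \<kappa> (min (inverse \<kappa>) (total gt z / total gxx z))"

lemma base_pd:
  shows tensor_base: "tensor_sum base"
    and base_t: "pd_t base = (\<lambda>z. h0)" and base_x: "pd_x base = (\<lambda>z. h0 * snd z)"
    and base_xx: "pd_x (pd_x base) = (\<lambda>z. h0)"
proof -
  have eq: "base = (\<lambda>z. (h0 * fst z) * 1 + 1 * (h0 / 2 * (snd z * snd z)))"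
    by (auto simp: base_def power2_eq_square algebra_simps)
  show "tensor_sum base"
    unfolding eq by (intro tensor_add tensor_prod smooth_mult smooth_const smooth_id)
  have "((\<lambda>t. base (t, x)) has_real_derivative h0) (at t)" for t x
    unfolding base_def by (auto intro!: derivative_eq_intros)
  then show "pd_t base = (\<lambda>z. h0)"
    by (auto simp: pd_t_def DERIV_imp_deriv)
  have "((\<lambda>y. base (t, y)) has_real_derivative h0 * x) (at x)" for t x
    unfolding base_def by (auto intro!: derivative_eq_intros)
  then show x: "pd_x base = (\<lambda>z. h0 * snd z)"
    by (auto simp: pd_x_def DERIV_imp_deriv)
  have "((\<lambda>y. h0 * y) has_real_derivative h0) (at x)" for x
    by (auto intro!: derivative_eq_intros)
  then show "pd_x (pd_x base) = (\<lambda>z. h0)"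
    unfolding x by (auto simp: pd_x_def DERIV_imp_deriv)
qed

text \<open>The start \<open>b\<close> is a parameter: \<open>base\<close> leads to the solution, a
  compactly supported version of it to the test functions.\<close>

definition approx :: "(real \<times> real \<Rightarrow> real) \<Rightarrow> nat \<Rightarrow> real \<times> real \<Rightarrow> real"
  where "approx b j z = b z + (\<Sum>k<j. w k z)"

lemma approx_pd:
  assumes "tensor_sum b"
  shows "tensor_sum (approx b j)" "pd_t (approx b j) = (\<lambda>z. pd_t b z + (\<Sum>k<j. gt k z))"
    "pd_x (approx b j) = (\<lambda>z. pd_x b z + (\<Sum>k<j. pd_x (w k) z))"
    "pd_x (pd_x (approx b j)) = (\<lambda>z. pd_x (pd_x b) z + (\<Sum>k<j. gxx k z))"
  using tensor_sum_sum[where w = w and n = j, OF assms tensor_w]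
    tensor_sum_sum(3)[where w = "\<lambda>k. pd_x (w k)" and n = j, OF tensor_sum_pd_x[OF assms] tensor_sum_pd_x[OF tensor_w]]
  by (simp_all add: approx_def[abs_def])

lemma w_series:
  "\<bar>\<Sum>k<j. w k z\<bar> \<le> 2" "\<bar>\<Sum>k. w k z\<bar> \<le> 2" "(\<lambda>j. \<Sum>k<j. w k z) \<longlonglongrightarrow> (\<Sum>k. w k z)"
  "continuous_on UNIV (\<lambda>z. \<Sum>k. w k z)"
  using geometric_series_bounds[of w] w_bound tensor_sum_continuous[OF tensor_w] by blast+

lemma w_x_series:
  "\<bar>\<Sum>k<j. pd_x (w k) z\<bar> \<le> 2" "\<bar>\<Sum>k. pd_x (w k) z\<bar> \<le> 2"
  "(\<lambda>j. \<Sum>k<j. pd_x (w k) z) \<longlonglongrightarrow> (\<Sum>k. pd_x (w k) z)"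
  "continuous_on UNIV (\<lambda>z. \<Sum>k. pd_x (w k) z)"
  using geometric_series_bounds[of "\<lambda>k. pd_x (w k)"] w_x_bound
    tensor_sum_continuous[OF tensor_sum_pd_x[OF tensor_w]] by blast+

lemma h0_ge: "h0 \<ge> 3"
  using height_ge[of 0] by simp

lemma base_bounds:
  assumes "z \<in> Q"
  shows "\<bar>base z\<bar> \<le> 2 * h0" "\<bar>h0 * snd z\<bar> \<le> h0"
proof -
  have z: "\<bar>fst z\<bar> \<le> 1" "\<bar>snd z\<bar> \<le> 1" using assms by (auto simp: Q_def)
  then have "(snd z)\<^sup>2 \<le> 1" by (simp add: abs_square_le_1)
  then have "\<bar>fst z + (snd z)\<^sup>2 / 2\<bar> \<le> 2" using z zero_le_power2[of "snd z"] unfolding abs_le_iff by linarith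
  then show "\<bar>base z\<bar> \<le> 2 * h0"
    using h0_ge by (simp add: base_def abs_mult mult.commute mult_left_mono)
  show "\<bar>h0 * snd z\<bar> \<le> h0"
    using z h0_ge by (simp add: abs_mult mult_left_le)
qed

lemma continuous_sol: "continuous_on UNIV sol" and continuous_sol_x: "continuous_on UNIV sol_x"
  unfolding sol_def[abs_def] sol_x_def[abs_def]
  by (intro continuous_on_add w_series w_x_series tensor_sum_continuous[OF tensor_base] continuous_intros)+

lemma sol_bounds:
  assumes "z \<in> Q"
  shows "\<bar>sol z\<bar> \<le> 2 * h0 + 2" "\<bar>sol_x z\<bar> \<le> 2 * h0 + 2"
    "\<bar>approx base j z\<bar> \<le> 2 * h0 + 2" "\<bar>pd_x (approx base j) z\<bar> \<le> 2 * h0 + 2"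
  using base_bounds[OF assms] w_series(1)[where z = z and j = j] w_series(2)[where z = z]
    w_x_series(1)[where z = z and j = j] w_x_series(2)[where z = z] h0_ge
  unfolding sol_def sol_x_def approx_pd(3)[OF tensor_base] base_x approx_def by linarith+

lemma approx_base_pd: "pd_t (approx base j) = partial gt j" "pd_x (pd_x (approx base j)) = partial gxx j"
  unfolding approx_pd(2,4)[OF tensor_base] base_t base_xx partial_def by (rule refl)+

text \<open>Adding the uniform bound on u and u_x gives one integrable majorant for all sequences
  and limits in \<open>weak_deriv_limit\<close>.\<close>

definition bnd :: "real \<times> real \<Rightarrow> real" where "bnd z = majorant z + (2 * h0 + 2)"

lemma bnd_integrable: "integrable (lebesgue_on Q) bnd"
  unfolding bnd_def[abs_def]
  by (intro Bochner_Integration.integrable_add majorant_integrable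
      finite_measure.integrable_const[OF finite_measure_lebesgue_on]) simp

lemma bnd_level:
  assumes g: "level_increment g" and z: "z \<notin> core"
  shows "\<bar>partial g j z\<bar> \<le> bnd z" "\<bar>total g z\<bar> \<le> bnd z" "(total g z)\<^sup>2 \<le> bnd z" "2 * h0 + 2 \<le> bnd z"
proof -
  have c: "2 * h0 + 2 \<ge> 0" using h0_ge by simp
  have t: "\<bar>total g z\<bar> \<le> height \<kappa> n + 2" if "z \<in> \<Omega> n" "z \<notin> \<Omega> (Suc n)" for n
  proof -
    have "0 \<le> \<kappa> * height \<kappa> n" using \<kappa> height_ge[of n] by simp
    then show ?thesis using total_bounds[OF g that] by simp
  qed
  have t0: "\<bar>total g z\<bar> \<le> h0 + 2" if "z \<notin> \<Omega> 0"
    using level_increment_outside[OF g that] h0_ge by simp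
  have pt: "\<bar>partial g j z\<bar> \<le> height \<kappa> n + 2" if "z \<in> \<Omega> n" "z \<notin> \<Omega> (Suc n)" for n
    using partial_bounds[OF g that] by simp
  have pt0: "\<bar>partial g j z\<bar> \<le> h0 + 2" if "z \<notin> \<Omega> 0"
    using level_increment_outside[OF g that] h0_ge by simp
  show "\<bar>partial g j z\<bar> \<le> bnd z"
    using majorant(2)[of z "partial g j", OF z pt pt0] c by (simp add: bnd_def)
  show "\<bar>total g z\<bar> \<le> bnd z" "(total g z)\<^sup>2 \<le> bnd z"
    using majorant[of z "total g", OF z t t0] c by (simp_all add: bnd_def)
  have "0 \<le> majorant z"
    using majorant(1)[of z "total g", OF z t t0] zero_le_power2[of "total g z"] by linarith
  then show "2 * h0 + 2 \<le> bnd z" by (simp add: bnd_def)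
qed

lemma sol_measurable: "sol \<in> borel_measurable borel" "sol_x \<in> borel_measurable borel"
  using continuous_sol continuous_sol_x by (simp_all add: borel_measurable_continuous_onI)

section \<open>Weak derivatives, membership in the Sobolev space and the equation\<close>

lemma Lp_2_of_bound:
  assumes "f \<in> borel_measurable borel" "AE z in lebesgue_on Q. (f z)\<^sup>2 \<le> H z" "integrable (lebesgue_on Q) H"
  shows "f \<in> Lp 2 Q"
proof -
  have f: "f \<in> borel_measurable (lebesgue_on Q)" by (rule borel_imp_lebesgue_on[OF assms(1)])
  have "integrable (lebesgue_on Q) (\<lambda>z. (f z)\<^sup>2)"
  proof (rule Bochner_Integration.integrable_bound[OF assms(3)])
    show "(\<lambda>z. (f z)\<^sup>2) \<in> borel_measurable (lebesgue_on Q)" using f by simp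
    show "AE z in lebesgue_on Q. norm ((f z)\<^sup>2) \<le> norm (H z)"
      using assms(2) by eventually_elim auto
  qed
  then show ?thesis using f by (simp add: Lp_def)
qed

text \<open>The truncated sums are smooth, so they can be integrated by parts, twice for u_xx;
  dominated convergence then carries the identities to the limit.\<close>

lemma sol_weak_derivs:
  "weak_deriv 1 0 Q sol (total gt)" "weak_deriv 0 1 Q sol sol_x" "weak_deriv 0 2 Q sol (total gxx)"
proof -
  note T = approx_pd(1)[OF tensor_base]
  note meas = borel_imp_lebesgue_on borel_measurable_continuous_onI
  have c: "continuous_on UNIV (approx base j)" "continuous_on UNIV (pd_x (approx base j))"
    "continuous_on UNIV (pd_t (approx base j))" "continuous_on UNIV (pd_x (pd_x (approx base j)))" for j
    by (intro tensor_sum_continuous tensor_sum_pd_t tensor_sum_pd_x T)+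
  have sol_lim: "AE z in lebesgue_on Q. (\<lambda>j. approx base j z) \<longlonglongrightarrow> sol z"
    unfolding approx_def sol_def by (intro AE_I2 tendsto_add tendsto_const w_series)
  have sol_x_lim: "AE z in lebesgue_on Q. (\<lambda>j. pd_x (approx base j) z) \<longlonglongrightarrow> sol_x z"
    unfolding approx_pd(3)[OF tensor_base] base_x sol_x_def
    by (intro AE_I2 tendsto_add tendsto_const w_x_series)
  have bnds: "AE z in lebesgue_on Q. \<bar>approx base j z\<bar> \<le> bnd z" "AE z in lebesgue_on Q. \<bar>sol z\<bar> \<le> bnd z"
    "AE z in lebesgue_on Q. \<bar>pd_x (approx base j) z\<bar> \<le> bnd z" "AE z in lebesgue_on Q. \<bar>sol_x z\<bar> \<le> bnd z" for j
    using AE_Q_core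
    by (eventually_elim, use sol_bounds bnd_level(4)[OF level_increment_w(1)] order_trans in blast)+
  have lvl: "AE z in lebesgue_on Q. (\<lambda>j. partial g j z) \<longlonglongrightarrow> total g z"
    "AE z in lebesgue_on Q. \<bar>partial g j z\<bar> \<le> bnd z" "AE z in lebesgue_on Q. \<bar>total g z\<bar> \<le> bnd z"
    if g: "level_increment g" for g j
    using AE_Q_core by (eventually_elim, use partial_tendsto[OF g] bnd_level[OF g] in blast)+
  have ibp_x: "(\<integral>z. v z * pd_x \<phi> z \<partial>lebesgue_on Q) = - (\<integral>z. pd_x v z * \<phi> z \<partial>lebesgue_on Q)"
    if "tensor_sum v" "\<phi> \<in> C0_inf Q" for v \<phi>
    using that by (intro integration_by_parts_x tensor_sum_continuous tensor_sum_has_pd_x tensor_sum_pd_x)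
  have ibp_t: "(\<integral>z. v z * pd_t \<phi> z \<partial>lebesgue_on Q) = - (\<integral>z. pd_t v z * \<phi> z \<partial>lebesgue_on Q)"
    if "tensor_sum v" "\<phi> \<in> C0_inf Q" for v \<phi>
    using that by (intro integration_by_parts_t tensor_sum_continuous tensor_sum_has_pd_t tensor_sum_pd_t)
  show "weak_deriv 1 0 Q sol (total gt)"
  proof (rule weak_deriv_limit[where f = "approx base" and g = "partial gt" and H = bnd])
    show "(\<integral>z. approx base j z * (pd_t ^^ 1) ((pd_x ^^ 0) \<phi>) z \<partial>lebesgue_on Q) =
        (-1) ^ (1 + 0) * (\<integral>z. partial gt j z * \<phi> z \<partial>lebesgue_on Q)" if "\<phi> \<in> C0_inf Q" for j \<phi>
      using ibp_t[OF T that] by (simp add: approx_base_pd)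
  qed (intro meas c sol_lim bnds lvl level_increment_w bnd_integrable borel_imp_lebesgue_on
      sol_measurable partial_measurable total_measurable)+
  show "weak_deriv 0 1 Q sol sol_x"
  proof (rule weak_deriv_limit[where f = "approx base" and g = "\<lambda>j. pd_x (approx base j)" and H = bnd])
    show "(\<integral>z. approx base j z * (pd_t ^^ 0) ((pd_x ^^ 1) \<phi>) z \<partial>lebesgue_on Q) =
        (-1) ^ (0 + 1) * (\<integral>z. pd_x (approx base j) z * \<phi> z \<partial>lebesgue_on Q)" if "\<phi> \<in> C0_inf Q" for j \<phi>
      using ibp_x[OF T that] by simp
  qed (intro meas c sol_lim sol_x_lim bnds bnd_integrable borel_imp_lebesgue_on sol_measurable)+
  show "weak_deriv 0 2 Q sol (total gxx)"
  proof (rule weak_deriv_limit[where f = "approx base" and g = "partial gxx" and H = bnd])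
    show "(\<integral>z. approx base j z * (pd_t ^^ 0) ((pd_x ^^ 2) \<phi>) z \<partial>lebesgue_on Q) =
        (-1) ^ (0 + 2) * (\<integral>z. partial gxx j z * \<phi> z \<partial>lebesgue_on Q)" if "\<phi> \<in> C0_inf Q" for j \<phi>
      using ibp_x[OF T C0_infD(3)[OF that]] ibp_x[OF tensor_sum_pd_x[OF T] that]
      by (simp add: approx_base_pd numeral_2_eq_2)
  qed (intro meas c sol_lim bnds lvl level_increment_w bnd_integrable borel_imp_lebesgue_on
      sol_measurable partial_measurable total_measurable)+
qed

lemma sol_W12_2: "sol \<in> W12_2 Q"
proof -
  have "integrable (lebesgue_on Q) (\<lambda>_. (2 * h0 + 2)\<^sup>2)"
    by (rule finite_measure.integrable_const[OF finite_measure_lebesgue_on]) simp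
  moreover have "AE z in lebesgue_on Q. (sol z)\<^sup>2 \<le> (2 * h0 + 2)\<^sup>2" "AE z in lebesgue_on Q. (sol_x z)\<^sup>2 \<le> (2 * h0 + 2)\<^sup>2"
    using AE_Q_core
    by (eventually_elim, metis sol_bounds(1,2) abs_ge_zero power2_abs power_mono)+
  ultimately have "sol \<in> Lp 2 Q" "sol_x \<in> Lp 2 Q"
    using sol_measurable by (auto intro: Lp_2_of_bound)
  moreover have "total g \<in> Lp 2 Q" if g: "level_increment g" for g
  proof (rule Lp_2_of_bound[OF total_measurable[OF g] _ bnd_integrable])
    show "AE z in lebesgue_on Q. (total g z)\<^sup>2 \<le> bnd z"
      using AE_Q_core by eventually_elim (use bnd_level(3)[OF g] in blast)
  qed
  ultimately show ?thesis
    unfolding W12_2_def using sol_weak_derivs level_increment_w by blast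
qed

lemma coeff_measurable: "coeff \<in> borel_measurable borel"
proof -
  note [measurable] = total_measurable[OF level_increment_w(1)] total_measurable[OF level_increment_w(2)]
  show ?thesis unfolding coeff_def[abs_def] by measurable
qed

lemma coeff_bounds: "\<kappa> \<le> coeff z" "coeff z \<le> inverse \<kappa>"
proof -
  have "\<kappa> \<le> inverse \<kappa>" using \<kappa> by (simp add: field_simps mult_le_one)
  then show "\<kappa> \<le> coeff z" "coeff z \<le> inverse \<kappa>" by (auto simp: coeff_def)
qed

text \<open>Admissibility in the one step that is not constant on the layer puts the quotient
  between \<kappa> and 1 / \<kappa>, so the clamp is inactive. Outside \<open>\<Omega> 0\<close> the
  quotient is 1.\<close>

lemma coeff_equation:
  assumes "z \<notin> core"
  shows "total gt z = coeff z * total gxx z"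
proof -
  have *: "0 < total gxx z \<and> \<kappa> * total gxx z \<le> total gt z \<and> \<kappa> * total gt z \<le> total gxx z"
    using assms
  proof (cases rule: level_cases)
    case 1
    have "\<kappa> * h0 \<le> 1 * h0" using \<kappa> h0_ge by (intro mult_right_mono) auto
    then show ?thesis
      using level_increment_outside(2)[OF level_increment_w(1) 1] level_increment_outside(2)[OF level_increment_w(2) 1] h0_ge
      by simp
  next
    case (2 n)
    have "\<kappa> * height \<kappa> n > 0" using \<kappa> height_ge[of n] by simp
    then show ?thesis
      using w_admissible[of n z] total_level[OF level_increment_w(1) 2] total_level[OF level_increment_w(2) 2]
      by (auto simp: admissible_def)
  qed
  then have "\<kappa> \<le> total gt z / total gxx z" "total gt z / total gxx z \<le> inverse \<kappa>"
    using \<kappa> by (auto simp: field_simps)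
  then have "coeff z = total gt z / total gxx z" by (simp add: coeff_def)
  then show ?thesis using * by simp
qed

text \<open>Supplies the hypothesis of \<open>Lp_lower\<close>. A truncated sum agrees with the full
  one below level \<open>j\<close> and has the value \<open>height \<kappa> j\<close> on
  \<open>\<Omega> j\<close>, which is still large enough for every \<open>n \<le> j\<close>.\<close>

lemma level_Lp_lower:
  assumes g: "level_increment g" and z: "z \<notin> core" "n \<le> j" "z \<in> \<Omega> n"
  shows "\<kappa> * real n \<le> partial g j z" "\<kappa> * real n \<le> total g z"
proof -
  have "z \<in> \<Omega> 0" using z \<Omega>_mono[of 0 n] by auto
  then obtain k where k: "z \<in> \<Omega> k" "z \<notin> \<Omega> (Suc k)"
    using level_cases[OF z(1)] by blast
  have "n \<le> k" using z k \<Omega>_mono[of "Suc k" n] by (meson not_less_eq_eq subsetD)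
  have le: "\<kappa> * real n \<le> \<kappa> * height \<kappa> k"
    using \<kappa> \<open>n \<le> k\<close> height_ge[of k] by (intro mult_left_mono) auto
  then show "\<kappa> * real n \<le> total g z" using total_bounds(1)[OF g k] by linarith
  show "\<kappa> * real n \<le> partial g j z"
  proof (cases "k < j")
    case True
    then show ?thesis using total_bounds(1)[OF g k] partial_level[OF g k True] total_level[OF g k] le by linarith
  next
    case False
    then have "z \<in> \<Omega> j" using k \<Omega>_mono[of j k] by auto
    have "\<kappa> * real n \<le> 1 * real n" using \<kappa> by (intro mult_right_mono) auto
    also have "\<dots> \<le> height \<kappa> j" using z(2) height_ge[of j] by simp
    finally show ?thesis using partial_in[OF g \<open>z \<in> \<Omega> j\<close>] by simp
  qed
qed

text \<open>Finiteness of the integral would bound \<open>ln (real j)\<close> uniformly in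
  \<open>j\<close>, by \<open>Lp_lower\<close>.\<close>

lemma not_Lp:
  assumes g: "level_increment g"
  shows "total g \<notin> Lp p (\<Omega> 0)"
proof
  assume "total g \<in> Lp p (\<Omega> 0)"
  then have int: "integrable (lebesgue_on (\<Omega> 0)) (\<lambda>z. \<bar>total g z\<bar> powr p)" by (simp add: Lp_def)
  define I where "I = (\<integral>z. \<bar>total g z\<bar> powr p \<partial>lebesgue_on (\<Omega> 0))"
  define c where "c = d0 * (\<kappa> / 2) powr p"
  have c: "c > 0" using d0_pos \<kappa> by (simp add: c_def)
  have le: "c * ln (real j) \<le> I" if "j \<ge> 1" for j
    unfolding c_def I_def
  proof (rule Lp_lower[OF _ int that])
    show "AE z in lebesgue_on (\<Omega> 0). \<forall>n\<le>j. z \<in> \<Omega> n \<longrightarrow> \<kappa> * real n \<le> \<bar>total g z\<bar>"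
      using AE_D_core by eventually_elim (use level_Lp_lower(2)[OF g] in fastforce)
  qed
  obtain j :: nat where j: "exp (I / c + 1) < real j" using reals_Archimedean2 by blast
  then have "j \<ge> 1" using exp_gt_zero[of "I / c + 1"] by (cases j) auto
  then have "ln (exp (I / c + 1)) < ln (real j)" using j by (subst ln_less_cancel_iff) auto
  then have "I / c < ln (real j)" by simp
  then have "I < c * ln (real j)" using c by (simp add: divide_less_eq mult.commute)
  then show False using le[OF \<open>j \<ge> 1\<close>] by simp
qed

section \<open>Distribution of u_t and u_xx on the initial rectangle\<close>

lemma total_tail_sets:
  assumes "level_increment g"
  shows "{z \<in> \<Omega> 0. total g z > \<tau>} \<in> sets lebesgue" "{z \<in> \<Omega> 0. \<bar>total g z\<bar> > \<tau>} \<in> sets lebesgue"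
proof -
  note [measurable] = total_measurable[OF assms]
  have [measurable]: "\<Omega> 0 \<in> sets borel" by simp
  have "{z \<in> \<Omega> 0. total g z > \<tau>} \<in> sets borel" "{z \<in> \<Omega> 0. \<bar>total g z\<bar> > \<tau>} \<in> sets borel"
    by measurable
  then show "{z \<in> \<Omega> 0. total g z > \<tau>} \<in> sets lebesgue" "{z \<in> \<Omega> 0. \<bar>total g z\<bar> > \<tau>} \<in> sets lebesgue"
    by auto
qed

definition tail_const :: real where "tail_const = d0 * (2 * (h0 + 2)) powr p"

lemma total_upper_tail:
  assumes g: "level_increment g" and "\<tau> > 0"
  shows "measure lebesgue {z \<in> \<Omega> 0. \<bar>total g z\<bar> > \<tau>} \<le> tail_const * \<tau> powr (- p)"
  unfolding tail_const_def
proof (rule upper_tail[OF _ assms(2) total_tail_sets(2)[OF g]])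
  fix n z assume z: "z \<in> \<Omega> n" "z \<notin> \<Omega> (Suc n)"
  have "0 \<le> \<kappa> * height \<kappa> n" using \<kappa> height_ge[of n] by simp
  then show "\<bar>total g z\<bar> \<le> height \<kappa> n + 2" using total_bounds[OF g z] by simp
qed

lemma total_weak_Lp:
  assumes g: "level_increment g"
  shows "total g \<in> weak_Lp p (\<Omega> 0)"
  unfolding weak_Lp_def
proof (intro CollectI conjI exI allI impI)
  show "total g \<in> borel_measurable (lebesgue_on (\<Omega> 0))"
    by (rule borel_imp_lebesgue_on[OF total_measurable[OF g]])
  fix \<tau> :: real assume "0 < \<tau>"
  have "{z \<in> \<Omega> 0. \<bar>total g z\<bar> > \<tau>} \<in> lmeasurable"
    by (rule fmeasurableI2[OF \<Omega>_lmeasurable[of 0] _ total_tail_sets(2)[OF g]]) auto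
  then have "emeasure lebesgue {z \<in> \<Omega> 0. \<bar>total g z\<bar> > \<tau>} = ennreal (measure lebesgue {z \<in> \<Omega> 0. \<bar>total g z\<bar> > \<tau>})"
    by (rule emeasure_eq_measure2)
  also have "\<dots> \<le> ennreal (tail_const * \<tau> powr (- p))"
    by (rule ennreal_leI[OF total_upper_tail[OF g \<open>0 < \<tau>\<close>]])
  finally show "emeasure lebesgue {z \<in> \<Omega> 0. \<bar>total g z\<bar> > \<tau>} \<le> ennreal (tail_const * \<tau> powr (- p))" .
qed

lemma total_tail:
  assumes g: "level_increment g"
  shows "\<exists>c>0. \<exists>N>0. \<forall>\<^sub>F \<tau> in at_top.
    c * \<tau> powr (- p) \<le> measure lebesgue {z \<in> \<Omega> 0. total g z > \<tau>} \<and>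
    measure lebesgue {z \<in> \<Omega> 0. total g z > \<tau>} \<le> N * \<tau> powr (- p)"
proof (intro exI conjI)
  show "0 < d0 * (\<kappa> / 3) powr p" "0 < tail_const"
    using d0_pos \<kappa> h0_ge by (auto simp: tail_const_def)
  show "\<forall>\<^sub>F \<tau> in at_top. d0 * (\<kappa> / 3) powr p * \<tau> powr (- p) \<le> measure lebesgue {z \<in> \<Omega> 0. total g z > \<tau>} \<and>
    measure lebesgue {z \<in> \<Omega> 0. total g z > \<tau>} \<le> tail_const * \<tau> powr (- p)"
    using eventually_ge_at_top[of 1]
  proof eventually_elim
    case (elim \<tau>)
    have "measure lebesgue {z \<in> \<Omega> 0. total g z > \<tau>} \<le> measure lebesgue {z \<in> \<Omega> 0. \<bar>total g z\<bar> > \<tau>}"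
    proof (rule measure_mono_fmeasurable[OF _ total_tail_sets(1)[OF g]])
      show "{z \<in> \<Omega> 0. \<bar>total g z\<bar> > \<tau>} \<in> lmeasurable"
        by (rule fmeasurableI2[OF \<Omega>_lmeasurable[of 0] _ total_tail_sets(2)[OF g]]) auto
    qed auto
    also have "\<dots> \<le> tail_const * \<tau> powr (- p)" using total_upper_tail[OF g, of \<tau>] elim by simp
    finally show ?case
      using lower_tail[OF total_bounds(1)[OF g] elim total_tail_sets(1)[OF g]] by blast
  qed
qed

end

section \<open>The test functions and the theorem\<close>

context staircase
begin

text \<open>Each term of the polynomial is multiplied by a time cutoff and a space cutoff, which
  keeps the form of a sum of products. The cutoffs are 1 on a closed rectangle inside
  \<open>Q\<close> that contains \<open>\<Omega> 0\<close>, so \<open>b\<close> coincides with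
  \<open>base\<close> on that open set and has the same derivatives there.\<close>

lemma ex_compact_base:
  assumes A: "A 0 \<subseteq> {t1..t2}" "-1 < t1" "t2 < 0" and B: "B 0 \<subseteq> {x1..x2}" "-1 < x1" "x2 < 1"
  obtains b K where "tensor_sum b" "compact K" "K \<subseteq> Q" "\<Omega> 0 \<subseteq> K" "\<And>z. z \<notin> K \<Longrightarrow> b z = 0"
    "\<And>z. z \<in> \<Omega> 0 \<Longrightarrow> pd_t b z = h0" "\<And>z. z \<in> \<Omega> 0 \<Longrightarrow> pd_x (pd_x b) z = h0"
proof -
  obtain \<zeta> s1 s2 where \<zeta>: "smooth \<zeta>" "\<And>t. t1 \<le> t \<Longrightarrow> t \<le> t2 \<Longrightarrow> \<zeta> t = 1"
    "\<And>t. t \<notin> {s1..s2} \<Longrightarrow> \<zeta> t = 0" "-1 < s1" "s1 < t1" "t2 < s2" "s2 < 0"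
    using ex_cutoff_interval[OF A(2,3)] by metis
  obtain \<xi> y1 y2 where \<xi>: "smooth \<xi>" "\<And>t. x1 \<le> t \<Longrightarrow> t \<le> x2 \<Longrightarrow> \<xi> t = 1"
    "\<And>t. t \<notin> {y1..y2} \<Longrightarrow> \<xi> t = 0" "-1 < y1" "y1 < x1" "x2 < y2" "y2 < 1"
    using ex_cutoff_interval[OF B(2,3)] by metis
  define b where "b z = (h0 * fst z * \<zeta> (fst z)) * \<xi> (snd z) + \<zeta> (fst z) * (h0 / 2 * (snd z * snd z) * \<xi> (snd z))" for z
  define K where "K = {s1..s2} \<times> {y1..y2}"
  have eq: "b z = base z" if "z \<in> \<Omega> 0" for z
  proof -
    have "\<zeta> (fst z) = 1" "\<xi> (snd z) = 1"
      using that A(1) B(1) by (auto simp: \<Omega>_def intro!: \<zeta>(2) \<xi>(2))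
    then show ?thesis by (simp add: b_def base_def power2_eq_square algebra_simps)
  qed
  note cong = pd_cong_open[OF \<Omega>_open[of 0]]
  show ?thesis
  proof (rule that[of b K])
    show "tensor_sum b"
      unfolding b_def[abs_def] by (intro tensor_add tensor_prod smooth_mult smooth_const smooth_id \<zeta>(1) \<xi>(1))
    show "compact K" "K \<subseteq> Q" "\<Omega> 0 \<subseteq> K"
      using \<zeta> \<xi> A B by (auto simp: K_def Q_def \<Omega>_def compact_Times)
    show "b z = 0" if "z \<notin> K" for z
      using that \<zeta>(3)[of "fst z"] \<xi>(3)[of "snd z"] by (auto simp: b_def K_def mem_Times_iff)
    show "pd_t b z = h0" if "z \<in> \<Omega> 0" for z
      using cong(1)[OF eq that] by (simp add: base_t)
    have "pd_x b z = pd_x base z" if "z \<in> \<Omega> 0" for z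
      using cong(2)[OF eq that] by simp
    from cong(2)[OF this] show "pd_x (pd_x b) z = h0" if "z \<in> \<Omega> 0" for z
      using that by (simp add: base_xx)
  qed
qed

lemma Linf_norm_le:
  assumes "f \<in> borel_measurable borel" "\<And>z. \<bar>f z\<bar> \<le> M"
  shows "Linf_norm Q f \<le> ereal M"
  unfolding Linf_norm_def
proof (rule esssup_I)
  have "f \<in> borel_measurable (lebesgue_on Q)" by (rule borel_imp_lebesgue_on[OF assms(1)])
  then show "(\<lambda>z. ereal \<bar>f z\<bar>) \<in> borel_measurable (lebesgue_on Q)" by simp
qed (use assms(2) in simp)

text \<open>The critical balance: a residual of order j on \<open>\<Omega> j\<close>, whose measure
  is of order j^(-p), contributes a bounded amount to the integral of the p-th power. The right side
  is free of \<open>j\<close>.\<close>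

lemma residual_Lp_norm:
  assumes f: "f \<in> borel_measurable borel" and C: "0 \<le> C1" "0 \<le> C2"
    and bound: "AE z in lebesgue_on Q. \<bar>f z\<bar> \<le> (if z \<in> \<Omega> j then C2 * height \<kappa> j else C1)"
  shows "Lp_norm p Q f \<le> ereal ((C1 powr p * measure lebesgue Q + (C2 * (2 * h0)) powr p * d0) powr (1 / p))"
proof -
  let ?M = "lebesgue_on Q"
  define H where "H z = C1 powr p + (C2 * height \<kappa> j) powr p * indicator (\<Omega> j) z" for z
  have p: "p > 0" using p_gt_2 by linarith
  have fm: "f \<in> borel_measurable ?M" by (rule borel_imp_lebesgue_on[OF f])
  have meas: "emeasure ?M (\<Omega> j) = emeasure lebesgue (\<Omega> j)" "measure ?M (\<Omega> j) = measure lebesgue (\<Omega> j)"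
    using \<Omega>_subset_Q by (auto simp: emeasure_restrict_space measure_restrict_space)
  have sets: "\<Omega> j \<in> sets ?M"
    using \<Omega>_subset_Q by (auto simp: sets_restrict_space_iff)
  have ind: "integrable ?M (indicator (\<Omega> j) :: _ \<Rightarrow> real)"
    using sets meas(1) fmeasurableD2[OF \<Omega>_lmeasurable[of j]]
    by (intro integrable_real_indicator) (simp_all only: top.not_eq_extremum infinity_ennreal_def)
  have const: "integrable ?M (\<lambda>_. c)" for c :: real
    by (rule finite_measure.integrable_const[OF finite_measure_lebesgue_on]) simp
  have H: "integrable ?M H"
    unfolding H_def by (intro Bochner_Integration.integrable_add const integrable_mult_right ind)
  have fH: "AE z in ?M. \<bar>f z\<bar> powr p \<le> H z"
    using bound
  proof eventually_elim
    case (elim z)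
    show ?case
    proof (cases "z \<in> \<Omega> j")
      case True
      then have "\<bar>f z\<bar> powr p \<le> (C2 * height \<kappa> j) powr p" using elim p by (intro powr_mono2) auto
      then show ?thesis using True by (simp add: H_def add_increasing)
    next
      case False
      then have "\<bar>f z\<bar> powr p \<le> C1 powr p" using elim p by (intro powr_mono2) auto
      then show ?thesis using False by (simp add: H_def)
    qed
  qed
  have int: "integrable ?M (\<lambda>z. \<bar>f z\<bar> powr p)"
  proof (rule Bochner_Integration.integrable_bound[OF H])
    show "(\<lambda>z. \<bar>f z\<bar> powr p) \<in> borel_measurable ?M" using fm by simp
    show "AE z in ?M. norm (\<bar>f z\<bar> powr p) \<le> norm (H z)"
      using fH by eventually_elim auto
  qed
  then have "f \<in> Lp p Q" using fm by (simp add: Lp_def)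
  have "(\<integral>z. \<bar>f z\<bar> powr p \<partial>?M) \<le> integral\<^sup>L ?M H"
    by (rule integral_mono_AE[OF int H fH])
  also have "\<dots> = C1 powr p * measure lebesgue Q + (C2 * height \<kappa> j) powr p * measure lebesgue (\<Omega> j)"
    unfolding H_def using ind const meas(2) \<Omega>_subset_Q[of j]
    by (subst Bochner_Integration.integral_add) (auto simp: Int_absorb2 measure_restrict_space)
  also have "(C2 * height \<kappa> j) powr p * measure lebesgue (\<Omega> j) \<le> (C2 * (2 * h0)) powr p * d0"
  proof -
    have "(C2 * height \<kappa> j) powr p * measure lebesgue (\<Omega> j)
        \<le> (C2 * height \<kappa> j) powr p * (d0 * (2 / (real j + 2)) powr p)"
      by (intro mult_left_mono measure_\<Omega>_upper) simp
    also have "\<dots> = d0 * (C2 * height \<kappa> j * (2 / (real j + 2))) powr p"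
      using C height_ge[of j] by (simp add: powr_mult powr_divide)
    also have "\<dots> \<le> d0 * (C2 * (2 * h0)) powr p"
    proof (intro mult_left_mono powr_mono2)
      \<comment> \<open>The factor j + 2 cancels the denominator in
        \<open>measure_\<Omega>_upper\<close>, which removes \<open>j\<close> from the
        bound.\<close>
      have "height \<kappa> j \<le> h0 * (real j + 2)"
        using h0_ge mult_right_mono[of 1 h0 "real j"] by (simp add: height_add[of j] algebra_simps)
      then have "height \<kappa> j * (2 / (real j + 2)) \<le> 2 * h0"
        by (simp add: divide_le_eq mult.commute mult.left_commute)
      then show "C2 * height \<kappa> j * (2 / (real j + 2)) \<le> C2 * (2 * h0)"
        using mult_left_mono[OF _ C(2)] by (simp only: mult.assoc)
      show "0 \<le> C2 * height \<kappa> j * (2 / (real j + 2))"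
        using C height_ge[of j] by simp
    qed (use d0_pos p in auto)
    finally show ?thesis by (simp only: mult.commute)
  qed
  finally have "(\<integral>z. \<bar>f z\<bar> powr p \<partial>?M) powr (1 / p)
      \<le> (C1 powr p * measure lebesgue Q + (C2 * (2 * h0)) powr p * d0) powr (1 / p)"
    using p by (intro powr_mono2) auto
  then show ?thesis using \<open>f \<in> Lp p Q\<close> by (simp add: Lp_norm_def)
qed

lemma test_functions:
  assumes A: "A 0 \<subseteq> {t1..t2}" "-1 < t1" "t2 < 0" and B: "B 0 \<subseteq> {x1..x2}" "-1 < x1" "x2 < 1"
  shows "\<exists>(\<phi> :: nat \<Rightarrow> real \<times> real \<Rightarrow> real). \<exists>c>0. \<exists>N>0. \<forall>j\<ge>1.
    \<phi> j \<in> C0_inf Q \<and>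
    Linf_norm Q (\<phi> j) + Linf_norm Q (pd_x (\<phi> j)) +
      Lp_norm p Q (\<lambda>z. pd_t (\<phi> j) z - coeff z * pd_x (pd_x (\<phi> j)) z) \<le> ereal N \<and>
    (\<integral>z. \<bar>pd_x (pd_x (\<phi> j)) z\<bar> powr p \<partial>lebesgue_on (\<Omega> 0)) \<ge> c * ln (real j)"
proof -
  obtain b K where b: "tensor_sum b" "compact K" "K \<subseteq> Q" "\<Omega> 0 \<subseteq> K" "\<And>z. z \<notin> K \<Longrightarrow> b z = 0"
    "\<And>z. z \<in> \<Omega> 0 \<Longrightarrow> pd_t b z = h0" "\<And>z. z \<in> \<Omega> 0 \<Longrightarrow> pd_x (pd_x b) z = h0"
    using ex_compact_base[OF A B] by metis
  have bC: "b \<in> C0_inf Q"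
    by (rule C0_infI[OF tensor_sum_Ck[OF b(1)] b(2,3,5)])
  obtain M0 where M0: "M0 > 0" "\<And>z. \<bar>b z\<bar> \<le> M0" using C0_inf_bounded[OF bC] by metis
  obtain M1 where M1: "M1 > 0" "\<And>z. \<bar>pd_x b z\<bar> \<le> M1" using C0_inf_bounded[OF C0_infD(3)[OF bC]] by metis
  obtain M2 where M2: "M2 > 0" "\<And>z. \<bar>pd_x (pd_x b) z\<bar> \<le> M2"
    using C0_inf_bounded[OF C0_infD(3)[OF C0_infD(3)[OF bC]]] by metis
  obtain M3 where M3: "M3 > 0" "\<And>z. \<bar>pd_t b z\<bar> \<le> M3" using C0_inf_bounded[OF C0_infD(2)[OF bC]] by metis
  let ?\<phi> = "approx b"
  note T = approx_pd(1)[OF b(1)]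
  have cont: "f \<in> borel_measurable borel" if "tensor_sum f" for f
    by (rule borel_measurable_continuous_onI[OF tensor_sum_continuous[OF that]])
  have inside: "pd_t (?\<phi> j) z = partial gt j z" "pd_x (pd_x (?\<phi> j)) z = partial gxx j z" if "z \<in> \<Omega> 0" for j z
    unfolding approx_pd(2,4)[OF b(1)] using b(6,7)[OF that] by (simp_all add: partial_def)
  have outside: "pd_t (?\<phi> j) z = pd_t b z" "pd_x (pd_x (?\<phi> j)) z = pd_x (pd_x b) z" if "z \<notin> \<Omega> 0" for j z
  proof -
    have "z \<notin> \<Omega> k" for k using that \<Omega>_mono[of 0 k] by auto
    then show "pd_t (?\<phi> j) z = pd_t b z" "pd_x (pd_x (?\<phi> j)) z = pd_x (pd_x b) z"
      unfolding approx_pd(2,4)[OF b(1)] by (simp_all add: pd_outside)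
  qed
  \<comment> \<open>\<open>C1\<close> bounds the residual outside \<open>\<Omega> 0\<close>, where
    only the cut-off polynomial acts. \<open>C2\<close> times the height bounds it on
    \<open>\<Omega> j\<close>, where both derivatives equal
    \<open>height \<kappa> j\<close>.\<close>
  define C1 where "C1 = M3 + inverse \<kappa> * M2"
  define C2 where "C2 = 1 + inverse \<kappa>"
  have C: "C1 \<ge> 0" "C2 \<ge> 0" using M2 M3 \<kappa> by (auto simp: C1_def C2_def)
  define L where "L = (C1 powr p * measure lebesgue Q + (C2 * (2 * h0)) powr p * d0) powr (1 / p)"
  have coeff_abs: "\<bar>coeff z * y\<bar> \<le> inverse \<kappa> * \<bar>y\<bar>" for y z
    unfolding abs_mult using coeff_bounds[of z] \<kappa> by (intro mult_right_mono) auto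
  define N where "N = (M0 + 2) + (M1 + 2) + L"
  define c where "c = d0 * (\<kappa> / 2) powr p"
  have "N > 0" "c > 0" using M0 M1 d0_pos \<kappa> by (auto simp: N_def L_def c_def add_pos_nonneg)
  moreover have "?\<phi> j \<in> C0_inf Q" for j
  proof (rule C0_infI[OF tensor_sum_Ck[OF T] b(2,3)])
    fix z assume z: "z \<notin> K"
    have "w k z = 0" for k
      using w_compact_support[of k] \<Omega>_mono[of 0 k] b(4) z by blast
    then show "?\<phi> j z = 0" using b(5)[OF z] by (simp add: approx_def)
  qed
  moreover have "Linf_norm Q (?\<phi> j) + Linf_norm Q (pd_x (?\<phi> j)) +
      Lp_norm p Q (\<lambda>z. pd_t (?\<phi> j) z - coeff z * pd_x (pd_x (?\<phi> j)) z) \<le> ereal N" for j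
  proof -
    have 1: "Linf_norm Q (?\<phi> j) \<le> ereal (M0 + 2)"
    proof (rule Linf_norm_le[OF cont[OF T]])
      show "\<bar>?\<phi> j z\<bar> \<le> M0 + 2" for z
        using M0(2)[of z] w_series(1)[where z = z and j = j] unfolding approx_def by linarith
    qed
    have 2: "Linf_norm Q (pd_x (?\<phi> j)) \<le> ereal (M1 + 2)"
    proof (rule Linf_norm_le[OF cont[OF tensor_sum_pd_x[OF T]]])
      show "\<bar>pd_x (?\<phi> j) z\<bar> \<le> M1 + 2" for z
        using M1(2)[of z] w_x_series(1)[where z = z and j = j] unfolding approx_pd(3)[OF b(1)] by linarith
    qed
    have 3: "Lp_norm p Q (\<lambda>z. pd_t (?\<phi> j) z - coeff z * pd_x (pd_x (?\<phi> j)) z) \<le> ereal L"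
      unfolding L_def
    proof (rule residual_Lp_norm[where j = j, OF _ C])
      note [measurable] = cont[OF tensor_sum_pd_t[OF T]] cont[OF tensor_sum_pd_x[OF tensor_sum_pd_x[OF T]]] coeff_measurable
      show "(\<lambda>z. pd_t (?\<phi> j) z - coeff z * pd_x (pd_x (?\<phi> j)) z) \<in> borel_measurable borel"
        by measurable
      show "AE z in lebesgue_on Q. \<bar>pd_t (?\<phi> j) z - coeff z * pd_x (pd_x (?\<phi> j)) z\<bar>
          \<le> (if z \<in> \<Omega> j then C2 * height \<kappa> j else C1)"
        using AE_Q_core
      proof eventually_elim
        case (elim z)
        then have "z \<notin> core" by simp
        have tri: "\<bar>s - coeff z * y\<bar> \<le> \<bar>s\<bar> + inverse \<kappa> * \<bar>y\<bar>" for s y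
          using abs_triangle_ineq4[of s "coeff z * y"] coeff_abs[of z y] by linarith
        show ?case
        proof (cases "z \<in> \<Omega> j")
          case True
          then have "z \<in> \<Omega> 0" using \<Omega>_mono[of 0 j] by auto
          then show ?thesis
            using True tri[of "height \<kappa> j" "height \<kappa> j"] height_ge[of j]
            by (simp add: inside partial_in[OF level_increment_w(1)] partial_in[OF level_increment_w(2)] C2_def distrib_right)
        next
          case no: False
          show ?thesis using \<open>z \<notin> core\<close>
          proof (cases rule: level_cases)
            case 1
            have "inverse \<kappa> * \<bar>pd_x (pd_x b) z\<bar> \<le> inverse \<kappa> * M2"
              using M2 \<kappa> by (intro mult_left_mono) auto
            then show ?thesis
              using no M3(2)[of z] tri[of "pd_t b z" "pd_x (pd_x b) z"]
              by (simp add: outside[OF 1] C1_def)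
          next
            case (2 n)
            \<comment> \<open>On a layer below \<open>j\<close> the truncated derivatives equal
              those of the solution, so the common coefficient makes the residual exactly 0.\<close>
            have "n < j" using 2 no \<Omega>_mono[of j n] by (meson not_less subsetD)
            moreover have "z \<in> \<Omega> 0" using 2 \<Omega>_mono[of 0 n] by auto
            ultimately have "pd_t (?\<phi> j) z = total gt z" "pd_x (pd_x (?\<phi> j)) z = total gxx z"
              using inside partial_level[OF level_increment_w(1) 2] partial_level[OF level_increment_w(2) 2]
                total_level[OF level_increment_w(1) 2] total_level[OF level_increment_w(2) 2] by auto
            then show ?thesis
              using coeff_equation[OF \<open>z \<notin> core\<close>] no C by simp
          qed
        qed
      qed
    qed
    have "Linf_norm Q (?\<phi> j) + Linf_norm Q (pd_x (?\<phi> j)) +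
      Lp_norm p Q (\<lambda>z. pd_t (?\<phi> j) z - coeff z * pd_x (pd_x (?\<phi> j)) z) \<le> ereal (M0 + 2) + ereal (M1 + 2) + ereal L"
      by (intro add_mono 1 2 3)
    then show ?thesis by (simp add: N_def)
  qed
  moreover have "(\<integral>z. \<bar>pd_x (pd_x (?\<phi> j)) z\<bar> powr p \<partial>lebesgue_on (\<Omega> 0)) \<ge> c * ln (real j)" if "j \<ge> 1" for j
    unfolding c_def
  proof (rule Lp_lower[OF _ _ that])
    show "AE z in lebesgue_on (\<Omega> 0). \<forall>n\<le>j. z \<in> \<Omega> n \<longrightarrow> \<kappa> * real n \<le> \<bar>pd_x (pd_x (?\<phi> j)) z\<bar>"
      using AE_D_core
    proof eventually_elim
      case (elim z)
      then show ?case
        using level_Lp_lower(1)[OF level_increment_w(2)] by (fastforce simp: inside(2))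
    qed
    have D: "pd_x (pd_x (?\<phi> j)) \<in> C0_inf Q"
      by (intro C0_infD(3) \<open>\<And>j. ?\<phi> j \<in> C0_inf Q\<close>)
    obtain M where M: "\<And>z. \<bar>pd_x (pd_x (?\<phi> j)) z\<bar> \<le> M" using C0_inf_bounded[OF D] by metis
    have const: "integrable (lebesgue_on (\<Omega> 0)) (\<lambda>_. M powr p)"
      by (rule finite_measure.integrable_const[OF finite_measure_lebesgue_on]) simp
    show "integrable (lebesgue_on (\<Omega> 0)) (\<lambda>z. \<bar>pd_x (pd_x (?\<phi> j)) z\<bar> powr p)"
    proof (rule Bochner_Integration.integrable_bound[OF const])
      have "pd_x (pd_x (?\<phi> j)) \<in> borel_measurable (lebesgue_on (\<Omega> 0))"
        by (intro borel_imp_lebesgue_on cont tensor_sum_pd_x T)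
      then show "(\<lambda>z. \<bar>pd_x (pd_x (?\<phi> j)) z\<bar> powr p) \<in> borel_measurable (lebesgue_on (\<Omega> 0))" by simp
      show "AE z in lebesgue_on (\<Omega> 0). norm (\<bar>pd_x (pd_x (?\<phi> j)) z\<bar> powr p) \<le> norm (M powr p)"
        using M \<kappa> by (intro AE_I2) (simp add: powr_mono2)
    qed
  qed
  ultimately show ?thesis by blast
qed

end

theorem theorem2p2:
  fixes D :: "(real \<times> real) set" and \<kappa> p :: real
  assumes "open_rectangle D" and "D \<noteq> {}" and "compactly_contained D Q_half"
    and "0 < \<kappa>" and "\<kappa> < 1" and "p = 2 / (1 - \<kappa>)"
  shows "\<exists>a :: real \<times> real \<Rightarrow> real.
    a \<in> borel_measurable (restrict_space borel Q) \<and> (\<forall>z\<in>Q. \<kappa> \<le> a z \<and> a z \<le> inverse \<kappa>) \<and>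
    (\<exists>u u\<^sub>t u\<^sub>x u\<^sub>x\<^sub>x.
       u \<in> W12_2 Q \<and>
       weak_deriv 1 0 Q u u\<^sub>t \<and> weak_deriv 0 1 Q u u\<^sub>x \<and> weak_deriv 0 2 Q u u\<^sub>x\<^sub>x \<and>
       (AE z in lebesgue_on Q. u\<^sub>t z - a z * u\<^sub>x\<^sub>x z = 0) \<and>
       bounded (u ` Q) \<and> continuous_on Q u \<and> bounded (u\<^sub>x ` Q) \<and> continuous_on Q u\<^sub>x \<and>
       (\<exists>c>0. \<exists>N>0. \<forall>\<^sub>F \<tau> in at_top.
          c * \<tau> powr (- p) \<le> measure lebesgue {z \<in> D. u\<^sub>x\<^sub>x z > \<tau>} \<and>
          measure lebesgue {z \<in> D. u\<^sub>x\<^sub>x z > \<tau>} \<le> N * \<tau> powr (- p)) \<and>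
       u\<^sub>t \<in> weak_Lp p D \<and> u\<^sub>x\<^sub>x \<in> weak_Lp p D \<and> u\<^sub>t \<notin> Lp p D \<and> u\<^sub>x\<^sub>x \<notin> Lp p D) \<and>
    (\<exists>(\<phi> :: nat \<Rightarrow> real \<times> real \<Rightarrow> real). \<exists>c>0. \<exists>N>0. \<forall>j\<ge>1.
       \<phi> j \<in> C0_inf Q \<and>
       Linf_norm Q (\<phi> j) + Linf_norm Q (pd_x (\<phi> j)) +
         Lp_norm p Q (\<lambda>z. pd_t (\<phi> j) z - a z * pd_x (pd_x (\<phi> j)) z) \<le> ereal N \<and>
       (\<integral>z. \<bar>pd_x (pd_x (\<phi> j)) z\<bar> powr p \<partial>lebesgue_on D) \<ge> c * ln (real j))"
proof -
  obtain t1 t2 x1 x2 where D: "D = {t1<..<t2} \<times> {x1<..<x2}"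
    using assms(1) unfolding open_rectangle_def by blast
  with assms(2) have lt: "t1 < t2" "x1 < x2" by auto
  have "closure D = {t1..t2} \<times> {x1..x2}"
    using lt by (simp add: D closure_Times)
  then have "{t1..t2} \<times> {x1..x2} \<subseteq> Q_half"
    using assms(3) by (simp add: compactly_contained_def)
  then have "(t1, x1) \<in> Q_half" "(t2, x2) \<in> Q_half"
    using lt by auto
  then have bds: "-1 < t1" "t2 < 0" "-1 < x1" "x2 < 1" by (auto simp: Q_half_def)
  have "{t1<..<t2} \<times> {x1<..<x2} \<subseteq> Q" "open {t1<..<t2}" "open {x1<..<x2}"
    "bounded {t1<..<t2}" "bounded {x1<..<x2}"
    "0 < measure lebesgue {t1<..<t2}" "0 < measure lebesgue {x1<..<x2}"
    using bds lt by (auto simp: Q_def)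
  \<comment> \<open>The staircase starts from the sides of \<open>D\<close> itself, so
    \<open>\<Omega> 0\<close> is \<open>D\<close> and all estimates on \<open>\<Omega> 0\<close> are
    estimates on \<open>D\<close>.\<close>
  then obtain A B w where stair: "staircase \<kappa> A B w" and AB: "A 0 = {t1<..<t2}" "B 0 = {x1<..<x2}"
    using ex_staircase[OF assms(4,5), of "{t1<..<t2}" "{x1<..<x2}"] by blast
  interpret staircase \<kappa> A B w by (rule stair)
  have \<Omega>: "\<Omega> 0 = D" by (simp add: \<Omega>_def AB D)
  have sub: "A 0 \<subseteq> {t1..t2}" "B 0 \<subseteq> {x1..x2}" by (auto simp: AB)
  note inc = level_increment_w
  have bdd: "bounded (sol ` Q)" "bounded (sol_x ` Q)"
    using sol_bounds(1,2) unfolding bounded_iff real_norm_def by blast+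
  show ?thesis
  proof (rule exI[of _ coeff], intro conjI, goal_cases measurable range solution test)
    case measurable
    show ?case by (rule measurable_restrict_space1[OF coeff_measurable])
  next
    case range
    show ?case using coeff_bounds by blast
  next
    case solution
    show ?case
    proof (rule exI[of _ sol], rule exI[of _ "total gt"], rule exI[of _ sol_x],
        rule exI[of _ "total gxx"], intro conjI)
      show "AE z in lebesgue_on Q. total gt z - coeff z * total gxx z = 0"
        using AE_Q_core by eventually_elim (simp add: coeff_equation)
      show "continuous_on Q sol" "continuous_on Q sol_x"
        using continuous_sol continuous_sol_x continuous_on_subset by blast+
      show "\<exists>c>0. \<exists>N>0. \<forall>\<^sub>F \<tau> in at_top.
            c * \<tau> powr (- p) \<le> measure lebesgue {z \<in> D. total gxx z > \<tau>} \<and>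
            measure lebesgue {z \<in> D. total gxx z > \<tau>} \<le> N * \<tau> powr (- p)"
        using total_tail[OF inc(2)] unfolding \<Omega> assms(6) .
      show "total gt \<in> weak_Lp p D" "total gxx \<in> weak_Lp p D"
        using total_weak_Lp inc unfolding \<Omega> assms(6) by blast+
      show "total gt \<notin> Lp p D" "total gxx \<notin> Lp p D"
        using not_Lp inc unfolding \<Omega> assms(6) by blast+
    qed (fact sol_W12_2 sol_weak_derivs bdd)+
  next
    case test
    show ?case
      using test_functions[OF sub(1) bds(1,2) sub(2) bds(3,4)] unfolding \<Omega> assms(6) .
  qed
qed

end
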